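(* Let $\xi$ be a positive random variable such that $\mathbb{P}(\xi>t)=t^{-\alpha}\ell(t)$ for all $t>0$, for some $\alpha\in(1,2)$ and some function $\ell$ slowly varying at $\infty$, and put $\mu=\mathbb{E}[\xi]<\infty$. Let $\xi_1,\xi_2,\ldots$ be independent copies of $\xi$, let $S_0=0$, $S_k=\xi_1+\ldots+\xi_k$ for $k\in\mathbb{N}$, and let $N(t)=\inf\{k\in\mathbb{N}:S_k>t\}$ for $t\ge0$. Let $c(t)$ be a positive function such that $\lim_{t\to\infty}t\,\ell(c(t))\,c(t)^{-\alpha}=1$, let $a(t)=\mu^{-(1+\alpha)/\alpha}c(t)$, and let $W$ be a random variable with characteristic function $$\mathbb{E}[e^{\mathrm{i}\lambda W}]=\exp\big\{-|\lambda|^\alpha\,\Gamma(1-\alpha)\big(\cos(\pi\alpha/2)+\mathrm{i}\sin(\pi\alpha/2)\,\mathrm{sgn}(\lambda)\big)\big\},\qquad\lambda\in\mathbb{R}.$$ Then, for every $\theta\ge0$, $$\lim_{t\to\infty}\mathbb{E}\left[\exp\left(\theta\,\frac{N(t)-t/\mu}{a(t)}\right)\right]=\mathbb{E}[e^{\theta W}]=e^{-\Gamma(1-\alpha)\theta^\alpha}.$$ Further, for all $p>0$, $$\lim_{t\to\infty}\frac{\mathbb{E}[(N(t)-t/\mu)_+^p]}{a(t)^p}=\mathbb{E}[W_+^p]\quad\text{and}\quad\lim_{t\to\infty}\frac{\mathbb{E}[(N(t)-t/\mu)_-^p]}{a(t)^p}=\mathbb{E}[W_-^p]$$ (as equalities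 in $[0,\infty]$), where $\mathbb{E}[W_+^p]<\infty$ for all $p>0$, and $\mathbb{E}[W_-^p]<\infty$ if and only if $p<\alpha$. In particular, for $p>0$, $$\lim_{t\to\infty}\frac{\mathbb{E}[|N(t)-t/\mu|^p]}{a(t)^p}=\mathbb{E}[|W|^p],$$ where $$\mathbb{E}[|W|^p]=\frac{2\Gamma(p+1)}{\pi p}\sin\Big(\frac{\pi p}{2}\Big)\Gamma\Big(1-\frac p\alpha\Big)|\Gamma(1-\alpha)|^{p/\alpha}\cos\Big(\frac{\pi p}{2}-\frac{\pi p}{\alpha}\Big)\quad\text{for }0<p<\alpha,$$ and $\mathbb{E}[|W|^p]=\infty$ for $p\ge\alpha$.
   Context: For real $x$, $x_+=\max\{x,0\}$ and $x_-=-\min\{x,0\}$. A function $\ell$ that is positive for all large arguments is slowly varying at $\infty$ if $\ell(xt)/\ell(t)\to1$ as $t\to\infty$ for every $x>0$. $\Gamma$ is Euler's gamma function; for $\alpha\in(1,2)$, $\Gamma(1-\alpha)=-\Gamma(2-\alpha)/(\alpha-1)$. *)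

theory Defs
  imports "HOL-Probability.Probability"
begin

definition slowly_varying :: "(real \<Rightarrow> real) \<Rightarrow> bool" where
  "slowly_varying l \<longleftrightarrow>
     (\<forall>\<^sub>F t in at_top. l t > 0) \<and>
     (\<forall>x>0. ((\<lambda>t. l (x * t) / l t) \<longlongrightarrow> 1) at_top)"

(* Steps are X 1, X 2, ...; the value X 0 is not used. *)
definition walk :: "(nat \<Rightarrow> 'b \<Rightarrow> real) \<Rightarrow> nat \<Rightarrow> 'b \<Rightarrow> real" where
  "walk X k \<omega> = (\<Sum>i=1..k. X i \<omega>)"

(* The infimum is taken in nat, so on the event that the walk never exceeds t
   the value is some unspecified natural number rather than infinity.  For i.i.d. positive steps this
   event has probability zero, so no expectation depends on that choice. *)
definition first_passage :: "(nat \<Rightarrow> 'b \<Rightarrow> real) \<Rightarrow> real \<Rightarrow> 'b \<Rightarrow> nat" where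
  "first_passage X t \<omega> = Inf {k. k \<ge> 1 \<and> walk X k \<omega> > t}"

end

theory Submission
  imports Defs
begin

text \<open>
  Write \<open>T x = P(\<xi> > x)\<close> and \<open>b t = \<mu> a t\<close>; then \<open>(t/\<mu>) T(b(t) y)\<close> tends to \<open>y powr (-\<alpha>)\<close>, with Potter bounds
  as dominating functions.  Dominated convergence in
  \<open>E(exp(-z\<xi>)) - 1 + z\<mu> = z \<integral> (1 - exp(-zx)) T x dx\<close> on the closed half plane \<open>Re z \<ge> 0\<close> gives at once the
  characteristic function and the one-sided exponential moments of the limit of \<open>(t - S\<^sub>n)/b(t)\<close>, \<open>n \<sim> t/\<mu>\<close>.
  The duality \<open>N(t) > n \<longleftrightarrow> S\<^sub>n \<le> t\<close> transfers the weak limit to \<open>Y t = (N(t) - t/\<mu>)/a(t)\<close>.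
  Uniform integrability comes from the exponential Markov inequality for the upper tail of \<open>Y t\<close> and, for
  the lower tail, from truncating the steps and Chebyshev's inequality, which gives
  \<open>P(-Y t > x) = O(x powr (-s))\<close> for every \<open>s < \<alpha>\<close>.  The absolute moments of \<open>W\<close> come from
  \<open>\<integral> (1 - Re (char W t)) t powr (-p-1) dt = c\<^sub>p E \<bar>W\<bar> powr p\<close>, whose left side is a Gamma integral.
\<close>

section \<open>Gamma integrals in the half plane\<close>

text \<open>The law of \<open>W\<close> is given only through its characteristic function, so its
  exponential moments have to be produced. They arise as limits of transforms of the walk at real
  arguments, which is why the Laplace asymptotics are proved on the whole closed half plane minus 0,
  with principal powers, and not only on the imaginary axis. The duality is used at an index
  depending on the level \<open>x\<close>: if n(t) is the integer part of t/\<mu> + x b(t)/\<mu>,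
  then t - \<mu> n(t) is about -x b(t), so adding \<open>x\<close> to (t - S_n)/b(t) removes the
  drift and every \<open>x\<close> leads to the same limit law. Moments are taken in
  [0,\<infinity>], so that divergence is a limit too. For p \<ge> \<alpha> lower semicontinuity
  under weak convergence suffices once the limiting moment is infinite. That infinity is read off
  from the pole of \<Gamma>(1 - q/\<alpha>) as q increases to \<alpha>, and it must sit in the
  negative part because all moments of the positive part are finite.\<close>

lemma has_bochner_integral_Gamma_scaled:
  fixes r b :: real assumes "r > 0" "b > 0"
  shows "has_bochner_integral lborel (\<lambda>x. indicator {0<..} x * (x powr (b - 1) * exp (- (r * x)))) (Gamma b * r powr (- b))"
proof (rule has_bochner_integral_nn_integral)
  have "(\<integral>\<^sup>+x. ennreal (indicator {0<..} x * (x powr (b - 1) * exp (- (r * x)))) \<partial>lborel)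
      = (\<integral>\<^sup>+x. ennreal (r powr (1 - b)) * ennreal (indicator {0..} (r * x) * (r * x) powr (b - 1) / exp (r * x)) \<partial>lborel)"
  proof (intro nn_integral_cong_AE eventually_mono[OF AE_lborel_singleton[of 0]])
    fix x :: real assume "x \<noteq> 0"
    show "ennreal (indicator {0<..} x * (x powr (b - 1) * exp (- (r * x)))) =
      ennreal (r powr (1 - b)) * ennreal (indicator {0..} (r * x) * (r * x) powr (b - 1) / exp (r * x))"
      using assms \<open>x \<noteq> 0\<close>
      by (auto simp: indicator_def ennreal_mult'[symmetric] powr_mult exp_minus field_simps
         zero_le_mult_iff powr_add[symmetric])
  qed
  also have "\<dots> = ennreal (r powr (1 - b)) * (\<integral>\<^sup>+x. ennreal (indicator {0..} (0 + r * x) * (0 + r * x) powr (b - 1) / exp (0 + r * x)) \<partial>lborel)"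
    by (subst nn_integral_cmult) auto
  also have "(\<integral>\<^sup>+x. ennreal (indicator {0..} (0 + r * x) * (0 + r * x) powr (b - 1) / exp (0 + r * x)) \<partial>lborel) = ennreal (1 / r) * ennreal (Gamma b)"
    unfolding Gamma_conv_nn_integral_real[OF \<open>b > 0\<close>]
    by (subst (2) nn_integral_real_affine[where c = r and t = 0])
       (use assms in \<open>auto simp: mult.assoc[symmetric] ennreal_mult'[symmetric]\<close>)
  also have "ennreal (r powr (1 - b)) * (ennreal (1 / r) * ennreal (Gamma b)) = ennreal (Gamma b * r powr (- b))"
    using assms by (simp add: ennreal_mult'[symmetric] powr_diff powr_minus field_simps Gamma_real_pos less_imp_le)
  finally show "(\<integral>\<^sup>+x. ennreal (indicator {0<..} x * (x powr (b - 1) * exp (- (r * x)))) \<partial>lborel) = ennreal (Gamma b * r powr (- b))" .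
qed (use assms in \<open>auto simp: Gamma_real_pos less_imp_le\<close>)

text \<open>The binomial series of (1 - q) powr (-b) comes with generalized binomial coefficients,
  whereas termwise integration produces rising factorials. The signs of coefficient and argument
  cancel.\<close>

lemma gbinomial_minus_pochhammer:
  "((- b :: 'a :: field_char_0) gchoose k) * (- q) ^ k = pochhammer b k / fact k * q ^ k"
proof -
  have "(- 1) ^ k * (- 1) ^ k = (1 :: 'a)" by (simp add: power_mult_distrib[symmetric])
  thus ?thesis unfolding gbinomial_pochhammer power_minus[of q k]
    by (simp add: field_simps)
qed

text \<open>Expand \<open>exp (- z x)\<close> about a real point \<open>r\<close> so large that \<open>\<bar>z - r\<bar> < r\<close>; integrating termwise yields
  the binomial series of \<open>z powr (-b)\<close>.\<close>
lemma Gamma_integral_complex_scaled: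
  fixes z :: complex and b :: real
  assumes z: "Re z > 0" and b: "b > 0"
  shows "has_bochner_integral lborel
    (\<lambda>x. indicator {0<..} x *\<^sub>R (of_real (x powr (b - 1)) * exp (- (z * of_real x))))
    (of_real (Gamma b) * z powr (- of_real b))"
proof -
  let ?g = "\<lambda>x. indicator {0<..} x *\<^sub>R (of_real (x powr (b - 1)) * exp (- (z * of_real x)))"
  \<comment> \<open>|r - z|^2 = r^2 - 2 r Re z + |z|^2 is below r^2 as soon as r > |z|^2 / (2 Re z);
    the summand 1 makes this strict.\<close>
  define r where "r = (cmod z)\<^sup>2 / (2 * Re z) + 1"
  have z0: "z \<noteq> 0" using z by auto
  have r0: "r > 0" using z by (simp add: r_def add_nonneg_pos)
  \<comment> \<open>So z = r (1 - w) with |w| < 1, and exp(-z x) = exp(-r x) exp(r w x);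
    \<open>f k\<close> below carries the k-th term of the series of the second factor.\<close>
  define w where "w = 1 - z / of_real r"
  let ?c = "\<lambda>k. pochhammer (of_real b) k / fact k * w ^ k" and ?C = "complex_of_real (Gamma b * r powr (- b))"
  have "(cmod (of_real r - z))\<^sup>2 < r\<^sup>2"
  proof -
    have "(cmod (of_real r - z))\<^sup>2 = r\<^sup>2 - 2 * r * Re z + (cmod z)\<^sup>2"
      by (simp add: cmod_power2 power2_diff)
    also have "2 * r * Re z = (cmod z)\<^sup>2 + 2 * Re z"
      using z by (simp add: r_def field_simps)
    finally show ?thesis using z by simp
  qed
  hence "cmod (of_real r - z) < r"
    using r0 by (simp add: power2_less_imp_less)
  moreover have rw: "of_real r - z = of_real r * w" using r0 by (simp add: w_def algebra_simps)
  ultimately have w1: "cmod w < 1" using r0 by (simp add: norm_mult)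
  define f where "f k x = (indicator {0<..} x * (x powr (b + real k - 1) * exp (- (r * x)))) *\<^sub>R
      ((of_real r * w) ^ k / fact k)" for k :: nat and x :: real
      let ?n = "\<lambda>k. norm ((complex_of_real r * w) ^ k / fact k)" and ?v = "\<lambda>k. (Gamma (b + real k) * r powr (- (b + real k)))"
  have G: "has_bochner_integral lborel (f k) (?v k *\<^sub>R ((of_real r * w) ^ k / fact k))" for k
    unfolding f_def
    by (rule has_bochner_integral_scaleR_left[OF has_bochner_integral_Gamma_scaled]) (use b r0 in auto)
  have val: "?v k *\<^sub>R ((of_real r * w) ^ k / fact k)
      = ?C * ?c k" for k
  proof -
    have "Gamma (b + real k) = pochhammer b k * Gamma b"
      proof -
      have "b \<notin> \<int>\<^sub>\<le>\<^sub>0" using b by (auto elim!: nonpos_Ints_cases)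
      thus ?thesis using pochhammer_Gamma[of b k] Gamma_real_pos[OF b] by (simp add: field_simps)
    qed
    moreover have "r powr (- (b + real k)) * r ^ k = r powr (- b)"
    proof -
      have "r ^ k = r powr real k" using r0 by (simp add: powr_realpow)
      thus ?thesis by (simp add: powr_add[symmetric])
    qed
    ultimately have "Gamma (b + real k) * r powr (- (b + real k)) * r ^ k = Gamma b * r powr (- b) * pochhammer b k"
      by (simp add: algebra_simps)
    hence "of_real (Gamma (b + real k) * r powr (- (b + real k)) * r ^ k) = (of_real (Gamma b * r powr (- b) * pochhammer b k) :: complex)"
      by simp
    thus ?thesis
      by (simp add: scaleR_conv_of_real power_mult_distrib pochhammer_of_real field_simps)
  qed
  \<comment> \<open>The norms integrate to the terms of the binomial series at |w|, whose
    convergence justifies exchanging sum and integral.\<close>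
  have nf: "has_bochner_integral lborel (\<lambda>x. norm (f k x)) (Gamma b * r powr (- b) * (pochhammer b k / fact k * cmod w ^ k))" for k
  proof -
    have "has_bochner_integral lborel (\<lambda>x. (indicator {0<..} x * (x powr (b + real k - 1) * exp (- (r * x)))) * ?n k)
       (?v k * ?n k)"
      by (rule has_bochner_integral_mult_left[OF has_bochner_integral_Gamma_scaled]) (use b r0 in auto)
    moreover have "?v k * ?n k = norm (?v k *\<^sub>R ((of_real r * w) ^ k / fact k))"
      using b by (simp add: Gamma_real_pos less_imp_le)
    moreover have "\<dots> = Gamma b * r powr (- b) * (pochhammer b k / fact k * cmod w ^ k)"
    proof -
      have "norm (pochhammer (complex_of_real b) k) = pochhammer b k"
        unfolding pochhammer_of_real norm_of_real using pochhammer_nonneg[of b k] b by simp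
      thus ?thesis unfolding val using b r0
        by (simp add: norm_mult norm_divide norm_power Gamma_real_pos less_imp_le abs_mult)
    qed
    moreover have "(\<lambda>x. (indicator {0<..} x * (x powr (b + real k - 1) * exp (- (r * x)))) * ?n k) = (\<lambda>x. norm (f k x))"
      by (auto simp: f_def fun_eq_iff abs_mult)
    ultimately show ?thesis by metis
  qed
  have sm: "(\<lambda>k. pochhammer b k / fact k * cmod w ^ k) sums ((1 - cmod w) powr (- b))"
    using gen_binomial_real[of "- cmod w" "- b"] w1 by (simp add: gbinomial_minus_pochhammer)
  have smc: "(\<lambda>k. pochhammer (of_real b) k / fact k * w ^ k) sums ((1 - w) powr (- of_real b))"
    using gen_binomial_complex[of "- w" "- of_real b"] w1 by (simp add: gbinomial_minus_pochhammer)
  have pw: "x powr (b + real k - 1) = x powr (b - 1) * x ^ k" if "x > 0" for x k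
  proof -
    have "x ^ k = x powr real k" using that by (simp add: powr_realpow)
    thus ?thesis by (simp add: powr_add[symmetric] algebra_simps)
  qed
  have ex: "(\<lambda>k. f k x) sums ?g x" for x
  proof (cases "x > 0")
    case True
    have "(\<lambda>k. (of_real r * w * of_real x) ^ k /\<^sub>R fact k) sums exp (of_real r * w * of_real x)"
      by (rule exp_converges)
    hence "(\<lambda>k. of_real (x powr (b - 1) * exp (- (r * x))) * ((of_real r * w * of_real x) ^ k /\<^sub>R fact k)) sums (of_real (x powr (b - 1) * exp (- (r * x))) * exp (of_real r * w * of_real x))"
      by (rule sums_mult)
    also have "of_real (x powr (b - 1) * exp (- (r * x))) * exp (of_real r * w * of_real x) = of_real (x powr (b - 1)) * exp (- (z * of_real x))"
      unfolding rw[symmetric] of_real_mult exp_of_real[symmetric] mult.assoc exp_add[symmetric]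
      by (simp add: algebra_simps)
    also have "(\<lambda>k. of_real (x powr (b - 1) * exp (- (r * x))) * ((of_real r * w * of_real x) ^ k /\<^sub>R fact k)) = (\<lambda>k. f k x)"
      using True by (auto simp: f_def fun_eq_iff scaleR_conv_of_real power_mult_distrib pw divide_inverse mult_ac)
    finally show ?thesis using True by simp
  qed (simp add: f_def)
  note S = integrable_suminf[of lborel f] sums_integral[of lborel f]
  have 1: "\<And>k. integrable lborel (f k)" using G by (auto simp: has_bochner_integral_iff)
  have 2: "summable (\<lambda>k. norm (f k x))" for x
  proof (cases "x > 0")
    case True
    have "summable (\<lambda>k. (x powr (b - 1) * exp (- (r * x))) * norm ((of_real r * w * of_real x) ^ k /\<^sub>R fact k))"
      by (intro summable_mult summable_norm_exp)
    also have "(\<lambda>k. (x powr (b - 1) * exp (- (r * x))) * norm ((of_real r * w * of_real x) ^ k /\<^sub>R fact k)) = (\<lambda>k. norm (f k x))"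
      using True r0 by (auto simp: f_def fun_eq_iff norm_mult norm_power norm_divide norm_inverse power_mult_distrib pw divide_inverse abs_mult mult_ac)
    finally show ?thesis .
  qed (simp add: f_def)
  have 3: "summable (\<lambda>k. \<integral>x. norm (f k x) \<partial>lborel)"
    using nf summable_mult[OF sums_summable[OF sm], of "Gamma b * r powr (- b)"] by (simp add: has_bochner_integral_iff)
  have I: "integrable lborel ?g"
    using S(1)[OF 1 _ 3] 2 sums_unique[OF ex, symmetric] by simp
  have "(\<lambda>k. integral\<^sup>L lborel (f k)) sums integral\<^sup>L lborel ?g"
    using S(2)[OF 1 _ 3] 2 sums_unique[OF ex, symmetric] by simp
  moreover have "integral\<^sup>L lborel (f k) = ?C * ?c k" for k
    using G[of k] val[of k] by (auto simp: has_bochner_integral_iff)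
  ultimately have "(\<lambda>k. ?C * ?c k) sums integral\<^sup>L lborel ?g"
    by simp
  from sums_unique2[OF this sums_mult[OF smc]]
  have "integral\<^sup>L lborel ?g = ?C * (1 - w) powr (- of_real b)" .
  also have "\<dots> = of_real (Gamma b) * z powr (- of_real b)"
  proof -
    \<comment> \<open>Splitting off a positive real factor causes no jump of the principal
      power.\<close>
    have "z = of_real r * (1 - w)" using r0 by (simp add: w_def)
    hence "z powr (- of_real b) = of_real r powr (- of_real b) * (1 - w) powr (- of_real b)"
      using powr_times_real_left[of "of_real r" "1 - w"] r0 by simp
    moreover have "complex_of_real r powr (- of_real b) = of_real (r powr (- b))"
      using powr_of_real[of r "- b"] r0 by simp
    ultimately show ?thesis by simp
  qed
  finally show ?thesis using I by (simp add: has_bochner_integral_iff)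
qed

lemma has_bochner_integral_powr_to_inf:
  fixes a e :: real assumes "e < -1" "a > 0"
  shows "has_bochner_integral lborel (\<lambda>x. indicator {a..} x * x powr e) (- (a powr (e + 1)) / (e + 1))"
proof (rule has_bochner_integral_nn_integral)
  show "(\<integral>\<^sup>+x. ennreal (indicator {a..} x * x powr e) \<partial>lborel) = ennreal (- (a powr (e + 1)) / (e + 1))"
    using nn_integral_has_integral_lebesgue[OF _ has_integral_powr_to_inf[OF assms]] by simp
qed (use assms in \<open>auto simp: divide_nonneg_neg divide_nonpos_neg\<close>)

lemma has_bochner_integral_powr_from_0:
  fixes a c :: real assumes "a > -1" "c \<ge> 0"
  shows "has_bochner_integral lborel (\<lambda>x. indicator {0..c} x * x powr a) (c powr (a + 1) / (a + 1))"
proof (rule has_bochner_integral_nn_integral)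
  show "(\<integral>\<^sup>+x. ennreal (indicator {0..c} x * x powr a) \<partial>lborel) = ennreal (c powr (a + 1) / (a + 1))"
    using nn_integral_has_integral_lebesgue[OF _ has_integral_powr_from_0[OF assms]] by simp
qed (use assms in auto)

text \<open>Mean value inequality on the convex half plane, where the derivative has norm at most 1.
  Together with the uniform bound 2 below it controls \<open>1 - exp (- (z * x))\<close> both near 0
  and at infinity.\<close>

lemma norm_one_minus_exp_le:
  fixes z :: complex assumes "Re z \<ge> 0"
  shows "norm (1 - exp (- z)) \<le> norm z"
proof -
  have "norm ((\<lambda>w. exp (- w)) 0 - (\<lambda>w. exp (- w)) z) \<le> 1 * norm (0 - z)"
  proof (rule field_differentiable_bound)
    show "convex {w. Re w \<ge> 0}" by (rule convex_halfspace_Re_ge)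
    show "((\<lambda>w. exp (- w)) has_field_derivative - exp (- w)) (at w within {w. Re w \<ge> 0})" for w :: complex
      by (auto intro!: derivative_eq_intros)
  qed (use assms in auto)
  thus ?thesis by simp
qed

lemma norm_one_minus_exp_le_2:
  fixes z :: complex assumes "Re z \<ge> 0"
  shows "norm (1 - exp (- z)) \<le> 2"
proof -
  have "norm (1 - exp (- z)) \<le> norm (1::complex) + norm (exp (- z))" by (rule norm_triangle_ineq4)
  also have "\<dots> \<le> 2" using assms by simp
  finally show ?thesis .
qed

lemma has_bochner_integral_exp_segment:
  fixes z :: complex assumes "u \<ge> 0"
  shows "has_bochner_integral lborel (\<lambda>v. indicator {0..u} v *\<^sub>R (z * exp (- (z * of_real v)))) (1 - exp (- (z * of_real u)))"
proof -
  have "has_bochner_integral lborel (\<lambda>v. indicator {0..u} v *\<^sub>R (z * exp (- (z * of_real v))))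
      ((\<lambda>v. - exp (- (z * of_real v))) u - (\<lambda>v. - exp (- (z * of_real v))) 0)"
  proof (rule has_bochner_integral_FTC_Icc)
    show "((\<lambda>v. - exp (- (z * of_real v))) has_vector_derivative z * exp (- (z * of_real x))) (at x within {0..u})" for x
      by (auto intro!: derivative_eq_intros has_vector_derivative_real_field simp: mult_ac)
  qed (use assms in \<open>auto intro!: continuous_intros\<close>)
  thus ?thesis by (simp add: algebra_simps)
qed

text \<open>Replace 1 - exp(-z u) by the integral of z exp(-z v) over 0 < v < u and exchange the
  order: integrating u powr (-\<beta>-1) over u > v leaves v powr (-\<beta>) / \<beta>, hence a
  Gamma integral of order 1 - \<beta>. Re z > 0 makes the double integral absolutely
  convergent.\<close>

lemma Gamma_neg_integral_aux:
  fixes z :: complex and \<beta> :: real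
  assumes z: "Re z > 0" and \<beta>: "0 < \<beta>" "\<beta> < 1"
  shows "integral\<^sup>L lborel (\<lambda>u. indicator {0<..} u *\<^sub>R (of_real (u powr (- \<beta> - 1)) * (1 - exp (- (z * of_real u)))))
    = of_real (Gamma (1 - \<beta>) / \<beta>) * z powr of_real \<beta>"
proof -
  have z0: "z \<noteq> 0" using z by auto
  define f where "f v u = (indicator {0<..} v * indicator {v..} u * u powr (- \<beta> - 1)) *\<^sub>R (z * exp (- (z * of_real v)))" for u v :: real
  have [measurable]: "case_prod f \<in> borel_measurable (lborel \<Otimes>\<^sub>M lborel)"
  proof -
    have "case_prod f = (\<lambda>(v, u). ((if 0 < v \<and> v \<le> u then 1 else 0) * u powr (- \<beta> - 1)) *\<^sub>R (z * exp (- (z * of_real v))))"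
      by (auto simp: f_def fun_eq_iff indicator_def)
    thus ?thesis by simp
  qed
  have inner: "has_bochner_integral lborel (\<lambda>u. indicator {v..} u * u powr (- \<beta> - 1)) (v powr (- \<beta>) / \<beta>)" if "v > 0" for v
    using has_bochner_integral_powr_to_inf[of "- \<beta> - 1" v] that \<beta> by simp
  have fu: "has_bochner_integral lborel (f v) ((indicator {0<..} v * (v powr (- \<beta>) / \<beta>)) *\<^sub>R (z * exp (- (z * of_real v))))" for v
  proof (cases "v > 0")
    case True
    from has_bochner_integral_scaleR_left[OF inner[OF True], of "z * exp (- (z * of_real v))"] True
    show ?thesis by (simp add: f_def[abs_def])
  qed (simp add: f_def[abs_def] has_bochner_integral_zero)
  have nfu: "(LINT u|lborel. norm (f v u)) = norm (z / \<beta>) * (indicator {0<..} v * (v powr (1 - \<beta> - 1) * exp (- (Re z * v))))" for v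
  proof (cases "v > 0")
    case True
    have "(LINT u|lborel. norm (f v u)) = (LINT u|lborel. (indicator {v..} u * u powr (- \<beta> - 1)) * norm (z * exp (- (z * of_real v))))"
      using True by (intro Bochner_Integration.integral_cong) (auto simp: f_def indicator_def)
    also have "\<dots> = v powr (- \<beta>) / \<beta> * norm (z * exp (- (z * of_real v)))"
      using has_bochner_integral_mult_left[OF inner[OF True], of "norm (z * exp (- (z * of_real v)))"]
      by (simp add: has_bochner_integral_iff)
    finally show ?thesis using True \<beta> by (simp add: norm_mult norm_divide)
  qed (simp add: f_def)
  have int: "integrable (lborel \<Otimes>\<^sub>M lborel) (case_prod f)"
  proof (rule lborel_pair.Fubini_integrable)
    show "integrable lborel (\<lambda>v. LINT u|lborel. norm (case_prod f (v, u)))"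
      using has_bochner_integral_Gamma_scaled[of "Re z" "1 - \<beta>"] z \<beta>
      by (simp add: nfu has_bochner_integral_iff)
  qed (use fu in \<open>auto simp: has_bochner_integral_iff\<close>)
  have "(LINT u|lborel. LINT v|lborel. f v u) = (LINT v|lborel. LINT u|lborel. f v u)"
    by (rule lborel_pair.Fubini_integral[OF int])
  also have "(LINT v|lborel. LINT u|lborel. f v u) = (LINT v|lborel. (z / of_real \<beta>) * (indicator {0<..} v *\<^sub>R (of_real (v powr (1 - \<beta> - 1)) * exp (- (z * of_real v)))))"
    using fu by (intro Bochner_Integration.integral_cong) (auto simp: has_bochner_integral_iff indicator_def scaleR_conv_of_real)
  also have "\<dots> = (z / of_real \<beta>) * (of_real (Gamma (1 - \<beta>)) * z powr (- of_real (1 - \<beta>)))"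
    using Gamma_integral_complex_scaled[OF z, of "1 - \<beta>"] \<beta>
    by (simp only: integral_mult_right_zero) (simp add: has_bochner_integral_iff)
  also have "\<dots> = of_real (Gamma (1 - \<beta>) / \<beta>) * z powr of_real \<beta>"
    using z0 by (simp add: powr_diff field_simps)
  also have "(LINT u|lborel. LINT v|lborel. f v u) = (LINT u|lborel. indicator {0<..} u *\<^sub>R (of_real (u powr (- \<beta> - 1)) * (1 - exp (- (z * of_real u)))))"
  proof (intro Bochner_Integration.integral_cong refl)
    fix u :: real
    show "(LINT v|lborel. f v u) = indicator {0<..} u *\<^sub>R (of_real (u powr (- \<beta> - 1)) * (1 - exp (- (z * of_real u))))"
    proof (cases "u > 0")
      case True
      have "(LINT v|lborel. f v u) = (LINT v|lborel. of_real (u powr (- \<beta> - 1)) * (indicator {0..u} v *\<^sub>R (z * exp (- (z * of_real v)))))"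
        by (intro integral_cong_AE eventually_mono[OF AE_lborel_singleton[of 0]])
           (auto simp: f_def indicator_def scaleR_conv_of_real)
      also have "\<dots> = of_real (u powr (- \<beta> - 1)) * (1 - exp (- (z * of_real u)))"
        using has_bochner_integral_exp_segment[of u z] True
        by (simp only: integral_mult_right_zero) (simp add: has_bochner_integral_iff)
      finally show ?thesis using True by simp
    next
      case False
      hence "f v u = 0" for v by (auto simp: f_def indicator_def)
      thus ?thesis using False by simp
    qed
  qed
  finally show ?thesis .
qed

text \<open>The restriction \<open>Re z \<ge> 0\<close>, rather than \<open>Re z > 0\<close>, matters: the boundary case gives
  characteristic functions.\<close>
lemma Gamma_neg_integral:
  fixes z :: complex and \<beta> :: real
  assumes z: "Re z \<ge> 0" "z \<noteq> 0" and \<beta>: "0 < \<beta>" "\<beta> < 1"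
  shows "has_bochner_integral lborel (\<lambda>u. indicator {0<..} u *\<^sub>R (of_real (u powr (- \<beta> - 1)) * (1 - exp (- (z * of_real u)))))
    (of_real (Gamma (1 - \<beta>) / \<beta>) * z powr of_real \<beta>)"
proof -
  define g where "g w = (\<lambda>u. indicator {0<..} u *\<^sub>R (of_real (u powr (- \<beta> - 1)) * (1 - exp (- (w * of_real u)))))" for w :: complex
  \<comment> \<open>One majorant for all w in the half plane with |w| \<le> |z| + 1: the linear
    bound on [0,1], the bound 2 beyond. It gives integrability at z itself and the passage to the
    limit from the interior points z + 1/(n+1).\<close>
  define h where "h u = (cmod z + 1) * (indicator {0..1} u * u powr (- \<beta>)) + 2 * (indicator {1..} u * u powr (- \<beta> - 1))" for u :: real
  have h: "integrable lborel h"
    using has_bochner_integral_powr_from_0[of "- \<beta>" 1] has_bochner_integral_powr_to_inf[of "- \<beta> - 1" 1] \<beta>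
    unfolding h_def by (intro Bochner_Integration.integrable_add integrable_mult_right) (auto simp: has_bochner_integral_iff)
  have gm[measurable]: "g w \<in> borel_measurable lborel" for w unfolding g_def by measurable
  have gh: "norm (g w u) \<le> h u" if w: "Re w \<ge> 0" "cmod w \<le> cmod z + 1" for w u
  proof (cases "u > 0")
    case True
    have Re: "Re (w * of_real u) \<ge> 0" using w True by simp
    have "norm (1 - exp (- (w * of_real u))) \<le> (cmod z + 1) * u"
      using norm_one_minus_exp_le[OF Re] w True
      by (auto simp: norm_mult intro: order_trans mult_right_mono)
    hence 1: "norm (g w u) \<le> u powr (- \<beta> - 1) * ((cmod z + 1) * u)"
      using True by (simp add: g_def norm_mult)
    have 2: "norm (g w u) \<le> u powr (- \<beta> - 1) * 2"
      using norm_one_minus_exp_le_2[OF Re] True by (simp add: g_def norm_mult)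
    have e: "u powr (- \<beta> - 1) * u = u powr (- \<beta>)" using True by (simp add: powr_diff)
    have e2: "u powr (- \<beta> - 1) * ((cmod z + 1) * u) = (cmod z + 1) * u powr (- \<beta>)" unfolding e[symmetric] by (simp only: mult_ac)
    have 1: "norm (g w u) \<le> (cmod z + 1) * u powr (- \<beta>)" using 1 unfolding e2 by assumption
    show ?thesis
    proof (cases "u \<le> 1")
      case True thus ?thesis using 1 \<open>u > 0\<close> by (auto simp: h_def indicator_def)
    next
      case False thus ?thesis using 2 \<open>u > 0\<close> by (auto simp: h_def indicator_def)
    qed
  next
    case False thus ?thesis by (auto simp: g_def h_def indicator_def)
  qed
  have gi: "integrable lborel (g z)"
    by (rule Bochner_Integration.integrable_bound[OF h]) (use gh[of z] z in \<open>auto intro: order_trans[OF _ abs_ge_self]\<close>)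
  define w where "w n = z + of_real (1 / real (Suc n))" for n
  have wlim: "w \<longlonglongrightarrow> z"
    unfolding w_def using tendsto_add[OF tendsto_const[of z] tendsto_of_real[OF LIMSEQ_inverse_real_of_nat]]
    by (simp add: inverse_eq_divide)
  have "(\<lambda>n. integral\<^sup>L lborel (g (w n))) \<longlonglongrightarrow> integral\<^sup>L lborel (g z)"
  proof (rule integral_dominated_convergence[OF _ _ h])
    show "AE u in lborel. (\<lambda>n. g (w n) u) \<longlonglongrightarrow> g z u"
      unfolding g_def by (auto intro!: tendsto_intros wlim)
    show "AE u in lborel. norm (g (w n) u) \<le> h u" for n
    proof (intro AE_I2 gh)
      show "Re (w n) \<ge> 0" using z by (simp add: w_def)
      have "cmod (w n) \<le> cmod z + cmod (of_real (1 / real (Suc n)))" unfolding w_def by (rule norm_triangle_ineq)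
      also have "\<dots> \<le> cmod z + 1" by (simp add: norm_divide del: of_real_divide)
      finally show "cmod (w n) \<le> cmod z + 1" .
    qed
  qed auto
  moreover have "integral\<^sup>L lborel (g (w n)) = of_real (Gamma (1 - \<beta>) / \<beta>) * w n powr of_real \<beta>" for n
    unfolding g_def by (rule Gamma_neg_integral_aux) (use z \<beta> in \<open>auto simp: w_def add_nonneg_pos\<close>)
  moreover have "(\<lambda>n. of_real (Gamma (1 - \<beta>) / \<beta>) * w n powr of_real \<beta>) \<longlonglongrightarrow> of_real (Gamma (1 - \<beta>) / \<beta>) * z powr of_real \<beta>"
  proof -
    \<comment> \<open>A nonzero point of the closed half plane stays off the branch cut, so the
      principal power is continuous there.\<close>
    have "z \<notin> \<real>\<^sub>\<le>\<^sub>0" using z by (auto simp: complex_nonpos_Reals_iff complex_eq_iff)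
    thus ?thesis by (intro tendsto_intros wlim) auto
  qed
  ultimately have "integral\<^sup>L lborel (g z) = of_real (Gamma (1 - \<beta>) / \<beta>) * z powr of_real \<beta>"
    using LIMSEQ_unique by simp blast
  with gi show ?thesis by (simp add: has_bochner_integral_iff g_def)
qed

section \<open>Absolute moments expressed through the characteristic function\<close>

lemma nn_integral_powr_substitution:
  fixes f :: "real \<Rightarrow> ennreal" and c :: real
  assumes [measurable]: "f \<in> borel_measurable borel" and c: "c > 0"
  shows "(\<integral>\<^sup>+x. f x * indicator {0<..} x \<partial>lborel)
    = (\<integral>\<^sup>+t. f (t powr c) * ennreal (c * t powr (c - 1)) * indicator {0<..} t \<partial>lborel)"
proof -
  \<comment> \<open>The change of variables is done on compact intervals away from 0, where t powr c
    is continuously differentiable; these exhaust the half line and monotone convergence concludes.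
    The offset 2 keeps the left endpoint strictly below the right one even for n = 0.\<close>
  define A where "A n = {1 / real (n + 2) .. real (n + 2)}" for n
  define B where "B n = {(1 / real (n + 2)) powr c .. real (n + 2) powr c}" for n
  have cover: "(SUP n. h t * indicator (S n) t) = h t * indicator (\<Union>n. S n) t" for h :: "real \<Rightarrow> ennreal" and t and S :: "nat \<Rightarrow> real set"
  proof (cases "t \<in> (\<Union>n. S n)")
    case True
    then obtain n where "t \<in> S n" by auto
    thus ?thesis using True by (auto intro!: antisym SUP_least SUP_upper2[of n] simp: indicator_def)
  qed auto
  have incA: "incseq A" 
  proof (rule incseq_SucI)
    fix n show "A n \<subseteq> A (Suc n)" by (auto simp: A_def intro: order_trans[rotated] frac_le)
  qed
  have incB: "incseq B"
  proof (rule incseq_SucI)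
    fix n
    have "(1 / real (Suc n + 2)) powr c \<le> (1 / real (n + 2)) powr c" "real (n + 2) powr c \<le> real (Suc n + 2) powr c"
      using c by (auto intro!: powr_mono2 frac_le)
    thus "B n \<subseteq> B (Suc n)" by (auto simp: B_def)
  qed
  have UA: "(\<Union>n. A n) = {0<..}"
  proof safe
    fix t :: real assume t: "t > 0"
    obtain n where "real n > max t (1 / t)" using reals_Archimedean2 by blast
    hence n: "real n > t" "real n > 1 / t" by auto
    hence "t * real n > 1" using t by (simp add: field_simps)
    hence "t \<in> A n" using t n by (auto simp: A_def field_simps)
    thus "t \<in> (\<Union>n. A n)" by blast
  qed (auto simp: A_def intro: less_le_trans[rotated])
  have BA: "x \<in> B n \<longleftrightarrow> x > 0 \<and> x powr (1 / c) \<in> A n" for x n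
  proof -
    have *: "s powr c \<le> x \<longleftrightarrow> s \<le> x powr (1 / c)" "x \<le> s powr c \<longleftrightarrow> x powr (1 / c) \<le> s" if "s > 0" "x > 0" for s
    proof -
      have "x = (x powr (1 / c)) powr c" using that c by (simp add: powr_powr)
      moreover have "s powr c \<le> (x powr (1 / c)) powr c \<longleftrightarrow> s \<le> x powr (1 / c)"
        "(x powr (1 / c)) powr c \<le> s powr c \<longleftrightarrow> x powr (1 / c) \<le> s"
        using powr_less_mono2[of c "x powr (1 / c)" s] powr_mono2[of c "x powr (1 / c)" s]
          powr_less_mono2[of c s "x powr (1 / c)"] powr_mono2[of c s "x powr (1 / c)"] that c
        by (auto simp: not_less[symmetric])
      ultimately show "s powr c \<le> x \<longleftrightarrow> s \<le> x powr (1 / c)" "x \<le> s powr c \<longleftrightarrow> x powr (1 / c) \<le> s" by simp_all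
    qed
    have "x > 0" if "x \<in> B n"
    proof -
      have "0 < (1 / real (n + 2)) powr c" by simp
      also have "\<dots> \<le> x" using that by (simp add: B_def)
      finally show ?thesis .
    qed
    moreover have "x \<in> B n \<longleftrightarrow> x powr (1 / c) \<in> A n" if "x > 0"
      using *[of "1 / real (n + 2)"] *[of "real (n + 2)"] that by (simp add: A_def B_def)
    ultimately show ?thesis by blast
  qed
  have UB: "(\<Union>n. B n) = {0<..}" using BA UA by (auto simp: set_eq_iff)
  have sub: "(\<integral>\<^sup>+x. f x * indicator (B n) x \<partial>lborel) = (\<integral>\<^sup>+t. f (t powr c) * ennreal (c * t powr (c - 1)) * indicator (A n) t \<partial>lborel)" for n
    unfolding A_def B_def
  proof (rule nn_integral_substitution_aux)
    show "1 / real (n + 2) < real (n + 2)" by (simp add: field_simps) (smt (verit) mult_nonneg_nonneg of_nat_0_le_iff)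
    have pos: "t > 0" if "t \<in> {1 / real (n + 2)..real (n + 2)}" for t
      using that by (auto intro: less_le_trans[rotated])
    show "((\<lambda>t. t powr c) has_real_derivative c * t powr (c - 1)) (at t)" if "t \<in> {1 / real (n + 2)..real (n + 2)}" for t
      using pos[OF that] by (auto intro!: derivative_eq_intros simp: powr_diff)
    show "continuous_on {1 / real (n + 2)..real (n + 2)} (\<lambda>t. c * t powr (c - 1))"
      using pos by (intro continuous_intros) fastforce+
    show "c * t powr (c - 1) \<ge> 0" for t using c by simp
  qed auto
  have mono: "incseq (\<lambda>n t. h t * indicator (S n) t)" if "incseq S" for h :: "real \<Rightarrow> ennreal" and S :: "nat \<Rightarrow> real set"
    using that by (auto simp: incseq_def le_fun_def indicator_def subset_eq)
  have [measurable]: "A n \<in> sets borel" "B n \<in> sets borel" for n by (auto simp: A_def B_def)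
  have "(\<integral>\<^sup>+x. f x * indicator {0<..} x \<partial>lborel) = (SUP n. \<integral>\<^sup>+x. f x * indicator (B n) x \<partial>lborel)"
    using nn_integral_monotone_convergence_SUP[OF mono[OF incB], of f lborel] unfolding cover UB by simp
  also have "\<dots> = (\<integral>\<^sup>+t. f (t powr c) * ennreal (c * t powr (c - 1)) * indicator {0<..} t \<partial>lborel)"
    using nn_integral_monotone_convergence_SUP[OF mono[OF incA], of "\<lambda>t. f (t powr c) * ennreal (c * t powr (c - 1))" lborel]
    unfolding cover[where h = "\<lambda>t. f (t powr c) * ennreal (c * t powr (c - 1))" and S = A] UA sub by simp
  finally show ?thesis .
qed

lemma nn_integral_Gamma_scaled:
  fixes r b :: real assumes "r > 0" "b > 0"
  shows "(\<integral>\<^sup>+x. ennreal (x powr (b - 1) * exp (- (r * x))) * indicator {0<..} x \<partial>lborel) = ennreal (Gamma b * r powr (- b))"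
proof -
  have "(\<integral>\<^sup>+x. ennreal (indicator {0<..} x * (x powr (b - 1) * exp (- (r * x)))) \<partial>lborel) = ennreal (Gamma b * r powr (- b))"
    using has_bochner_integral_Gamma_scaled[OF assms]
    by (subst nn_integral_eq_integral) (auto simp: has_bochner_integral_iff)
  thus ?thesis by (simp add: indicator_mult_ennreal mult.commute ennreal_mult' flip: ennreal_indicator)
qed

text \<open>Euler's Beta integral: write 1/(1+v) as the integral of exp(-(1+v) s) over s > 0 and
  integrate over v first.\<close>

lemma nn_integral_powr_over_one_plus:
  fixes q :: real assumes q: "0 < q" "q < 1"
  shows "(\<integral>\<^sup>+v. ennreal (v powr (q - 1) / (1 + v)) * indicator {0<..} v \<partial>lborel) = ennreal (Gamma q * Gamma (1 - q))"
proof -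
  define F where "F v s = ennreal (v powr (q - 1) * exp (- ((1 + v) * s))) * indicator {0<..} v * indicator {0<..} s" for v s :: real
  have [measurable]: "case_prod F \<in> borel_measurable (lborel \<Otimes>\<^sub>M lborel)" unfolding F_def by measurable
  have 1: "(\<integral>\<^sup>+s. F v s \<partial>lborel) = ennreal (v powr (q - 1) / (1 + v)) * indicator {0<..} v" for v
  proof (cases "v > 0")
    case True
    have "(\<integral>\<^sup>+s. F v s \<partial>lborel) = (\<integral>\<^sup>+s. ennreal (v powr (q - 1)) * (ennreal (s powr (1 - 1) * exp (- ((1 + v) * s))) * indicator {0<..} s) \<partial>lborel)"
      using True by (intro nn_integral_cong) (auto simp: F_def indicator_def ennreal_mult')
    also have "\<dots> = ennreal (v powr (q - 1)) * ennreal (Gamma 1 * (1 + v) powr (- 1))"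
      using nn_integral_Gamma_scaled[of "1 + v" 1] True by (subst nn_integral_cmult) auto
    finally show ?thesis using True by (simp add: powr_minus divide_inverse ennreal_mult')
  qed (simp add: F_def)
  have 2: "(\<integral>\<^sup>+v. F v s \<partial>lborel) = ennreal (Gamma q) * (ennreal (s powr ((1 - q) - 1) * exp (- (1 * s))) * indicator {0<..} s)" for s
  proof (cases "s > 0")
    case True
    have "(\<integral>\<^sup>+v. F v s \<partial>lborel) = (\<integral>\<^sup>+v. ennreal (exp (- s)) * (ennreal (v powr (q - 1) * exp (- (s * v))) * indicator {0<..} v) \<partial>lborel)"
      using True by (intro nn_integral_cong) (auto simp: F_def indicator_def ennreal_mult'[symmetric] mult_ac exp_add[symmetric] algebra_simps)
    also have "\<dots> = ennreal (exp (- s)) * ennreal (Gamma q * s powr (- q))"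
      using nn_integral_Gamma_scaled[of s q] True q by (subst nn_integral_cmult) auto
    finally show ?thesis using True q
      by (simp add: ennreal_mult'[symmetric] Gamma_real_pos less_imp_le mult_ac)
  qed (simp add: F_def)
  have "(\<integral>\<^sup>+v. \<integral>\<^sup>+s. F v s \<partial>lborel \<partial>lborel) = (\<integral>\<^sup>+s. \<integral>\<^sup>+v. F v s \<partial>lborel \<partial>lborel)"
    by (rule lborel_pair.Fubini'[symmetric]) simp
  also have "\<dots> = ennreal (Gamma q) * ennreal (Gamma (1 - q) * 1 powr (- (1 - q)))"
    unfolding 2 using nn_integral_Gamma_scaled[of 1 "1 - q"] q by (subst nn_integral_cmult) auto
  finally show ?thesis using q by (simp add: 1 ennreal_mult' Gamma_real_pos less_imp_le)
qed

text \<open>The cosine contributes the real part of the Gamma integral of order 1 at the point x -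
  i, which is x/(1 + x^2); it is subtracted from 1/x.\<close>

lemma nn_integral_one_minus_cos_exp:
  fixes x :: real assumes x: "x > 0"
  shows "(\<integral>\<^sup>+t. ennreal ((1 - cos t) * exp (- (x * t))) * indicator {0<..} t \<partial>lborel) = ennreal (1 / (x * (1 + x\<^sup>2)))"
proof -
  define z where "z = Complex x (- 1)"
  have z: "Re z > 0" "z \<noteq> 0" using x by (auto simp: z_def complex_eq_iff)
  have r: "has_bochner_integral lborel (\<lambda>t. indicator {0<..} t * (t powr (1 - 1) * exp (- (x * t)))) (1 / x)"
    using has_bochner_integral_Gamma_scaled[of x 1] x by (simp add: powr_minus divide_inverse)
  have c: "has_bochner_integral lborel (\<lambda>t. indicator {0<..} t *\<^sub>R (of_real (t powr (1 - 1)) * exp (- (z * of_real t)))) (1 / z)"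
    using Gamma_integral_complex_scaled[of z 1] z by (simp add: powr_minus divide_inverse)
  have "has_bochner_integral lborel (\<lambda>t. Re (indicator {0<..} t *\<^sub>R (of_real (t powr (1 - 1)) * exp (- (z * of_real t))))) (Re (1 / z))"
    by (rule has_bochner_integral_bounded_linear[OF bounded_linear_Re c])
  from has_bochner_integral_diff[OF r this]
  have d: "has_bochner_integral lborel (\<lambda>t. indicator {0<..} t * (t powr (1 - 1) * exp (- (x * t))) - Re (indicator {0<..} t *\<^sub>R (of_real (t powr (1 - 1)) * exp (- (z * of_real t))))) (1 / x - Re (1 / z))" .
  also have "(\<lambda>t. indicator {0<..} t * (t powr (1 - 1) * exp (- (x * t))) - Re (indicator {0<..} t *\<^sub>R (of_real (t powr (1 - 1)) * exp (- (z * of_real t))))) = (\<lambda>t. indicator {0<..} t * ((1 - cos t) * exp (- (x * t))))"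
    by (auto simp: fun_eq_iff indicator_def z_def Re_exp algebra_simps)
  also have "1 / x - Re (1 / z) = 1 / (x * (1 + x\<^sup>2))"
  proof -
    have "1 + x\<^sup>2 > 0" by (simp add: add_pos_nonneg)
    moreover have "Re (1 / z) = x / (1 + x\<^sup>2)" by (simp add: z_def Re_divide power2_eq_square add.commute)
    ultimately have "1 / x - Re (1 / z) = 1 / x - x / (1 + x\<^sup>2)" by simp
    also have "\<dots> = 1 / (x * (1 + x\<^sup>2))"
      using x \<open>1 + x\<^sup>2 > 0\<close> by (simp add: divide_simps) (simp add: algebra_simps power2_eq_square)
    finally show ?thesis .
  qed
  finally have D: "has_bochner_integral lborel (\<lambda>t. indicator {0<..} t * ((1 - cos t) * exp (- (x * t)))) (1 / (x * (1 + x\<^sup>2)))" .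
  have "(\<integral>\<^sup>+t. ennreal (indicator {0<..} t * ((1 - cos t) * exp (- (x * t)))) \<partial>lborel) = ennreal (1 / (x * (1 + x\<^sup>2)))"
    using D by (subst nn_integral_eq_integral) (auto simp: has_bochner_integral_iff)
  also have "(\<integral>\<^sup>+t. ennreal (indicator {0<..} t * ((1 - cos t) * exp (- (x * t)))) \<partial>lborel) = (\<integral>\<^sup>+t. ennreal ((1 - cos t) * exp (- (x * t))) * indicator {0<..} t \<partial>lborel)"
    by (intro nn_integral_cong) (auto simp: indicator_def)
  finally show ?thesis .
qed

text \<open>Represent t powr (-p-1) as 1/Gamma(p+1) times the integral of x powr p * exp(-t x), and
  integrate over t first. The substitution v = x^2 turns what remains into the Beta integral at p/2,
  which lies in (0,1) because p < 2; the reflection formula gives the sine.\<close>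

lemma nn_integral_one_minus_cos_powr:
  fixes p :: real assumes p: "0 < p" "p < 2"
  shows "(\<integral>\<^sup>+t. ennreal ((1 - cos t) * t powr (- p - 1)) * indicator {0<..} t \<partial>lborel)
     = ennreal (pi / (2 * Gamma (p + 1) * sin (pi * p / 2)))"
proof -
  have G: "Gamma (p + 1) > 0" using p by (simp add: Gamma_real_pos)
  define F where "F t x = ennreal ((1 - cos t) * (x powr p * exp (- (t * x)) / Gamma (p + 1))) * indicator {0<..} t * indicator {0<..} x" for t x :: real
  have [measurable]: "case_prod F \<in> borel_measurable (lborel \<Otimes>\<^sub>M lborel)" unfolding F_def by measurable
  have 1: "(\<integral>\<^sup>+x. F t x \<partial>lborel) = ennreal ((1 - cos t) * t powr (- p - 1)) * indicator {0<..} t" for t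
  proof (cases "t > 0")
    case True
    have "(\<integral>\<^sup>+x. F t x \<partial>lborel) = (\<integral>\<^sup>+x. ennreal ((1 - cos t) / Gamma (p + 1)) * (ennreal (x powr (p + 1 - 1) * exp (- (t * x))) * indicator {0<..} x) \<partial>lborel)"
      using True G by (intro nn_integral_cong) (auto simp: F_def indicator_def ennreal_mult'[symmetric])
    also have "\<dots> = ennreal ((1 - cos t) / Gamma (p + 1)) * ennreal (Gamma (p + 1) * t powr (- (p + 1)))"
      using nn_integral_Gamma_scaled[of t "p + 1"] True p by (subst nn_integral_cmult) auto
    also have "\<dots> = ennreal ((1 - cos t) / Gamma (p + 1) * (Gamma (p + 1) * t powr (- (p + 1))))"
      using G by (intro ennreal_mult'[symmetric]) simp
    also have "(1 - cos t) / Gamma (p + 1) * (Gamma (p + 1) * t powr (- (p + 1))) = (1 - cos t) * t powr (- p - 1)"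
      using G by simp
    finally show ?thesis using True by simp
  qed (simp add: F_def)
  have 2: "(\<integral>\<^sup>+t. F t x \<partial>lborel) = ennreal (x powr (p - 1) / (1 + x\<^sup>2) / Gamma (p + 1)) * indicator {0<..} x" for x
  proof (cases "x > 0")
    case True
    have "(\<integral>\<^sup>+t. F t x \<partial>lborel) = (\<integral>\<^sup>+t. ennreal (x powr p / Gamma (p + 1)) * (ennreal ((1 - cos t) * exp (- (x * t))) * indicator {0<..} t) \<partial>lborel)"
      using True G by (intro nn_integral_cong) (auto simp: F_def indicator_def ennreal_mult'[symmetric] mult_ac)
    also have "\<dots> = ennreal (x powr p / Gamma (p + 1)) * ennreal (1 / (x * (1 + x\<^sup>2)))"
      using nn_integral_one_minus_cos_exp[OF True] by (subst nn_integral_cmult) auto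
    also have "\<dots> = ennreal (x powr p / Gamma (p + 1) * (1 / (x * (1 + x\<^sup>2))))"
      using True G by (simp add: ennreal_mult'[symmetric])
    also have "x powr p / Gamma (p + 1) * (1 / (x * (1 + x\<^sup>2))) = x powr (p - 1) / (1 + x\<^sup>2) / Gamma (p + 1)"
      using True by (simp add: powr_diff)
    finally show ?thesis using True by simp
  qed (simp add: F_def)
  have "(\<integral>\<^sup>+t. \<integral>\<^sup>+x. F t x \<partial>lborel \<partial>lborel) = (\<integral>\<^sup>+x. \<integral>\<^sup>+t. F t x \<partial>lborel \<partial>lborel)"
    by (rule lborel_pair.Fubini'[symmetric]) simp
  also have "\<dots> = (\<integral>\<^sup>+x. ennreal (1 / (2 * Gamma (p + 1))) * (ennreal ((x powr 2) powr (p / 2 - 1) / (1 + x powr 2)) * ennreal (2 * x powr (2 - 1)) * indicator {0<..} x) \<partial>lborel)"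
  proof (intro nn_integral_cong)
    fix x :: real
    show "(\<integral>\<^sup>+t. F t x \<partial>lborel) = ennreal (1 / (2 * Gamma (p + 1))) * (ennreal ((x powr 2) powr (p / 2 - 1) / (1 + x powr 2)) * ennreal (2 * x powr (2 - 1)) * indicator {0<..} x)"
    proof (cases "x > 0")
      case True
      have "(x powr 2) powr (p / 2 - 1) * x = x powr (p - 1)"
      proof -
        have "(x powr 2) powr (p / 2 - 1) * x powr 1 = x powr (2 * (p / 2 - 1) + 1)"
          unfolding powr_powr powr_add[symmetric] ..
        also have "2 * (p / 2 - 1) + 1 = p - 1" by (simp add: field_simps)
        finally show ?thesis using True by simp
      qed
      hence "1 / (2 * Gamma (p + 1)) * ((x powr 2) powr (p / 2 - 1) / (1 + x powr 2) * (2 * x)) = x powr (p - 1) / (1 + x\<^sup>2) / Gamma (p + 1)"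
        using True by (simp add: field_simps)
      thus ?thesis unfolding 2 using True G
        by (simp add: ennreal_mult'[symmetric] del: powr_powr powr_numeral)
    qed (simp add: 2)
  qed
  also have "\<dots> = ennreal (1 / (2 * Gamma (p + 1))) * ennreal (Gamma (p / 2) * Gamma (1 - p / 2))"
    using nn_integral_powr_substitution[of "\<lambda>v. ennreal (v powr (p / 2 - 1) / (1 + v))" 2] nn_integral_powr_over_one_plus[of "p / 2"] p
    by (subst nn_integral_cmult) auto
  also have "Gamma (p / 2) * Gamma (1 - p / 2) = pi / sin (pi * p / 2)"
  proof -
    have "complex_of_real (Gamma (p / 2) * Gamma (1 - p / 2)) = of_real (pi / sin (pi * p / 2))"
      using Gamma_reflection_complex[of "of_real (p / 2)"]
      by (simp flip: Gamma_complex_of_real sin_of_real)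
    thus ?thesis by (simp only: of_real_eq_iff)
  qed
  also have "ennreal (1 / (2 * Gamma (p + 1))) * ennreal (pi / sin (pi * p / 2)) = ennreal (pi / (2 * Gamma (p + 1) * sin (pi * p / 2)))"
    using G by (subst ennreal_mult'[symmetric]) auto
  finally show ?thesis by (simp add: 1)
qed

text \<open>Tonelli, using 1 - cos \<ge> 0, and then scaling of t by |w|, which extracts |w| powr p.
  Being an identity in [0,\<infinity>], it computes moments whose finiteness is not known
  beforehand.\<close>

lemma (in real_distribution) nn_integral_abs_powr_char:
  fixes p :: real assumes p: "0 < p" "p < 2"
  shows "(\<integral>\<^sup>+t. ennreal ((1 - Re (char M t)) * t powr (- p - 1)) * indicator {0<..} t \<partial>lborel)
     = ennreal (pi / (2 * Gamma (p + 1) * sin (pi * p / 2))) * (\<integral>\<^sup>+w. ennreal (\<bar>w\<bar> powr p) \<partial>M)"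
proof -
  interpret L: pair_sigma_finite lborel M ..
  define F where "F t w = ennreal ((1 - cos (t * w)) * t powr (- p - 1)) * indicator {0<..} t" for t w :: real
  have [measurable]: "case_prod F \<in> borel_measurable (lborel \<Otimes>\<^sub>M M)" unfolding F_def by measurable
  have 1: "(\<integral>\<^sup>+w. F t w \<partial>M) = ennreal ((1 - Re (char M t)) * t powr (- p - 1)) * indicator {0<..} t" for t
  proof -
    have i: "complex_integrable M (\<lambda>w. iexp (t * w))" by (rule integrable_iexp) auto
    have "Re (char M t) = (\<integral>w. cos (t * w) \<partial>M)"
      unfolding char_def using integral_Re[OF i] by (simp add: Re_exp)
    moreover have ic: "integrable M (\<lambda>w. cos (t * w))"
      using integrable_Re[OF i] by (simp add: Re_exp)
    ultimately have "1 - Re (char M t) = (\<integral>w. 1 - cos (t * w) \<partial>M)"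
      by (simp add: prob_space[simplified])
    moreover have "(\<integral>\<^sup>+w. ennreal (1 - cos (t * w)) \<partial>M) = ennreal (\<integral>w. 1 - cos (t * w) \<partial>M)"
      using ic by (intro nn_integral_eq_integral) auto
    ultimately show ?thesis
      unfolding F_def by (simp add: nn_integral_multc ennreal_mult'')
  qed
  have 2: "(\<integral>\<^sup>+t. F t w \<partial>lborel) = ennreal (pi / (2 * Gamma (p + 1) * sin (pi * p / 2))) * ennreal (\<bar>w\<bar> powr p)" for w
  proof (cases "w = 0")
    case False
    define f where "f t = ennreal ((1 - cos t) * t powr (- p - 1)) * indicator {0<..} t" for t :: real
    have [measurable]: "f \<in> borel_measurable borel" unfolding f_def by measurable
    have "(\<integral>\<^sup>+t. f t \<partial>lborel) = ennreal \<bar>\<bar>w\<bar>\<bar> * (\<integral>\<^sup>+t. f (0 + \<bar>w\<bar> * t) \<partial>lborel)"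
      by (rule nn_integral_real_affine) (use False in auto)
    hence "ennreal (\<bar>w\<bar> powr p) * (\<integral>\<^sup>+t. f t \<partial>lborel) = ennreal (\<bar>w\<bar> powr p * \<bar>w\<bar>) * (\<integral>\<^sup>+t. f (\<bar>w\<bar> * t) \<partial>lborel)"
      by (simp add: ennreal_mult' mult.assoc)
    also have "\<dots> = (\<integral>\<^sup>+t. ennreal (\<bar>w\<bar> powr p * \<bar>w\<bar>) * f (\<bar>w\<bar> * t) \<partial>lborel)"
      by (subst nn_integral_cmult) auto
    also have "\<dots> = (\<integral>\<^sup>+t. F t w \<partial>lborel)"
    proof (intro nn_integral_cong)
      fix t :: real
      show "ennreal (\<bar>w\<bar> powr p * \<bar>w\<bar>) * f (\<bar>w\<bar> * t) = F t w"
      proof (cases "t > 0")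
        case True
        have "\<bar>w\<bar> powr p * \<bar>w\<bar> * \<bar>w\<bar> powr (- p - 1) = 1"
          using False by (simp add: powr_diff powr_minus)
        hence e: "\<bar>w\<bar> powr p * \<bar>w\<bar> * ((1 - cos (t * w)) * (\<bar>w\<bar> * t) powr (- p - 1)) = (1 - cos (t * w)) * t powr (- p - 1)"
          by (simp add: powr_mult)
        have "cos (\<bar>w\<bar> * t) = cos (t * w)" by (cases "w \<ge> 0") (auto simp: mult.commute)
        thus ?thesis using True False e by (simp add: f_def F_def zero_less_mult_iff ennreal_mult'[symmetric])
      qed (use False in \<open>simp add: f_def F_def zero_less_mult_iff\<close>)
    qed
    finally show ?thesis using nn_integral_one_minus_cos_powr[OF p] by (simp add: f_def mult.commute)
  qed (simp add: F_def)
  have "(\<integral>\<^sup>+t. \<integral>\<^sup>+w. F t w \<partial>M \<partial>lborel) = (\<integral>\<^sup>+w. \<integral>\<^sup>+t. F t w \<partial>lborel \<partial>M)"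
    by (rule L.Fubini'[symmetric]) simp
  thus ?thesis by (simp add: 1 2 nn_integral_cmult)
qed

section \<open>Absolute moments of the stable law\<close>

text \<open>Spelled exactly as in the theorem, so that the hypothesis on \<open>W\<close> applies
  after unfolding; \<open>stable_cf_eq_powr\<close> gives the form that comes out of the
  limit.\<close>

definition stable_cf :: "real \<Rightarrow> real \<Rightarrow> complex" where
  "stable_cf \<alpha> s = exp (- (complex_of_real (\<bar>s\<bar> powr \<alpha> * Gamma (1 - \<alpha>)) *
          (complex_of_real (cos (pi * \<alpha> / 2)) +
           \<i> * complex_of_real (sin (pi * \<alpha> / 2) * sgn s))))"

text \<open>The sign matters: since cos(\<pi> \<alpha>/2) is negative as well, Gamma(1 - \<alpha>)
  exp(i \<pi> \<alpha>/2) has positive real part.\<close>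

lemma Gamma_one_minus:
  fixes \<alpha> :: real assumes "1 < \<alpha>" "\<alpha> < 2"
  shows "Gamma (1 - \<alpha>) = - Gamma (2 - \<alpha>) / (\<alpha> - 1)" "Gamma (1 - \<alpha>) < 0"
proof -
  have "1 - \<alpha> \<notin> \<int>\<^sub>\<le>\<^sub>0"
  proof
    assume "1 - \<alpha> \<in> \<int>\<^sub>\<le>\<^sub>0"
    then obtain n :: int where "1 - \<alpha> = of_int n" by (auto elim!: nonpos_Ints_cases)
    hence "of_int n < (0::real)" "of_int n > (-1::real)" using assms by auto
    hence "n < 0" "n > -1" using of_int_less_iff[of "-1" n, where 'a = real] by simp_all
    thus False by simp
  qed
  from Gamma_plus1[OF this] have "Gamma (2 - \<alpha>) = (1 - \<alpha>) * Gamma (1 - \<alpha>)" by (simp add: algebra_simps)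
  thus *: "Gamma (1 - \<alpha>) = - Gamma (2 - \<alpha>) / (\<alpha> - 1)" using assms by (simp add: field_simps)
  have "Gamma (2 - \<alpha>) > 0" using assms by (simp add: Gamma_real_pos)
  thus "Gamma (1 - \<alpha>) < 0" unfolding * using assms by (simp add: divide_less_0_iff)
qed

text \<open>The characteristic function is the value at z = i s of exp(-Gamma(1-\<alpha>) z powr
  \<alpha>): the point i s has argument \<pm>\<pi>/2 according to the sign of s, which produces the
  sine term with its sgn.\<close>

lemma stable_cf_eq_powr:
  assumes "s \<noteq> 0"
  shows "stable_cf \<alpha> s = exp (- (of_real (Gamma (1 - \<alpha>)) * (\<i> * of_real s) powr of_real \<alpha>))"
proof -
  have "Ln (\<i> * of_real s) = of_real (ln \<bar>s\<bar>) + \<i> * of_real (pi / 2 * sgn s)"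
  proof -
    have e: "exp (of_real (ln \<bar>s\<bar>) + \<i> * of_real (pi / 2 * sgn s)) = \<i> * of_real s"
      using assms by (cases "s > 0") (auto simp: exp_add exp_of_real sgn_if exp_minus complex_eq_iff Re_exp Im_exp)
    show ?thesis unfolding e[symmetric]
      by (rule Ln_exp) (auto simp: sgn_if)
  qed
  hence "(\<i> * of_real s) powr of_real \<alpha> = exp (of_real (\<alpha> * ln \<bar>s\<bar>) + \<i> * of_real (pi * \<alpha> / 2 * sgn s))"
    using assms by (simp add: powr_def algebra_simps)
  also have "\<dots> = of_real (\<bar>s\<bar> powr \<alpha>) * (of_real (cos (pi * \<alpha> / 2)) + \<i> * of_real (sin (pi * \<alpha> / 2) * sgn s))"
    using assms by (auto simp: exp_add powr_def exp_of_real[symmetric] complex_eq_iff Re_exp Im_exp sgn_if)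
  finally show ?thesis by (simp add: stable_cf_def mult_ac)
qed

lemma cos_pi_alpha_neg: "1 < \<alpha> \<Longrightarrow> \<alpha> < 2 \<Longrightarrow> cos (pi * \<alpha> / 2) < 0"
proof -
  assume "1 < \<alpha>" "\<alpha> < 2"
  hence "cos (pi * \<alpha> / 2 - pi) > 0"
    by (intro cos_gt_zero_pi) (auto simp: field_simps)
  thus ?thesis by simp
qed

text \<open>For t > 0 the characteristic function is exp(-\<zeta> u) with u = t powr \<alpha>, so
  this substitution reduces the integral to the real part of \<open>Gamma_neg_integral\<close> with
  \<beta> = p/\<alpha>.\<close>

lemma nn_integral_stable_cf:
  fixes p \<alpha> :: real
  assumes \<alpha>: "1 < \<alpha>" "\<alpha> < 2" and p: "0 < p" "p < \<alpha>"
  shows "(\<integral>\<^sup>+t. ennreal ((1 - Re (stable_cf \<alpha> t)) * t powr (- p - 1)) * indicator {0<..} t \<partial>lborel)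
    = ennreal (Gamma (1 - p / \<alpha>) / p * \<bar>Gamma (1 - \<alpha>)\<bar> powr (p / \<alpha>) * cos (pi * p / 2 - pi * p / \<alpha>))"
proof -
  let ?S = "\<lambda>t. (1 - Re (stable_cf \<alpha> t)) * t powr (- p - 1)"
  define G where "G = Gamma (1 - \<alpha>)"
  have G: "G < 0" unfolding G_def by (rule Gamma_one_minus[OF \<alpha>])
  \<comment> \<open>The argument of \<zeta>: as Gamma(1-\<alpha>) is negative, the angle \<pi>
    \<alpha>/2 is turned by -\<pi> into (-\<pi>/2, 0), the range of the principal logarithm.\<close>
  define \<phi> where "\<phi> = pi * \<alpha> / 2 - pi"
  define \<zeta> where "\<zeta> = complex_of_real G * (of_real (cos (pi * \<alpha> / 2)) + \<i> * of_real (sin (pi * \<alpha> / 2)))"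
  have Re\<zeta>: "Re \<zeta> > 0" using G cos_pi_alpha_neg[OF \<alpha>] by (simp add: \<zeta>_def mult_neg_neg)
  have \<zeta>0: "\<zeta> \<noteq> 0" using Re\<zeta> by auto
  define \<beta> where "\<beta> = p / \<alpha>"
  let ?v = "Gamma (1 - \<beta>) / \<beta> * (\<bar>G\<bar> powr \<beta> * cos (\<beta> * \<phi>))"
  have \<beta>: "0 < \<beta>" "\<beta> < 1" using p \<alpha> by (auto simp: \<beta>_def)
  have "exp (of_real (ln \<bar>G\<bar>) + \<i> * of_real \<phi>) = \<zeta>"
    using G by (simp add: exp_add exp_of_real complex_eq_iff Re_exp Im_exp \<phi>_def \<zeta>_def)
  moreover have "Ln (exp (of_real (ln \<bar>G\<bar>) + \<i> * of_real \<phi>)) = of_real (ln \<bar>G\<bar>) + \<i> * of_real \<phi>"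
    using \<alpha> by (intro Ln_exp) (auto simp: \<phi>_def field_simps)
  ultimately have "\<zeta> powr of_real \<beta> = exp (of_real \<beta> * (of_real (ln \<bar>G\<bar>) + \<i> * of_real \<phi>))"
    using \<zeta>0 by (simp add: powr_def)
  hence Rep: "Re (\<zeta> powr of_real \<beta>) = \<bar>G\<bar> powr \<beta> * cos (\<beta> * \<phi>)"
    using G by (simp add: Re_exp powr_def)
  define g where "g u = (1 - Re (exp (- (\<zeta> * of_real u)))) * u powr (- \<beta> - 1)" for u :: real
  let ?u = "\<lambda>u. indicator {0<..} u *\<^sub>R (complex_of_real (u powr (- \<beta> - 1)) * (1 - exp (- (\<zeta> * of_real u))))" and ?w = "of_real (Gamma (1 - \<beta>) / \<beta>) * \<zeta> powr of_real \<beta>"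
  have g0: "g u \<ge> 0" if "u > 0" for u
  proof -
    have "Re (exp (- (\<zeta> * of_real u))) \<le> norm (exp (- (\<zeta> * of_real u)))" by (rule complex_Re_le_cmod)
    also have "\<dots> \<le> 1" using that Re\<zeta> by simp
    finally show ?thesis by (simp add: g_def)
  qed
  have [measurable]: "g \<in> borel_measurable borel" unfolding g_def by measurable
  have "has_bochner_integral lborel (\<lambda>u. Re (?u u))
      (Re (?w))"
    by (rule has_bochner_integral_bounded_linear[OF bounded_linear_Re Gamma_neg_integral]) (use Re\<zeta> \<zeta>0 \<beta> in auto)
  also have "(\<lambda>u. Re (?u u)) = (\<lambda>u. indicator {0<..} u * g u)"
    by (auto simp: fun_eq_iff g_def indicator_def)
  also have "Re (?w) = Gamma (1 - \<beta>) / \<beta> * (\<bar>G\<bar> powr \<beta> * cos (\<beta> * \<phi>))"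
    by (simp only: Re_complex_of_real Im_complex_of_real times_complex.sel Rep)
  finally have I: "has_bochner_integral lborel (\<lambda>u. indicator {0<..} u * g u) ?v" .
  have "(\<integral>\<^sup>+u. ennreal (indicator {0<..} u * g u) \<partial>lborel) = ennreal ?v"
    using I g0 by (subst nn_integral_eq_integral) (auto simp: has_bochner_integral_iff indicator_def)
  also have "(\<integral>\<^sup>+u. ennreal (indicator {0<..} u * g u) \<partial>lborel) = (\<integral>\<^sup>+u. ennreal (g u) * indicator {0<..} u \<partial>lborel)"
    by (intro nn_integral_cong) (auto simp: indicator_def)
  also have "\<dots> = (\<integral>\<^sup>+t. ennreal (g (t powr \<alpha>)) * ennreal (\<alpha> * t powr (\<alpha> - 1)) * indicator {0<..} t \<partial>lborel)"
    by (rule nn_integral_powr_substitution) (use \<alpha> in auto)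
  also have "\<dots> = (\<integral>\<^sup>+t. ennreal \<alpha> * (ennreal (?S t) * indicator {0<..} t) \<partial>lborel)"
  proof (intro nn_integral_cong)
    fix t :: real
    show "ennreal (g (t powr \<alpha>)) * ennreal (\<alpha> * t powr (\<alpha> - 1)) * indicator {0<..} t = ennreal \<alpha> * (ennreal (?S t) * indicator {0<..} t)"
    proof (cases "t > 0")
      case True
      have s: "stable_cf \<alpha> t = exp (- (\<zeta> * of_real (t powr \<alpha>)))"
        using True by (simp add: stable_cf_def \<zeta>_def G_def mult_ac)
      have "(t powr \<alpha>) powr (- \<beta> - 1) * t powr (\<alpha> - 1) = t powr (- p - 1)"
        using \<alpha> by (simp add: powr_powr powr_add[symmetric] \<beta>_def field_simps)
      hence "g (t powr \<alpha>) * (\<alpha> * t powr (\<alpha> - 1)) = \<alpha> * (?S t)"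
        unfolding g_def s by (metis mult.assoc mult.left_commute)
      hence "ennreal (g (t powr \<alpha>) * (\<alpha> * t powr (\<alpha> - 1))) = ennreal (\<alpha> * (?S t))"
        by (rule arg_cong)
      moreover have "ennreal (g (t powr \<alpha>) * (\<alpha> * t powr (\<alpha> - 1))) = ennreal (g (t powr \<alpha>)) * ennreal (\<alpha> * t powr (\<alpha> - 1))"
        using \<alpha> by (intro ennreal_mult'') simp
      moreover have "ennreal (\<alpha> * (?S t)) = ennreal \<alpha> * ennreal (?S t)"
        using \<alpha> by (intro ennreal_mult') simp
      ultimately show ?thesis using True by simp
    qed simp
  qed
  also have "\<dots> = ennreal \<alpha> * (\<integral>\<^sup>+t. (ennreal (?S t) * indicator {0<..} t) \<partial>lborel)"
    unfolding stable_cf_def by (rule nn_integral_cmult) simp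
  finally have "ennreal (1 / \<alpha>) * (ennreal \<alpha> * (\<integral>\<^sup>+t. (ennreal (?S t) * indicator {0<..} t) \<partial>lborel))
      = ennreal (1 / \<alpha>) * ennreal ?v" by simp
  moreover have "ennreal (1 / \<alpha>) * (ennreal \<alpha> * x) = x" for x
    using \<alpha> by (simp add: mult.assoc[symmetric] ennreal_mult'[symmetric])
  moreover have "1 / \<alpha> * ?v = Gamma (1 - p / \<alpha>) / p * \<bar>Gamma (1 - \<alpha>)\<bar> powr (p / \<alpha>) * cos (pi * p / 2 - pi * p / \<alpha>)"
  proof -
    have "\<beta> * \<phi> = pi * p / 2 - pi * p / \<alpha>" using \<alpha> by (simp add: \<beta>_def \<phi>_def field_simps)
    thus ?thesis using \<alpha> by (simp add: \<beta>_def G_def)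
  qed
  moreover have "ennreal (1 / \<alpha>) * ennreal y = ennreal (1 / \<alpha> * y)" for y
    using \<alpha> by (intro ennreal_mult'[symmetric]) simp
  ultimately show ?thesis by metis
qed

text \<open>The same integral has been evaluated twice, once as \<open>K\<close> times the moment
  and once in closed form; \<open>K\<close> is positive because 0 < p < 2, so it can be divided
  out.\<close>

lemma (in real_distribution) stable_abs_moment:
  fixes p \<alpha> :: real
  assumes \<alpha>: "1 < \<alpha>" "\<alpha> < 2" and p: "0 < p" "p < \<alpha>" and cf: "\<And>s. char M s = stable_cf \<alpha> s"
  shows "(\<integral>\<^sup>+w. ennreal (\<bar>w\<bar> powr p) \<partial>M) = ennreal (2 * Gamma (p + 1) / (pi * p) * sin (pi * p / 2) * Gamma (1 - p / \<alpha>)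
               * \<bar>Gamma (1 - \<alpha>)\<bar> powr (p / \<alpha>) * cos (pi * p / 2 - pi * p / \<alpha>))"
proof -
  define K where "K = pi / (2 * Gamma (p + 1) * sin (pi * p / 2))"
  have s: "sin (pi * p / 2) > 0" using p \<alpha> by (intro sin_gt_zero) (auto simp: field_simps)
  have G: "Gamma (p + 1) > 0" using p by (simp add: Gamma_real_pos)
  have K: "K > 0" using s G by (simp add: K_def)
  have "ennreal (1 / K) * (ennreal K * (\<integral>\<^sup>+w. ennreal (\<bar>w\<bar> powr p) \<partial>M)) = ennreal (1 / K) * ennreal (Gamma (1 - p / \<alpha>) / p * \<bar>Gamma (1 - \<alpha>)\<bar> powr (p / \<alpha>) * cos (pi * p / 2 - pi * p / \<alpha>))"
    using nn_integral_abs_powr_char[of p] nn_integral_stable_cf[OF \<alpha> p] p \<alpha> by (simp add: cf K_def)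
  moreover have "ennreal (1 / K) * (ennreal K * x) = x" for x
    using K by (simp add: mult.assoc[symmetric] ennreal_mult'[symmetric])
  moreover have "ennreal (1 / K) * ennreal y = ennreal (1 / K * y)" for y
    using K by (intro ennreal_mult'[symmetric]) simp
  moreover have "1 / K * (Gamma (1 - p / \<alpha>) / p * \<bar>Gamma (1 - \<alpha>)\<bar> powr (p / \<alpha>) * cos (pi * p / 2 - pi * p / \<alpha>))
    = 2 * Gamma (p + 1) / (pi * p) * sin (pi * p / 2) * Gamma (1 - p / \<alpha>) * \<bar>Gamma (1 - \<alpha>)\<bar> powr (p / \<alpha>) * cos (pi * p / 2 - pi * p / \<alpha>)"
    using s G p by (simp add: K_def)
  ultimately show ?thesis by metis
qed

text \<open>A finite p-th moment would bound the moments of all orders q < \<alpha> uniformly, since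
  |w| powr q \<le> 1 + |w| powr p. Their closed form, however, blows up as q increases to \<alpha>,
  through the pole of Gamma at 0.\<close>

lemma (in real_distribution) stable_abs_moment_infinite:
  fixes p \<alpha> :: real
  assumes \<alpha>: "1 < \<alpha>" "\<alpha> < 2" and p: "p \<ge> \<alpha>" and cf: "\<And>s. char M s = stable_cf \<alpha> s"
  shows "(\<integral>\<^sup>+w. ennreal (\<bar>w\<bar> powr p) \<partial>M) = \<infinity>"
proof (rule ccontr)
  let ?I = "\<integral>\<^sup>+w. ennreal (\<bar>w\<bar> powr p) \<partial>M"
  assume "?I \<noteq> \<infinity>"
  then obtain B where B: "B \<ge> 0" "?I = ennreal B"
    by (cases "?I") auto
  \<comment> \<open>The closed form stripped of its singular factor Gamma(1 - q/\<alpha>); it is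
    continuous and positive at q = \<alpha>.\<close>
  define h where "h q = 2 * Gamma (q + 1) / (pi * q) * sin (pi * q / 2) * \<bar>Gamma (1 - \<alpha>)\<bar> powr (q / \<alpha>) * cos (pi * q / 2 - pi * q / \<alpha>)" for q
  have bound: "h q * Gamma (1 - q / \<alpha>) \<le> 1 + B" if q: "0 < q" "q < \<alpha>" for q
  proof -
    have "ennreal (h q * Gamma (1 - q / \<alpha>)) = (\<integral>\<^sup>+w. ennreal (\<bar>w\<bar> powr q) \<partial>M)"
      unfolding stable_abs_moment[OF \<alpha> q cf] h_def by (simp add: mult_ac)
    also have "\<dots> \<le> (\<integral>\<^sup>+w. 1 + ennreal (\<bar>w\<bar> powr p) \<partial>M)"
    proof (intro nn_integral_mono)
      fix w :: real
      have "\<bar>w\<bar> powr q \<le> 1 + \<bar>w\<bar> powr p"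
      proof (cases "\<bar>w\<bar> \<le> 1")
        case True
        hence "\<bar>w\<bar> powr q \<le> 1 powr q" using q by (intro powr_mono2) auto
        thus ?thesis by (auto intro: order_trans)
      next
        case False
        hence "\<bar>w\<bar> powr q \<le> \<bar>w\<bar> powr p" using q p by (intro powr_mono) auto
        thus ?thesis by auto
      qed
      thus "ennreal (\<bar>w\<bar> powr q) \<le> 1 + ennreal (\<bar>w\<bar> powr p)"
        by (simp flip: ennreal_1 ennreal_plus)
    qed
    also have "\<dots> = ennreal (1 + B)"
      using B by (subst nn_integral_add) (auto simp: emeasure_space_1[simplified])
    finally show ?thesis using B ennreal_le_iff[of "1 + B"] by simp
  qed
  have ha: "(h \<longlongrightarrow> h \<alpha>) (at_left \<alpha>)"
    unfolding h_def using \<alpha> Gamma_one_minus[OF \<alpha>] by (intro tendsto_intros) (auto elim!: nonpos_Ints_cases simp: add_eq_0_iff)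
  have h0: "h \<alpha> > 0"
  proof -
    have "sin (pi * \<alpha> / 2) > 0" using \<alpha> by (intro sin_gt_zero) (auto simp: field_simps)
    moreover have "cos (pi * \<alpha> / 2 - pi * \<alpha> / \<alpha>) > 0"
      using cos_pi_alpha_neg[OF \<alpha>] \<alpha> by simp
    moreover have "Gamma (\<alpha> + 1) > 0" using \<alpha> by (simp add: Gamma_real_pos)
    moreover have "\<bar>Gamma (1 - \<alpha>)\<bar> powr (\<alpha> / \<alpha>) > 0" using Gamma_one_minus(2)[OF \<alpha>] by simp
    ultimately show ?thesis unfolding h_def using \<alpha> by (intro mult_pos_pos divide_pos_pos) auto
  qed
  \<comment> \<open>Functional equation: Gamma(1 - q/\<alpha>) = Gamma(2 - q/\<alpha>) / (1 -
    q/\<alpha>), where the numerator tends to Gamma 1 = 1 and the denominator to 0 from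
    above.\<close>
  have "filterlim (\<lambda>q. Gamma (1 - q / \<alpha>)) at_top (at_left \<alpha>)"
  proof -
    have 1: "((\<lambda>q. Gamma (2 - q / \<alpha>)) \<longlongrightarrow> Gamma (2 - \<alpha> / \<alpha>)) (at_left \<alpha>)"
      using \<alpha> by (intro tendsto_intros) (auto elim!: nonpos_Ints_cases)
    have 2: "filterlim (\<lambda>q. inverse (1 - q / \<alpha>)) at_top (at_left \<alpha>)"
    proof (rule filterlim_inverse_at_top)
      show "((\<lambda>q. 1 - q / \<alpha>) \<longlongrightarrow> 0) (at_left \<alpha>)" using \<alpha> by (auto intro!: tendsto_eq_intros)
      show "\<forall>\<^sub>F q in at_left \<alpha>. 0 < 1 - q / \<alpha>" using \<alpha> by (auto simp: eventually_at_left_field field_simps intro!: exI[of _ 0])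
    qed
    have "filterlim (\<lambda>q. Gamma (2 - q / \<alpha>) * inverse (1 - q / \<alpha>)) at_top (at_left \<alpha>)"
      by (rule filterlim_tendsto_pos_mult_at_top[OF 1 _ 2]) (use \<alpha> in simp)
    moreover have "\<forall>\<^sub>F q in at_left \<alpha>. Gamma (2 - q / \<alpha>) * inverse (1 - q / \<alpha>) = Gamma (1 - q / \<alpha>)"
    proof -
      have gen: "Gamma (y + 1) * inverse y = Gamma y" if "y > 0" for y :: real
        using that by (subst Gamma_plus1) auto
      have "\<forall>\<^sub>F q in at_left \<alpha>. q < \<alpha> \<and> 0 < q" using \<alpha> by (auto simp: eventually_at_left_field intro!: exI[of _ 0])
      thus ?thesis
      proof eventually_elim
        case (elim q)
        hence "1 - q / \<alpha> > 0" using \<alpha> by (simp add: field_simps)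
        hence "Gamma ((1 - q / \<alpha>) + 1) * inverse (1 - q / \<alpha>) = Gamma (1 - q / \<alpha>)" by (rule gen)
        thus ?case by (simp add: algebra_simps)
      qed
    qed
    ultimately show ?thesis by (rule filterlim_cong[THEN iffD1, rotated 3, OF _ refl refl]) 
  qed
  from filterlim_tendsto_pos_mult_at_top[OF ha h0 this]
  have "\<forall>\<^sub>F q in at_left \<alpha>. h q * Gamma (1 - q / \<alpha>) > 1 + B" by (simp add: filterlim_at_top_dense)
  moreover have "\<forall>\<^sub>F q in at_left \<alpha>. q < \<alpha> \<and> 0 < q" using \<alpha> by (auto simp: eventually_at_left_field intro!: exI[of _ 0])
  ultimately have "\<forall>\<^sub>F q in at_left \<alpha>. False"
    by eventually_elim (use bound in force)
  thus False by simp
qed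

section \<open>Convergence of moments under weak convergence\<close>

lemma nn_integral_truncations:
  fixes g :: "real \<Rightarrow> real"
  assumes [measurable]: "g \<in> borel_measurable N" and g0: "\<And>x. 0 \<le> g x"
  shows "(\<integral>\<^sup>+x. ennreal (g x) \<partial>N) = (SUP n. \<integral>\<^sup>+x. ennreal (min (g x) (real n)) \<partial>N)"
proof -
  have "(\<integral>\<^sup>+x. ennreal (g x) \<partial>N) = (\<integral>\<^sup>+x. (SUP n. ennreal (min (g x) (real n))) \<partial>N)"
  proof (intro nn_integral_cong)
    fix x
    obtain n where n: "g x \<le> real n" using real_arch_simple by blast
    show "ennreal (g x) = (SUP n. ennreal (min (g x) (real n)))"
    proof (rule antisym)
      show "ennreal (g x) \<le> (SUP n. ennreal (min (g x) (real n)))"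
        by (rule SUP_upper2[of n]) (use n in auto)
    qed (auto intro!: SUP_least ennreal_leI)
  qed
  also have "\<dots> = (SUP n. \<integral>\<^sup>+x. ennreal (min (g x) (real n)) \<partial>N)"
    by (rule nn_integral_monotone_convergence_SUP) (auto simp: incseq_def le_fun_def intro!: ennreal_leI)
  finally show ?thesis .
qed

text \<open>The test function \<open>g\<close> may be unbounded. Sequences are used because weak
  convergence is formulated for them; limits in real t are recovered along arbitrary sequences
  tending to infinity.\<close>

locale weakly_convergent =
  fixes N :: "nat \<Rightarrow> real measure" and N' :: "real measure" and g :: "real \<Rightarrow> real"
  assumes N: "\<And>k. real_distribution (N k)" and N': "real_distribution N'"
    and weak: "weak_conv_m N N'" and cont: "\<And>x. isCont g x" and nonneg: "\<And>x. 0 \<le> g x"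
begin

sublocale N: real_distribution "N k" for k by (rule N)
sublocale N': real_distribution N' by (rule N')

lemma g_measurable [measurable]: "g \<in> borel_measurable borel"
  by (intro borel_measurable_continuous_onI continuous_at_imp_continuous_on) (auto simp: cont)

lemma tendsto_nn_integral_min:
  assumes "K \<ge> 0"
  shows "(\<lambda>k. \<integral>\<^sup>+x. ennreal (min (g x) K) \<partial>N k) \<longlonglongrightarrow> (\<integral>\<^sup>+x. ennreal (min (g x) K) \<partial>N')"
proof -
  have "(\<lambda>k. \<integral>x. min (g x) K \<partial>N k) \<longlonglongrightarrow> (\<integral>x. min (g x) K \<partial>N')"
  proof (rule weak_conv_imp_integral_bdd_continuous_conv[OF N N' weak, where B = K])
    show "isCont (\<lambda>x. min (g x) K) x" for x
      using cont[of x] unfolding isCont_def by (intro tendsto_min) auto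
  qed (use assms nonneg in auto)
  hence "(\<lambda>k. ennreal (\<integral>x. min (g x) K \<partial>N k)) \<longlonglongrightarrow> ennreal (\<integral>x. min (g x) K \<partial>N')" by simp
  moreover have "(\<integral>\<^sup>+x. ennreal (min (g x) K) \<partial>M) = ennreal (\<integral>x. min (g x) K \<partial>M)" if "real_distribution M" for M
  proof -
    interpret real_distribution M by fact
    show ?thesis
      using assms nonneg by (intro nn_integral_eq_integral integrable_const_bound[of _ K]) auto
  qed
  ultimately show ?thesis using N N' by simp
qed

text \<open>Lower semicontinuity: some truncation min g n already exceeds the level in the limit,
  and integrals of bounded continuous functions converge.\<close>

lemma eventually_nn_integral_gt:
  assumes "x < (\<integral>\<^sup>+x. ennreal (g x) \<partial>N')"
  shows "\<forall>\<^sub>F k in sequentially. x < (\<integral>\<^sup>+x. ennreal (g x) \<partial>N k)"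
proof -
  from assms obtain n where "x < (\<integral>\<^sup>+x. ennreal (min (g x) (real n)) \<partial>N')"
    using nonneg by (subst (asm) nn_integral_truncations) (auto simp: less_SUP_iff)
  hence "\<forall>\<^sub>F k in sequentially. x < (\<integral>\<^sup>+x. ennreal (min (g x) (real n)) \<partial>N k)"
    by (intro order_tendstoD(1)[OF tendsto_nn_integral_min]) auto
  thus ?thesis
    by eventually_elim (auto intro!: ennreal_leI elim!: less_le_trans intro: nn_integral_mono)
qed

lemma tendsto_nn_integral_infinite:
  assumes "(\<integral>\<^sup>+x. ennreal (g x) \<partial>N') = \<infinity>"
  shows "(\<lambda>k. \<integral>\<^sup>+x. ennreal (g x) \<partial>N k) \<longlonglongrightarrow> \<infinity>"
  by (rule order_tendstoI) (use eventually_nn_integral_gt assms in auto)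

text \<open>Where g > K one has g \<le> K powr (1 - q) * g powr q, so a bounded integral of g powr q
  with q > 1 makes the loss by truncation at K uniformly small.\<close>

lemma tendsto_nn_integral:
  fixes q B :: real
  assumes q: "q > 1" and B: "B \<ge> 0"
    and bound: "\<forall>\<^sub>F k in sequentially. (\<integral>\<^sup>+x. ennreal (g x powr q) \<partial>N k) \<le> ennreal B"
  shows "(\<lambda>k. \<integral>\<^sup>+x. ennreal (g x) \<partial>N k) \<longlonglongrightarrow> (\<integral>\<^sup>+x. ennreal (g x) \<partial>N')"
    and "(\<integral>\<^sup>+x. ennreal (g x) \<partial>N') < \<infinity>"
proof -
  let ?I = "\<lambda>N. \<integral>\<^sup>+x. ennreal (g x) \<partial>N" and ?J = "\<lambda>K N. \<integral>\<^sup>+x. ennreal (min (g x) K) \<partial>N" and ?Q = "\<lambda>N. \<integral>\<^sup>+x. ennreal (g x powr q) \<partial>N"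
  have le: "g x \<le> min (g x) K + K powr (1 - q) * g x powr q" if "K > 0" for x K
  proof (cases "g x \<le> K")
    case True thus ?thesis by simp
  next
    case False
    hence "g x = g x powr (1 - q) * g x powr q" using that by (simp add: powr_add[symmetric])
    also have "\<dots> \<le> K powr (1 - q) * g x powr q"
      using False that q by (intro mult_right_mono powr_mono2') auto
    finally show ?thesis using that False by simp
  qed
  have up: "?I (N k) \<le> ?J K (N k) + ennreal (K powr (1 - q) * B)"
    if "K > 0" "?Q (N k) \<le> ennreal B" for k K
  proof -
    have "?I (N k) \<le> (\<integral>\<^sup>+x. ennreal (min (g x) K) + ennreal (K powr (1 - q)) * ennreal (g x powr q) \<partial>N k)"
    proof (intro nn_integral_mono)
      fix x
      have "ennreal (g x) \<le> ennreal (min (g x) K + K powr (1 - q) * g x powr q)"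
        using le[OF that(1)] by (intro ennreal_leI)
      also have "\<dots> = ennreal (min (g x) K) + ennreal (K powr (1 - q)) * ennreal (g x powr q)"
        using nonneg that(1) by (subst ennreal_plus) (auto simp: ennreal_mult')
      finally show "ennreal (g x) \<le> \<dots>" .
    qed
    also have "\<dots> = ?J K (N k) + ennreal (K powr (1 - q)) * ?Q (N k)"
      by (simp add: nn_integral_add nn_integral_cmult)
    also have "\<dots> \<le> ?J K (N k) + ennreal (K powr (1 - q)) * ennreal B"
      using that by (intro add_left_mono mult_left_mono) auto
    finally show ?thesis by (simp add: ennreal_mult')
  qed
  have "(\<integral>\<^sup>+x. ennreal (min (g x) (real n)) \<partial>N') \<le> ennreal (1 + B)" for n
  proof (rule tendsto_upperbound[OF tendsto_nn_integral_min])
    show "\<forall>\<^sub>F k in sequentially. ?J (real n) (N k) \<le> ennreal (1 + B)"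
      using bound
    proof eventually_elim
      case (elim k)
      have "?J (real n) (N k) \<le> ?I (N k)" by (intro nn_integral_mono ennreal_leI) auto
      also have "\<dots> \<le> (\<integral>\<^sup>+x. ennreal (min (g x) 1) \<partial>N k) + ennreal (1 powr (1 - q) * B)" by (rule up) (use elim in auto)
      also have "(\<integral>\<^sup>+x. ennreal (min (g x) 1) \<partial>N k) \<le> (\<integral>\<^sup>+x. 1 \<partial>N k)"
        by (intro nn_integral_mono) (simp add: ennreal_leI flip: ennreal_1)
      also have "\<dots> = 1" using N.emeasure_space_1[of k] by simp
      finally show ?case using B by (simp add: ennreal_plus)
    qed
  qed auto
  hence "?I N' \<le> ennreal (1 + B)"
    using nonneg by (subst nn_integral_truncations) (auto intro!: SUP_least)
  also have "\<dots> < \<infinity>" by simp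
  finally show fin: "?I N' < \<infinity>" .
  then obtain I where I: "?I N' = ennreal I" "I \<ge> 0"
    by (cases "?I N'") auto
  show "(\<lambda>k. \<integral>\<^sup>+x. ennreal (g x) \<partial>N k) \<longlonglongrightarrow> ?I N'"
  proof (rule order_tendstoI)
    fix x assume x: "?I N' < x"
    have "((\<lambda>K. ennreal (I + K powr (1 - q) * B)) \<longlongrightarrow> ennreal (I + 0 * B)) at_top"
      using q by (intro tendsto_ennrealI tendsto_intros tendsto_neg_powr filterlim_ident) auto
    hence "\<forall>\<^sub>F K in at_top. ennreal (I + K powr (1 - q) * B) < x"
      using x I by (intro order_tendstoD) auto
    moreover have "\<forall>\<^sub>F K in at_top. (K::real) > 0" by (rule eventually_gt_at_top)
    ultimately have "\<forall>\<^sub>F K in at_top. ennreal (I + K powr (1 - q) * B) < x \<and> K > 0" by eventually_elim simp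
    from eventually_happens'[OF trivial_limit_at_top_linorder this] obtain K where K: "ennreal (I + K powr (1 - q) * B) < x" "K > 0"
      by blast
    have lim: "(\<lambda>k. ?J K (N k) + ennreal (K powr (1 - q) * B)) \<longlonglongrightarrow> ?J K N' + ennreal (K powr (1 - q) * B)"
      using K by (intro tendsto_add tendsto_nn_integral_min) auto
    have "?J K N' + ennreal (K powr (1 - q) * B) \<le> ?I N' + ennreal (K powr (1 - q) * B)"
      by (intro add_right_mono nn_integral_mono ennreal_leI) auto
    also have "\<dots> = ennreal (I + K powr (1 - q) * B)" using I B by (simp add: ennreal_plus)
    also note K(1)
    finally have "\<forall>\<^sub>F k in sequentially. ?J K (N k) + ennreal (K powr (1 - q) * B) < x"
      by (rule order_tendstoD(2)[OF lim])
    with bound show "\<forall>\<^sub>F k in sequentially. ?I (N k) < x"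
      by eventually_elim (use up[OF K(2)] in \<open>blast intro: le_less_trans\<close>)
  qed (rule eventually_nn_integral_gt)
qed

end

section \<open>From tail bounds to moment bounds\<close>

lemma (in real_distribution) layer_cake_measurable:
  fixes h :: "real \<Rightarrow> ennreal"
  assumes [measurable]: "h \<in> borel_measurable borel"
  shows "(\<lambda>y. \<integral>\<^sup>+x. h x * indicator {0<..<y} x \<partial>lborel) \<in> borel_measurable M"
proof -
  have "(\<lambda>y. \<integral>\<^sup>+x. h x * indicator {0<..<y} x \<partial>lborel) = (\<lambda>y. \<integral>\<^sup>+x. h x * (if 0 < x \<and> x < y then 1 else 0) \<partial>lborel)"
    by (auto simp: indicator_def intro!: ext nn_integral_cong)
  also have "\<dots> \<in> borel_measurable M" by measurable
  finally show ?thesis .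
qed

text \<open>Used with h the derivative of a test function: the inner integral rebuilds that function
  at y, and the right side involves the law only through its tail.\<close>

lemma (in real_distribution) nn_integral_layer_cake:
  fixes h :: "real \<Rightarrow> ennreal"
  assumes [measurable]: "h \<in> borel_measurable borel"
  shows "(\<integral>\<^sup>+y. (\<integral>\<^sup>+x. h x * indicator {0<..<y} x \<partial>lborel) \<partial>M)
    = (\<integral>\<^sup>+x. h x * ennreal (measure M {x<..}) * indicator {0<..} x \<partial>lborel)"
proof -
  interpret L: pair_sigma_finite lborel M ..
  define F where "F x y = h x * indicator {0<..} x * (if x < y then 1 else 0)" for x y :: real
  have [measurable]: "case_prod F \<in> borel_measurable (lborel \<Otimes>\<^sub>M M)" unfolding F_def by measurable
  have "(\<integral>\<^sup>+y. (\<integral>\<^sup>+x. h x * indicator {0<..<y} x \<partial>lborel) \<partial>M) = (\<integral>\<^sup>+y. (\<integral>\<^sup>+x. F x y \<partial>lborel) \<partial>M)"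
    by (intro nn_integral_cong) (auto simp: F_def indicator_def)
  also have "\<dots> = (\<integral>\<^sup>+x. (\<integral>\<^sup>+y. F x y \<partial>M) \<partial>lborel)" by (rule L.Fubini') simp
  also have "\<dots> = (\<integral>\<^sup>+x. h x * ennreal (measure M {x<..}) * indicator {0<..} x \<partial>lborel)"
  proof (intro nn_integral_cong)
    fix x :: real
    show "(\<integral>\<^sup>+y. F x y \<partial>M) = h x * ennreal (measure M {x<..}) * indicator {0<..} x"
  proof -
    have "(\<integral>\<^sup>+y. F x y \<partial>M) = (\<integral>\<^sup>+y. h x * indicator {0<..} x * indicator {x<..} y \<partial>M)"
      by (intro nn_integral_cong) (auto simp: F_def indicator_def)
    also have "\<dots> = h x * indicator {0<..} x * emeasure M {x<..}"
      by (subst nn_integral_cmult_indicator) auto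
    finally show ?thesis by (simp add: emeasure_eq_measure mult_ac)
  qed
  qed
  finally show ?thesis .
qed

text \<open>Tail decay at rate 2 \<theta> against the growth exp(\<theta> x) leaves the integral of
  C \<theta> exp(-\<theta> x), equal to C. The summand 1 is the value of the exponential at 0 and
  also covers negative y.\<close>

lemma (in real_distribution) nn_integral_exp_le_tail:
  fixes \<theta> C :: real
  assumes \<theta>: "\<theta> > 0" and C: "C \<ge> 0" and tail: "\<And>x. x > 0 \<Longrightarrow> measure M {x<..} \<le> C * exp (- (2 * \<theta> * x))"
  shows "(\<integral>\<^sup>+y. ennreal (exp (\<theta> * y)) \<partial>M) \<le> ennreal (1 + C)"
proof -
  let ?h = "\<lambda>x. ennreal (\<theta> * exp (\<theta> * x))"
  have "(\<integral>\<^sup>+y. ennreal (exp (\<theta> * y)) \<partial>M) \<le> (\<integral>\<^sup>+y. 1 + (\<integral>\<^sup>+x. ?h x * indicator {0<..<y} x \<partial>lborel) \<partial>M)"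
  proof (intro nn_integral_mono)
    fix y :: real
    show "ennreal (exp (\<theta> * y)) \<le> 1 + (\<integral>\<^sup>+x. ?h x * indicator {0<..<y} x \<partial>lborel)"
    proof (cases "y \<ge> 0")
      case True
      have "(\<integral>\<^sup>+x. ?h x * indicator {0<..<y} x \<partial>lborel) = (\<integral>\<^sup>+x. ?h x * indicator {0..y} x \<partial>lborel)"
        by (intro nn_integral_cong_AE AE_mp[OF AE_lborel_singleton[of 0] AE_mp[OF AE_lborel_singleton[of y] AE_I2]]) (auto simp: indicator_def)
      also have "\<dots> = ennreal (exp (\<theta> * y) - exp (\<theta> * 0))"
        using True \<theta> by (intro nn_integral_FTC_Icc) (auto intro!: derivative_eq_intros)
      finally show ?thesis using True \<theta> by (simp flip: ennreal_1 ennreal_plus)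
    next
      case False
      hence "exp (\<theta> * y) \<le> 1" using \<theta> by (simp add: mult_nonneg_nonpos)
      hence "ennreal (exp (\<theta> * y)) \<le> 1" by (simp flip: ennreal_1)
      thus ?thesis by (rule add_increasing2[rotated]) simp
    qed
  qed
  also have "\<dots> = 1 + (\<integral>\<^sup>+x. ?h x * ennreal (measure M {x<..}) * indicator {0<..} x \<partial>lborel)"
    by (subst nn_integral_add) (use emeasure_space_1 in \<open>auto simp: nn_integral_layer_cake intro!: layer_cake_measurable\<close>)
  also have "(\<integral>\<^sup>+x. ?h x * ennreal (measure M {x<..}) * indicator {0<..} x \<partial>lborel)
    \<le> (\<integral>\<^sup>+x. ennreal (C * \<theta>) * (ennreal (x powr (1 - 1) * exp (- (\<theta> * x))) * indicator {0<..} x) \<partial>lborel)"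
  proof (intro nn_integral_mono)
    fix x :: real
    show "?h x * ennreal (measure M {x<..}) * indicator {0<..} x \<le> ennreal (C * \<theta>) * (ennreal (x powr (1 - 1) * exp (- (\<theta> * x))) * indicator {0<..} x)"
    proof (cases "x > 0")
      case True
      have "\<theta> * exp (\<theta> * x) * measure M {x<..} \<le> \<theta> * exp (\<theta> * x) * (C * exp (- (2 * \<theta> * x)))"
        using tail[OF True] \<theta> by (intro mult_left_mono) auto
      also have "\<dots> = C * \<theta> * exp (- (\<theta> * x))"
      proof -
        have "exp (\<theta> * x) * exp (- (2 * \<theta> * x)) = exp (- (\<theta> * x))" by (simp flip: exp_add)
        thus ?thesis by (metis mult.assoc mult.commute)
      qed
      finally show ?thesis using True \<theta> C by (simp add: ennreal_mult'[symmetric] ennreal_leI)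
    qed simp
  qed
  also have "\<dots> = ennreal C"
    using nn_integral_Gamma_scaled[of \<theta> 1] \<theta> C by (subst nn_integral_cmult) (auto simp: powr_minus ennreal_mult'[symmetric])
  finally show ?thesis using C by (simp add: ennreal_plus add_left_mono)
qed

text \<open>The density h starts at 1, where the tail bound begins; the summand 1 accounts for y
  below 1 and for the value 1 powr r.\<close>

lemma (in real_distribution) nn_integral_powr_le_tail:
  fixes r s C :: real
  assumes r: "0 < r" "r < s" and C: "C \<ge> 0" and tail: "\<And>x. x \<ge> 1 \<Longrightarrow> measure M {x<..} \<le> C * x powr (- s)"
  shows "(\<integral>\<^sup>+y. ennreal (max y 0 powr r) \<partial>M) \<le> ennreal (1 + C * r / (s - r))"
proof -
  let ?h = "\<lambda>x. ennreal (r * x powr (r - 1)) * indicator {1..} x"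
  have "(\<integral>\<^sup>+y. ennreal (max y 0 powr r) \<partial>M) \<le> (\<integral>\<^sup>+y. 1 + (\<integral>\<^sup>+x. ?h x * indicator {0<..<y} x \<partial>lborel) \<partial>M)"
  proof (intro nn_integral_mono)
    fix y :: real
    show "ennreal (max y 0 powr r) \<le> 1 + (\<integral>\<^sup>+x. ?h x * indicator {0<..<y} x \<partial>lborel)"
    proof (cases "y \<ge> 1")
      case True
      have "(\<integral>\<^sup>+x. ?h x * indicator {0<..<y} x \<partial>lborel) = (\<integral>\<^sup>+x. ennreal (r * x powr (r - 1)) * indicator {1..y} x \<partial>lborel)"
        by (intro nn_integral_cong_AE AE_mp[OF AE_lborel_singleton[of y] AE_I2]) (auto simp: indicator_def)
      also have "\<dots> = ennreal (y powr r - 1 powr r)"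
        using True r by (intro nn_integral_FTC_Icc) (auto intro!: derivative_eq_intros simp: powr_diff)
      finally show ?thesis using True r ge_one_powr_ge_zero[of y r] by (simp add: max_def flip: ennreal_1 ennreal_plus)
    next
      case False
      hence "max y 0 powr r \<le> 1 powr r" using r by (intro powr_mono2) auto
      hence "ennreal (max y 0 powr r) \<le> 1" by (simp flip: ennreal_1)
      thus ?thesis by (rule add_increasing2[rotated]) simp
    qed
  qed
  also have "\<dots> = 1 + (\<integral>\<^sup>+x. ?h x * ennreal (measure M {x<..}) * indicator {0<..} x \<partial>lborel)"
    by (subst nn_integral_add) (use emeasure_space_1 in \<open>auto simp: nn_integral_layer_cake intro!: layer_cake_measurable\<close>)
  also have "(\<integral>\<^sup>+x. ?h x * ennreal (measure M {x<..}) * indicator {0<..} x \<partial>lborel)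
    \<le> (\<integral>\<^sup>+x. ennreal (C * r) * ennreal (indicator {1..} x * x powr (r - s - 1)) \<partial>lborel)"
  proof (intro nn_integral_mono)
    fix x :: real
    show "?h x * ennreal (measure M {x<..}) * indicator {0<..} x \<le> ennreal (C * r) * ennreal (indicator {1..} x * x powr (r - s - 1))"
    proof (cases "x \<ge> 1")
      case True
      have "r * x powr (r - 1) * measure M {x<..} \<le> r * x powr (r - 1) * (C * x powr (- s))"
        using tail[OF True] r by (intro mult_left_mono) auto
      also have "\<dots> = C * r * x powr (r - s - 1)"
      proof -
        have "x powr (r - 1) * x powr (- s) = x powr (r - s - 1)" by (simp add: algebra_simps flip: powr_add)
        thus ?thesis by (metis mult.assoc mult.commute)
      qed
      finally show ?thesis using True r C by (simp add: ennreal_mult'[symmetric] ennreal_leI)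
    qed simp
  qed
  also have "\<dots> = ennreal (C * r) * ennreal (1 / (s - r))"
  proof -
    have "(\<integral>\<^sup>+x. ennreal (indicator {1..} x * x powr (r - s - 1)) \<partial>lborel) = ennreal (- (1 powr (r - s - 1 + 1)) / (r - s - 1 + 1))"
      using has_bochner_integral_powr_to_inf[of "r - s - 1" 1] r
      by (subst nn_integral_eq_integral) (auto simp: has_bochner_integral_iff)
    also have "- (1 powr (r - s - 1 + 1)) / (r - s - 1 + 1) = 1 / (s - r)" using r by (simp add: field_simps)
    finally show ?thesis by (subst nn_integral_cmult) auto
  qed
  finally show ?thesis using C r by (simp add: ennreal_plus add_left_mono ennreal_mult'[symmetric])
qed

section \<open>Regularly varying tails\<close>

lemma dyadic_bracket:
  fixes y :: real assumes "y \<ge> 1"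
  obtains k :: nat where "2 ^ k \<le> y" "y < 2 ^ Suc k"
proof -
  obtain n where n: "y < 2 ^ n" using real_arch_pow[of 2 y] by auto
  define m where "m = (LEAST n. y < 2 ^ n)"
  have m: "y < 2 ^ m" unfolding m_def by (rule LeastI[of _ n]) (rule n)
  have "m \<noteq> 0" using m assms by (cases m) auto
  then obtain k where k: "m = Suc k" by (cases m) auto
  have "\<not> y < 2 ^ k" using not_less_Least[of k "\<lambda>n. y < 2 ^ n"] k m_def by auto
  thus ?thesis using that[of k] m k by auto
qed

text \<open>Only the law of a single step enters here. Slow variation of \<open>l\<close> is
  rephrased as regular variation of the tail with index -\<alpha>, and positivity of the tail makes
  the ratios meaningful.\<close>

locale regularly_varying_tail = real_distribution D for D :: "real measure" +
  fixes \<alpha> :: real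
  assumes alpha: "1 < \<alpha>" "\<alpha> < 2"
    and pos: "AE x in D. 0 < x"
    and tail_pos: "measure D {x<..} > 0"
    and tail_rv: "y > 0 \<Longrightarrow> ((\<lambda>x. measure D {x * y<..} / measure D {x<..}) \<longlongrightarrow> y powr (- \<alpha>)) at_top"
begin

definition T :: "real \<Rightarrow> real" where "T x = measure D {x<..}"

lemma T_antimono: "x \<le> y \<Longrightarrow> T y \<le> T x"
  unfolding T_def by (rule finite_measure_mono) auto

lemma T_pos: "T x > 0" and T_le_1: "T x \<le> 1"
  using tail_pos by (auto simp: T_def)

lemma T_measurable [measurable]: "T \<in> borel_measurable borel"
proof -
  have "(\<lambda>x. - T x) \<in> borel_measurable borel"
    by (rule borel_measurable_mono) (auto simp: mono_def T_antimono)
  hence "(\<lambda>x. - (- T x)) \<in> borel_measurable borel" by measurable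
  thus ?thesis by simp
qed

text \<open>Iterate the doubling estimate T(2x)/T(x) < 2 powr (-s), valid for large x because s <
  \<alpha>. The factor 2 powr s pays for rounding y down to a power of two.\<close>

lemma potter_large:
  assumes "s \<ge> 0" "s < \<alpha>"
  shows "\<forall>\<^sub>F x in at_top. \<forall>y\<ge>1. T (x * y) \<le> 2 powr s * y powr (- s) * T x"
proof -
  have "(2::real) powr (- \<alpha>) < 2 powr (- s)" using assms by simp
  from order_tendstoD(2)[OF tail_rv[of 2] this] have "\<forall>\<^sub>F x in at_top. T (x * 2) / T x < 2 powr (- s)"
    by (simp add: T_def)
  then obtain x0 where x0: "\<And>x. x \<ge> x0 \<Longrightarrow> T (x * 2) / T x < 2 powr (- s)"
    by (auto simp: eventually_at_top_linorder)
  have step: "T (x * 2 ^ k) \<le> (2 ^ k) powr (- s) * T x" if "x \<ge> max x0 1" for x k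
  proof (induction k)
    case (Suc k)
    have "x \<le> x * 2 ^ k" using mult_left_mono[of 1 "2 ^ k" x] that by simp
    hence "x0 \<le> x * 2 ^ k" using that by linarith
    hence "T ((x * 2 ^ k) * 2) / T (x * 2 ^ k) < 2 powr (- s)" by (rule x0)
    hence "T ((x * 2 ^ k) * 2) \<le> 2 powr (- s) * T (x * 2 ^ k)"
      using T_pos[of "x * 2 ^ k"] by (simp add: field_simps)
    also have "\<dots> \<le> 2 powr (- s) * ((2 ^ k) powr (- s) * T x)" by (intro mult_left_mono Suc) auto
    also have "\<dots> = (2 ^ Suc k) powr (- s) * T x" by (simp add: powr_mult mult_ac)
    finally show ?case by (simp add: mult_ac)
  qed simp
  have "T (x * y) \<le> 2 powr s * y powr (- s) * T x" if "x \<ge> max x0 1" "y \<ge> 1" for x y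
  proof -
    obtain k where k: "2 ^ k \<le> y" "y < 2 ^ Suc k" using dyadic_bracket[OF \<open>y \<ge> 1\<close>] .
    have "T (x * y) \<le> T (x * 2 ^ k)" using k that by (intro T_antimono mult_left_mono) auto
    also have "\<dots> \<le> (2 ^ k) powr (- s) * T x" by (rule step) (use that in auto)
    also have "\<dots> \<le> (y / 2) powr (- s) * T x"
      using k that assms T_pos[of x] by (intro mult_right_mono powr_mono2') auto
    also have "(y / 2) powr (- s) = 2 powr s * y powr (- s)" using that by (simp add: powr_divide powr_minus field_simps)
    finally show ?thesis .
  qed
  thus ?thesis unfolding eventually_at_top_linorder by blast
qed

text \<open>The iteration now runs upwards from x y until it passes x, with the reversed doubling
  estimate, available since s > \<alpha>. It works only while x y stays above the threshold
  \<open>x1\<close>; below it the bound T \<le> 1 takes over.\<close>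

lemma potter_small:
  assumes "s > \<alpha>"
  shows "\<exists>C>0. \<forall>\<^sub>F x in at_top. \<forall>y. 0 < y \<and> y \<le> 1 \<longrightarrow> T (x * y) \<le> C * y powr (- s) * T x"
proof -
  have "(2::real) powr (- \<alpha>) > 2 powr (- s)" using assms by simp
  from order_tendstoD(1)[OF tail_rv[of 2] this] have "\<forall>\<^sub>F x in at_top. T (x * 2) / T x > 2 powr (- s)"
    by (simp add: T_def)
  then obtain x0 where x0: "\<And>x. x \<ge> x0 \<Longrightarrow> T (x * 2) / T x > 2 powr (- s)"
    by (auto simp: eventually_at_top_linorder)
  define x1 where "x1 = max x0 1"
  have x1: "x1 \<ge> x0" "x1 \<ge> 1" by (auto simp: x1_def)
  have step: "T x \<le> (2 ^ k) powr s * T (x * 2 ^ k)" if "x \<ge> x1" for x k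
  proof (induction k)
    case (Suc k)
    have "x \<le> x * 2 ^ k" using mult_left_mono[of 1 "2 ^ k" x] that x1 by simp
    hence "x0 \<le> x * 2 ^ k" using that x1 by linarith
    hence "T ((x * 2 ^ k) * 2) / T (x * 2 ^ k) > 2 powr (- s)" by (rule x0)
    hence "T (x * 2 ^ k) \<le> 2 powr s * T ((x * 2 ^ k) * 2)"
      using T_pos[of "x * 2 ^ k"] by (simp add: field_simps powr_minus)
    hence "(2 ^ k) powr s * T (x * 2 ^ k) \<le> (2 ^ k) powr s * (2 powr s * T ((x * 2 ^ k) * 2))" by (intro mult_left_mono) auto
    also have "\<dots> = (2 ^ Suc k) powr s * T (x * 2 ^ Suc k)" by (simp add: powr_mult mult_ac)
    finally show ?case using Suc by simp
  qed simp
  have small: "T (x * y) \<le> 2 powr s * y powr (- s) * T x" if "x * y \<ge> x1" "0 < y" "y \<le> 1" for x y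
  proof -
    have "1 / y \<ge> 1" using that by simp
    then obtain k where k: "2 ^ k \<le> 1 / y" "1 / y < 2 ^ Suc k" using dyadic_bracket by blast
    have xp: "x > 0" using that x1 by (metis less_le_trans zero_less_mult_pos2 zero_less_one)
    have "T (x * y) \<le> (2 ^ Suc k) powr s * T (x * y * 2 ^ Suc k)" by (rule step) (use that in auto)
    also have "\<dots> \<le> (2 / y) powr s * T x"
    proof (intro mult_mono powr_mono2 T_antimono)
      show "2 ^ Suc k \<le> 2 / y" using k by simp
      have "1 \<le> y * 2 ^ Suc k" using k that by (simp add: field_simps)
      hence "x * 1 \<le> x * (y * 2 ^ Suc k)" using xp by (intro mult_left_mono) auto
      thus "x \<le> x * y * 2 ^ Suc k" by (simp add: mult.assoc)
    qed (use assms alpha T_pos less_imp_le in auto)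
    also have "(2 / y) powr s = 2 powr s * y powr (- s)" using that by (simp add: powr_divide powr_minus field_simps)
    finally show ?thesis .
  qed
  \<comment> \<open>Dividing by T x1 makes the right-hand side at least 1 as soon as x y < x1, so
    that T \<le> 1 settles that range.\<close>
  define C where "C = 2 powr s / T x1"
  have C: "C \<ge> 2 powr s" using T_pos[of x1] T_le_1[of x1] by (simp add: C_def field_simps)
  have "T (x * y) \<le> C * y powr (- s) * T x" if "x \<ge> x1" "0 < y" "y \<le> 1" for x y
  proof (cases "x * y \<ge> x1")
    case True
    have "T (x * y) \<le> 2 powr s * y powr (- s) * T x" using small True that by blast
    also have "\<dots> \<le> C * y powr (- s) * T x" using C T_pos[of x] by (intro mult_right_mono) auto
    finally show ?thesis .
  next
    case False
    have xp: "x > 0" using that x1 by auto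
    \<comment> \<open>The estimate at x1/x, the smallest ratio covered so far; lowering the ratio
      further to y only enlarges the negative power.\<close>
    have "T (x * (x1 / x)) \<le> 2 powr s * (x1 / x) powr (- s) * T x"
      by (rule small) (use that x1 xp in auto)
    also have "\<dots> \<le> 2 powr s * y powr (- s) * T x"
      using False that x1 xp assms alpha T_pos[of x] by (intro mult_right_mono mult_left_mono powr_mono2') (auto simp: field_simps)
    finally have "T x1 \<le> 2 powr s * y powr (- s) * T x" using xp by simp
    hence "1 \<le> C * y powr (- s) * T x" using T_pos[of x1] by (simp add: C_def field_simps)
    thus ?thesis using T_le_1[of "x * y"] by linarith
  qed
  moreover have "C > 0" using T_pos[of x1] by (simp add: C_def)
  ultimately show ?thesis unfolding eventually_at_top_linorder by blast
qed

lemma T_le_powr: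
  assumes "s \<ge> 0" "s < \<alpha>"
  shows "\<exists>C>0. \<forall>x\<ge>1. T x \<le> C * x powr (- s)"
proof -
  obtain x0 where x0: "\<And>x y. x \<ge> x0 \<Longrightarrow> y \<ge> 1 \<Longrightarrow> T (x * y) \<le> 2 powr s * y powr (- s) * T x"
    using potter_large[OF assms] unfolding eventually_at_top_linorder by blast
  define x1 where "x1 = max x0 1"
  have x1: "x1 \<ge> x0" "x1 \<ge> 1" by (auto simp: x1_def)
  define C where "C = 2 powr s * x1 powr s"
  have "T x \<le> C * x powr (- s)" if "x \<ge> 1" for x
  proof (cases "x \<ge> x1")
    case True
    have "T (x1 * (x / x1)) \<le> 2 powr s * (x / x1) powr (- s) * T x1"
      by (rule x0) (use True x1 in auto)
    also have "\<dots> \<le> 2 powr s * (x / x1) powr (- s) * 1" using T_le_1 by (intro mult_left_mono) auto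
    also have "\<dots> = C * x powr (- s)" using x1 that by (simp add: C_def powr_divide powr_minus field_simps)
    finally show ?thesis using x1 by simp
  next
    case False
    have "1 * 1 \<le> 2 powr s * (x1 / x) powr s" using False that assms by (intro mult_mono ge_one_powr_ge_zero) auto
    also have "\<dots> = C * x powr (- s)" using x1 that by (simp add: C_def powr_divide powr_minus field_simps)
    finally show ?thesis using T_le_1[of x] by simp
  qed
  moreover have "C > 0" using x1 by (simp add: C_def)
  ultimately show ?thesis by blast
qed

text \<open>The bound for small ratios at y = 1/x, where T (x * y) is the constant T 1.\<close>

lemma T_ge_powr:
  assumes "s > \<alpha>"
  shows "\<exists>C>0. \<forall>\<^sub>F x in at_top. x powr (- s) \<le> C * T x"
proof -
  obtain C x0 where C: "C > 0" "\<And>x y. x \<ge> x0 \<Longrightarrow> 0 < y \<Longrightarrow> y \<le> 1 \<Longrightarrow> T (x * y) \<le> C * y powr (- s) * T x"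
    using potter_small[OF assms] unfolding eventually_at_top_linorder by blast
  have "x powr (- s) \<le> (C / T 1) * T x" if "x \<ge> max x0 1" for x
  proof -
    have "T (x * (1 / x)) \<le> C * (1 / x) powr (- s) * T x" using that by (intro C) auto
    hence "T 1 \<le> C * x powr s * T x" using that by (simp add: powr_divide powr_minus)
    thus ?thesis using that T_pos[of 1] by (simp add: field_simps powr_minus)
  qed
  moreover have "C / T 1 > 0" using C T_pos[of 1] by simp
  ultimately show ?thesis unfolding eventually_at_top_linorder by blast
qed

lemma integrable_id: "integrable D (\<lambda>x. x)"
proof (rule integrableI_bounded)
  define s where "s = (1 + \<alpha>) / 2"
  have s: "1 < s" "s < \<alpha>" using alpha by (auto simp: s_def)
  obtain C where C: "C > 0" "\<And>x. x \<ge> 1 \<Longrightarrow> T x \<le> C * x powr (- s)" using T_le_powr[of s] s by auto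
  have "(\<integral>\<^sup>+x. ennreal (norm x) \<partial>D) = (\<integral>\<^sup>+x. ennreal (max x 0 powr 1) \<partial>D)"
    using pos by (intro nn_integral_cong_AE) auto
  also have "\<dots> \<le> ennreal (1 + C * 1 / (s - 1))"
    by (rule nn_integral_powr_le_tail[of 1 s C]) (use s C in \<open>auto simp: T_def\<close>)
  also have "\<dots> < \<infinity>" by simp
  finally show "(\<integral>\<^sup>+x. ennreal (norm x) \<partial>D) < \<infinity>" .
qed simp

definition \<mu> :: real where "\<mu> = (\<integral>x. x \<partial>D)"

lemma mu_pos: "\<mu> > 0"
proof -
  have "\<mu> \<ge> 0" unfolding \<mu>_def using pos by (intro integral_nonneg_AE) auto
  moreover have "\<mu> \<noteq> 0"
  proof
    assume "\<mu> = 0"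
    moreover have "AE x in D. 0 \<le> x" using pos by eventually_elim simp
    ultimately have "AE x in D. x = 0"
      using integral_nonneg_eq_0_iff_AE[OF integrable_id] by (simp add: \<mu>_def)
    with pos have "AE x in D. False" by eventually_elim simp
    thus False by (simp add: AE_False emeasure_space_1[simplified])
  qed
  ultimately show ?thesis by simp
qed

lemma has_bochner_integral_T: "has_bochner_integral lborel (\<lambda>x. indicator {0<..} x * T x) \<mu>"
proof (rule has_bochner_integral_nn_integral)
  have "(\<integral>\<^sup>+x. ennreal (indicator {0<..} x * T x) \<partial>lborel) = (\<integral>\<^sup>+x. 1 * ennreal (measure D {x<..}) * indicator {0<..} x \<partial>lborel)"
    by (intro nn_integral_cong) (auto simp: T_def indicator_def)
  also have "\<dots> = (\<integral>\<^sup>+y. (\<integral>\<^sup>+x. 1 * indicator {0<..<y} x \<partial>lborel) \<partial>D)"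
    by (rule nn_integral_layer_cake[symmetric]) simp
  also have "\<dots> = (\<integral>\<^sup>+y. ennreal y \<partial>D)" using pos by (intro nn_integral_cong_AE) auto
  also have "\<dots> = ennreal \<mu>" unfolding \<mu>_def using pos by (intro nn_integral_eq_integral integrable_id) auto
  finally show "(\<integral>\<^sup>+x. ennreal (indicator {0<..} x * T x) \<partial>lborel) = ennreal \<mu>" .
qed (use mu_pos T_pos in \<open>auto simp: less_imp_le\<close>)

definition \<Phi> :: "complex \<Rightarrow> complex" where "\<Phi> z = (\<integral>x. exp (- (z * of_real x)) \<partial>D)"

lemma integrable_exp: "Re z \<ge> 0 \<Longrightarrow> integrable D (\<lambda>x. exp (- (z * of_real x)))"
  using pos by (intro integrable_const_bound[of _ 1]) (auto elim!: eventually_mono)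

text \<open>Integrating z (1 - exp(-z v)) over 0 < v < x gives exp(-z x) - 1 + z x; then Fubini. The
  centring is thus absorbed into a factor of norm at most 2, so finiteness of the mean, which is the
  integral of T, gives absolute convergence even for imaginary z.\<close>

lemma Phi_expansion:
  assumes z: "Re z \<ge> 0"
  shows "\<Phi> z - 1 + z * of_real \<mu> = z * (\<integral>x. (indicator {0<..} x * T x) *\<^sub>R (1 - exp (- (z * of_real x))) \<partial>lborel)"
proof -
  interpret L: pair_sigma_finite lborel D ..
  define f where "f v x = (indicator {0<..} v * indicator {v<..} x) *\<^sub>R (z * (1 - exp (- (z * of_real v))))" for v x :: real
  have [measurable]: "case_prod f \<in> borel_measurable (lborel \<Otimes>\<^sub>M D)"
  proof -
    have "case_prod f = (\<lambda>(v, x). (if 0 < v \<and> v < x then 1 else 0) *\<^sub>R (z * (1 - exp (- (z * of_real v)))))"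
      by (auto simp: f_def fun_eq_iff indicator_def)
    thus ?thesis by simp
  qed
  have fv: "has_bochner_integral D (f v) ((indicator {0<..} v * T v) *\<^sub>R (z * (1 - exp (- (z * of_real v)))))" for v
  proof -
    have "has_bochner_integral D (indicator {v<..}) (measure D {v<..})"
      by (intro has_bochner_integral_real_indicator) (auto simp: emeasure_eq_measure)
    from has_bochner_integral_scaleR_left[OF this, of "indicator {0<..} v *\<^sub>R (z * (1 - exp (- (z * of_real v))))"]
    show ?thesis by (simp add: f_def[abs_def] T_def mult.commute)
  qed
  have nf: "(\<integral>x. norm (f v x) \<partial>D) = (indicator {0<..} v * T v) * norm (z * (1 - exp (- (z * of_real v))))" for v
  proof -
    have "(\<integral>x. norm (f v x) \<partial>D) = (\<integral>x. indicator {v<..} x * (indicator {0<..} v * norm (z * (1 - exp (- (z * of_real v))))) \<partial>D)"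
      by (intro Bochner_Integration.integral_cong) (auto simp: f_def indicator_def)
    thus ?thesis by (simp add: T_def mult_ac)
  qed
  have int: "integrable (lborel \<Otimes>\<^sub>M D) (case_prod f)"
  proof (rule L.Fubini_integrable)
    show "integrable lborel (\<lambda>v. \<integral>x. norm (case_prod f (v, x)) \<partial>D)"
    proof (rule Bochner_Integration.integrable_bound)
      show "integrable lborel (\<lambda>v. (indicator {0<..} v * T v) * (norm z * 2))"
        using has_bochner_integral_T by (intro integrable_mult_left) (auto simp: has_bochner_integral_iff)
      show "AE v in lborel. norm (\<integral>x. norm (case_prod f (v, x)) \<partial>D) \<le> norm ((indicator {0<..} v * T v) * (norm z * 2))"
      proof (intro AE_I2)
        fix v
        have "norm (z * (1 - exp (- (z * of_real v)))) \<le> norm z * 2" if "v > 0"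
          using norm_one_minus_exp_le_2[of "z * of_real v"] z that by (auto simp: norm_mult intro!: mult_left_mono)
        thus "norm (\<integral>x. norm (case_prod f (v, x)) \<partial>D) \<le> norm ((indicator {0<..} v * T v) * (norm z * 2))"
          using T_pos[of v] by (auto simp: nf indicator_def abs_mult)
      qed
    qed (simp add: nf)
  qed (use fv in \<open>auto simp: has_bochner_integral_iff\<close>)
  have "(\<integral>x. (\<integral>v. f v x \<partial>lborel) \<partial>D) = (\<integral>v. (\<integral>x. f v x \<partial>D) \<partial>lborel)"
    by (rule L.Fubini_integral[OF int])
  also have "\<dots> = (\<integral>v. z * ((indicator {0<..} v * T v) *\<^sub>R (1 - exp (- (z * of_real v)))) \<partial>lborel)"
    using fv by (intro Bochner_Integration.integral_cong) (auto simp: has_bochner_integral_iff)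
  also have "\<dots> = z * (\<integral>v. (indicator {0<..} v * T v) *\<^sub>R (1 - exp (- (z * of_real v))) \<partial>lborel)"
    by (rule integral_mult_right_zero)
  also have "(\<integral>x. (\<integral>v. f v x \<partial>lborel) \<partial>D) = (\<integral>x. exp (- (z * of_real x)) - 1 + z * of_real x \<partial>D)"
  proof (rule integral_cong_AE)
    show "AE x in D. (\<integral>v. f v x \<partial>lborel) = exp (- (z * of_real x)) - 1 + z * of_real x"
      using pos
    proof eventually_elim
      case (elim x)
      have "(\<integral>v. f v x \<partial>lborel) = (\<integral>v. indicator {0..x} v *\<^sub>R (z * (1 - exp (- (z * of_real v)))) \<partial>lborel)"
        by (intro integral_cong_AE AE_mp[OF AE_lborel_singleton[of 0] AE_mp[OF AE_lborel_singleton[of x] AE_I2]]) (auto simp: f_def indicator_def)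
      also have "\<dots> = (\<lambda>v. z * of_real v + exp (- (z * of_real v))) x - (\<lambda>v. z * of_real v + exp (- (z * of_real v))) 0"
      proof (rule integral_FTC_Icc)
        show "((\<lambda>v. z * of_real v + exp (- (z * of_real v))) has_vector_derivative z * (1 - exp (- (z * of_real v)))) (at v within {0..x})" for v
          by (auto intro!: derivative_eq_intros has_vector_derivative_real_field simp: algebra_simps)
      qed (use elim in \<open>auto intro!: continuous_intros\<close>)
      finally show ?case by simp
    qed
  qed auto
  also have "\<dots> = \<Phi> z - 1 + z * of_real \<mu>"
    unfolding \<Phi>_def \<mu>_def using integrable_exp[OF z] integrable_id
    by (simp add: prob_space[simplified])
  finally show ?thesis .
qed

end

section \<open>Norming function and Laplace asymptotics of one step\<close>

text \<open>In the notation of the theorem \<open>b = \<mu> a\<close>.\<close>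
locale normed_tail = regularly_varying_tail +
  fixes b :: "real \<Rightarrow> real"
  assumes b_pos: "t > 0 \<Longrightarrow> b t > 0"
    and b_lim: "filterlim b at_top at_top"
    and norming: "((\<lambda>t. t / \<mu> * T (b t)) \<longlongrightarrow> 1) at_top"
begin

lemma eventually_b_pos: "\<forall>\<^sub>F t in at_top. b t > 0"
  using eventually_gt_at_top[of 0] by eventually_elim (rule b_pos)

lemma scaled_tail_tendsto:
  assumes "y > 0"
  shows "((\<lambda>t. t / \<mu> * T (b t * y)) \<longlongrightarrow> y powr (- \<alpha>)) at_top"
proof -
  have "((\<lambda>t. T (b t * y) / T (b t)) \<longlongrightarrow> y powr (- \<alpha>)) at_top"
    using filterlim_compose[OF tail_rv[OF assms] b_lim] by (simp add: T_def)
  from tendsto_mult[OF norming this] have "((\<lambda>t. t / \<mu> * T (b t) * (T (b t * y) / T (b t))) \<longlongrightarrow> y powr (- \<alpha>)) at_top"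
    by simp
  moreover have "t / \<mu> * T (b t) * (T (b t * y) / T (b t)) = t / \<mu> * T (b t * y)" for t
    using T_pos[of "b t"] by simp
  ultimately show ?thesis by simp
qed

text \<open>Both Potter bounds at x = b t, with exponents on either side of \<alpha>; the prefactor
  t/\<mu> T(b t) is eventually below 2.\<close>

lemma scaled_tail_bound:
  assumes "0 < \<delta>" "\<delta> < \<alpha>"
  shows "\<exists>C>0. \<forall>\<^sub>F t in at_top. \<forall>y>0. t / \<mu> * T (b t * y) \<le>
    C * (if y \<le> 1 then y powr (- (\<alpha> + \<delta>)) else y powr (- (\<alpha> - \<delta>)))"
proof -
  obtain C where C: "C > 0" "\<forall>\<^sub>F x in at_top. \<forall>y. 0 < y \<and> y \<le> 1 \<longrightarrow> T (x * y) \<le> C * y powr (- (\<alpha> + \<delta>)) * T x"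
    using potter_small[of "\<alpha> + \<delta>"] assms by auto
  have L: "\<forall>\<^sub>F x in at_top. \<forall>y\<ge>1. T (x * y) \<le> 2 powr (\<alpha> - \<delta>) * y powr (- (\<alpha> - \<delta>)) * T x"
    using potter_large[of "\<alpha> - \<delta>"] assms by auto
  define C' where "C' = max C (2 powr (\<alpha> - \<delta>))"
  have C': "C' > 0" "C' \<ge> C" "C' \<ge> 2 powr (\<alpha> - \<delta>)" using C by (auto simp: C'_def)
  have "\<forall>\<^sub>F t in at_top. t / \<mu> * T (b t) < 2" using order_tendstoD(2)[OF norming, of 2] by simp
  moreover have "\<forall>\<^sub>F t in at_top. \<forall>y. 0 < y \<and> y \<le> 1 \<longrightarrow> T (b t * y) \<le> C * y powr (- (\<alpha> + \<delta>)) * T (b t)"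
    using eventually_compose_filterlim[OF C(2) b_lim] .
  moreover have "\<forall>\<^sub>F t in at_top. \<forall>y\<ge>1. T (b t * y) \<le> 2 powr (\<alpha> - \<delta>) * y powr (- (\<alpha> - \<delta>)) * T (b t)"
    using eventually_compose_filterlim[OF L b_lim] .
  moreover have "\<forall>\<^sub>F t in at_top. (t::real) > 0" by (rule eventually_gt_at_top)
  ultimately have "\<forall>\<^sub>F t in at_top. \<forall>y>0. t / \<mu> * T (b t * y) \<le>
    (2 * C') * (if y \<le> 1 then y powr (- (\<alpha> + \<delta>)) else y powr (- (\<alpha> - \<delta>)))"
  proof eventually_elim
    case (elim t)
    show ?case
    proof (intro allI impI)
      fix y :: real assume y: "y > 0"
      define B where "B = (if y \<le> 1 then y powr (- (\<alpha> + \<delta>)) else y powr (- (\<alpha> - \<delta>)))"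
      have B: "B \<ge> 0" by (simp add: B_def)
      have "T (b t * y) \<le> C' * B * T (b t)"
      proof (cases "y \<le> 1")
        case True
        have "T (b t * y) \<le> C * y powr (- (\<alpha> + \<delta>)) * T (b t)" using elim y True by blast
        also have "\<dots> \<le> C' * y powr (- (\<alpha> + \<delta>)) * T (b t)" using C' T_pos[of "b t"] by (intro mult_right_mono) auto
        finally show ?thesis using True by (simp add: B_def)
      next
        case False
        have "T (b t * y) \<le> 2 powr (\<alpha> - \<delta>) * y powr (- (\<alpha> - \<delta>)) * T (b t)" using elim y False by auto
        also have "\<dots> \<le> C' * y powr (- (\<alpha> - \<delta>)) * T (b t)" using C' T_pos[of "b t"] by (intro mult_right_mono) auto
        finally show ?thesis using False by (simp add: B_def)
      qed
      hence "t / \<mu> * T (b t * y) \<le> t / \<mu> * (C' * B * T (b t))"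
        using elim mu_pos by (intro mult_left_mono) auto
      also have "\<dots> = C' * B * (t / \<mu> * T (b t))" by simp
      also have "\<dots> \<le> C' * B * 2" using elim C' B by (intro mult_left_mono) auto
      finally show "t / \<mu> * T (b t * y) \<le> (2 * C') * (if y \<le> 1 then y powr (- (\<alpha> + \<delta>)) else y powr (- (\<alpha> - \<delta>)))"
        by (simp add: B_def)
    qed
  qed
  thus ?thesis using C' by (intro exI[of _ "2 * C'"]) auto
qed

text \<open>T (b t) is of order 1/t while T x is at most a multiple of x powr (-s) with s > 1; hence
  b t / t is at most a multiple of b t powr (1 - s).\<close>

lemma b_over_t: "((\<lambda>t. b t / t) \<longlongrightarrow> 0) at_top"
proof -
  define s where "s = (1 + \<alpha>) / 2"
  have s: "1 < s" "s < \<alpha>" using alpha by (auto simp: s_def)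
  obtain C where C: "C > 0" "\<And>x. x \<ge> 1 \<Longrightarrow> T x \<le> C * x powr (- s)" using T_le_powr[of s] s by auto
  have "((\<lambda>t. (2 * C / \<mu>) * b t powr (1 - s)) \<longlongrightarrow> (2 * C / \<mu>) * 0) at_top"
    using s by (intro tendsto_intros tendsto_neg_powr b_lim) auto
  moreover have "\<forall>\<^sub>F t in at_top. norm (b t / t) \<le> (2 * C / \<mu>) * b t powr (1 - s)"
  proof -
    have "\<forall>\<^sub>F t in at_top. t / \<mu> * T (b t) > 1 / 2" using order_tendstoD(1)[OF norming, of "1/2"] by simp
    moreover have "\<forall>\<^sub>F t in at_top. b t \<ge> 1" using b_lim by (simp add: filterlim_at_top)
    moreover have "\<forall>\<^sub>F t in at_top. (t::real) > 0" by (rule eventually_gt_at_top)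
    ultimately show ?thesis
    proof eventually_elim
      case (elim t)
      have "1 / 2 \<le> t / \<mu> * (C * b t powr (- s))"
      proof -
        have "t / \<mu> * T (b t) \<le> t / \<mu> * (C * b t powr (- s))"
          using elim mu_pos C(2)[of "b t"] by (intro mult_left_mono) auto
        with elim show ?thesis by linarith
      qed
      hence "b t / t * (1 / 2) \<le> b t / t * (t / \<mu> * (C * b t powr (- s)))"
        using elim by (intro mult_left_mono) auto
      also have "\<dots> = C / \<mu> * (b t powr 1 * b t powr (- s))" using elim by simp
      also have "b t powr 1 * b t powr (- s) = b t powr (1 - s)" unfolding powr_add[symmetric] by simp
      finally show ?case using elim by simp
    qed
  qed
  ultimately show ?thesis by (intro Lim_null_comparison[of "\<lambda>t. b t / t"]) auto
qed

text \<open>Mirror image of the previous argument, with a lower bound on T of exponent s < 2. It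
  will make the quadratic error of the centring factor negligible over about t/\<mu> steps.\<close>

lemma t_over_b_squared: "((\<lambda>t. t / (b t)\<^sup>2) \<longlongrightarrow> 0) at_top"
proof -
  define s where "s = (2 + \<alpha>) / 2"
  have s: "\<alpha> < s" "s < 2" using alpha by (auto simp: s_def)
  obtain C where C: "C > 0" "\<forall>\<^sub>F x in at_top. x powr (- s) \<le> C * T x" using T_ge_powr[of s] s by auto
  have "((\<lambda>t. (2 * C * \<mu>) * b t powr (s - 2)) \<longlongrightarrow> (2 * C * \<mu>) * 0) at_top"
    using s by (intro tendsto_intros tendsto_neg_powr b_lim) auto
  moreover have "\<forall>\<^sub>F t in at_top. norm (t / (b t)\<^sup>2) \<le> (2 * C * \<mu>) * b t powr (s - 2)"
  proof -
    have "\<forall>\<^sub>F t in at_top. t / \<mu> * T (b t) < 2" using order_tendstoD(2)[OF norming, of 2] by simp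
    moreover have "\<forall>\<^sub>F t in at_top. b t powr (- s) \<le> C * T (b t)" by (rule eventually_compose_filterlim[OF C(2) b_lim])
    moreover have "\<forall>\<^sub>F t in at_top. (t::real) > 0" by (rule eventually_gt_at_top)
    moreover note eventually_b_pos
    ultimately show ?thesis
    proof eventually_elim
      case (elim t)
      have "t / \<mu> * b t powr (- s) \<le> t / \<mu> * (C * T (b t))"
        using elim mu_pos by (intro mult_left_mono) auto
      also have "\<dots> = C * (t / \<mu> * T (b t))" by simp
      also have "\<dots> \<le> C * 2" using elim C by (intro mult_left_mono) auto
      finally have "t * b t powr (- s) \<le> 2 * C * \<mu>" using mu_pos by (simp add: field_simps)
      hence "(t * b t powr (- s)) * b t powr (s - 2) \<le> (2 * C * \<mu>) * b t powr (s - 2)" by (intro mult_right_mono) auto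
      also have "(t * b t powr (- s)) * b t powr (s - 2) = t * b t powr (- 2)" by (simp add: mult.assoc flip: powr_add)
      also have "\<dots> = t / (b t)\<^sup>2" using elim by (simp add: powr_minus divide_inverse)
      finally show ?case using elim by simp
    qed
  qed
  ultimately show ?thesis by (intro Lim_null_comparison[of "\<lambda>t. t / (b t)\<^sup>2"]) auto
qed

text \<open>In \<open>Phi_expansion\<close> at z / b t substitute x = b t * y: the weight becomes
  t/\<mu> T(b t * y), which tends to y powr (-\<alpha>), and the limiting integral is
  \<open>Gamma_neg_integral\<close> with \<beta> = \<alpha> - 1.\<close>

lemma laplace_limit:
  assumes z: "Re z \<ge> 0" "z \<noteq> 0"
  shows "((\<lambda>t. of_real (t / \<mu>) * (\<Phi> (z / of_real (b t)) - 1 + z / of_real (b t) * of_real \<mu>))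
     \<longlongrightarrow> - (of_real (Gamma (1 - \<alpha>)) * z powr of_real \<alpha>)) at_top"
proof -
  \<comment> \<open>Small enough for \<alpha> - \<delta> > 1, so that the majorant is integrable at
    infinity, and for \<alpha> + \<delta> < 2, so that it is integrable at 0 after gaining a factor
    y.\<close>
  define \<delta> where "\<delta> = min (\<alpha> - 1) (2 - \<alpha>) / 2"
  have \<delta>: "0 < \<delta>" "\<delta> < \<alpha>" "\<alpha> - \<delta> > 1" "\<alpha> + \<delta> < 2" using alpha by (auto simp: \<delta>_def min_def field_simps)
  define H where "H t y = (indicator {0<..} y * (t / \<mu> * T (b t * y))) *\<^sub>R (1 - exp (- (z * of_real y)))" for t y
  define H0 where "H0 y = indicator {0<..} y *\<^sub>R (of_real (y powr (- (\<alpha> - 1) - 1)) * (1 - exp (- (z * of_real y))))" for y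
  have I0: "integral\<^sup>L lborel H0 = of_real (Gamma (1 - (\<alpha> - 1)) / (\<alpha> - 1)) * z powr of_real (\<alpha> - 1)"
    using Gamma_neg_integral[OF z, of "\<alpha> - 1"] alpha unfolding H0_def by (simp add: has_bochner_integral_iff)
  obtain C where C: "C > 0" "\<forall>\<^sub>F t in at_top. \<forall>y>0. t / \<mu> * T (b t * y) \<le>
    C * (if y \<le> 1 then y powr (- (\<alpha> + \<delta>)) else y powr (- (\<alpha> - \<delta>)))"
    using scaled_tail_bound[OF \<delta>(1,2)] by blast
  define w where "w y = C * norm z * (indicator {0..1} y * y powr (1 - (\<alpha> + \<delta>))) + C * 2 * (indicator {1..} y * y powr (- (\<alpha> - \<delta>)))" for y :: real
  have [measurable]: "H t \<in> borel_measurable lborel" "H0 \<in> borel_measurable lborel" for t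
    unfolding H_def H0_def by measurable
  have "((\<lambda>t. integral\<^sup>L lborel (H t)) \<longlongrightarrow> integral\<^sup>L lborel H0) at_top"
  proof (rule integral_dominated_convergence_at_top)
    show "integrable lborel w"
      using has_bochner_integral_powr_from_0[of "1 - (\<alpha> + \<delta>)" 1] has_bochner_integral_powr_to_inf[of "- (\<alpha> - \<delta>)" 1] \<delta>
      unfolding w_def by (intro Bochner_Integration.integrable_add integrable_mult_right) (auto simp: has_bochner_integral_iff)
    show "AE y in lborel. ((\<lambda>t. H t y) \<longlongrightarrow> H0 y) at_top"
    proof (intro AE_I2)
      fix y :: real
      show "((\<lambda>t. H t y) \<longlongrightarrow> H0 y) at_top"
      proof (cases "y > 0")
        case True
        from tendsto_scaleR[OF scaled_tail_tendsto[OF True] tendsto_const, of "1 - exp (- (z * of_real y))"]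
        show ?thesis using True by (simp add: H_def H0_def scaleR_conv_of_real)
      qed (simp add: H_def H0_def)
    qed
    show "\<forall>\<^sub>F t in at_top. AE y in lborel. norm (H t y) \<le> w y"
      using C(2) eventually_gt_at_top[of 0]
    proof eventually_elim
      case (elim t)
      show ?case
      proof (intro AE_I2)
        fix y :: real
        show "norm (H t y) \<le> w y"
        proof (cases "y > 0")
          case True
          have Re: "Re (z * of_real y) \<ge> 0" using z True by simp
          have nn: "t / \<mu> * T (b t * y) \<ge> 0" using elim mu_pos T_pos[of "b t * y"] by simp
          have nH: "norm (H t y) = (t / \<mu> * T (b t * y)) * norm (1 - exp (- (z * of_real y)))"
            using True nn elim mu_pos T_pos[of "b t * y"] by (simp add: H_def abs_mult)
          show ?thesis
          proof (cases "y \<le> 1")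
            case y1: True
            have "norm (H t y) \<le> (C * y powr (- (\<alpha> + \<delta>))) * (norm z * y)"
              unfolding nH
            proof (rule mult_mono)
              show "t / \<mu> * T (b t * y) \<le> C * y powr (- (\<alpha> + \<delta>))" using elim True y1 by auto
              show "norm (1 - exp (- (z * of_real y))) \<le> norm z * y"
                using norm_one_minus_exp_le[OF Re] True by (simp add: norm_mult)
            qed (use C in auto)
            also have "\<dots> = C * norm z * (y powr (- (\<alpha> + \<delta>)) * y powr 1)" using True by simp
            also have "y powr (- (\<alpha> + \<delta>)) * y powr 1 = y powr (1 - (\<alpha> + \<delta>))" unfolding powr_add[symmetric] by (simp add: algebra_simps)
            also have "C * norm z * y powr (1 - (\<alpha> + \<delta>)) \<le> w y"
              using True y1 C by (auto simp: w_def indicator_def)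
            finally show ?thesis .
          next
            case y1: False
            have "norm (H t y) \<le> (C * y powr (- (\<alpha> - \<delta>))) * 2"
              unfolding nH
            proof (rule mult_mono)
              show "t / \<mu> * T (b t * y) \<le> C * y powr (- (\<alpha> - \<delta>))"
                using elim(1)[rule_format, OF True] y1 by simp
            qed (use C norm_one_minus_exp_le_2[OF Re] in auto)
            also have "\<dots> \<le> w y" using True y1 C by (auto simp: w_def indicator_def)
            finally show ?thesis .
          qed
        next
          case False
          thus ?thesis using C by (auto simp: H_def w_def indicator_def)
        qed
      qed
    qed
  qed auto
  hence "((\<lambda>t. z * integral\<^sup>L lborel (H t)) \<longlongrightarrow> z * integral\<^sup>L lborel H0) at_top" by (intro tendsto_intros)
  also have "z * integral\<^sup>L lborel H0 = - (of_real (Gamma (1 - \<alpha>)) * z powr of_real \<alpha>)"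
  proof -
    \<comment> \<open>The outer factor z raises the power from \<alpha> - 1 to \<alpha>; the sign
      comes from Gamma(2 - \<alpha>)/(\<alpha> - 1) = -Gamma(1 - \<alpha>).\<close>
    have "z * z powr of_real (\<alpha> - 1) = z powr of_real \<alpha>"
      using z by (simp add: powr_diff)
    moreover have "1 - (\<alpha> - 1) = 2 - \<alpha>" by simp
    ultimately show ?thesis unfolding I0 Gamma_one_minus(1)[OF alpha]
      by (simp only: of_real_minus of_real_divide) (simp add: mult_ac)
  qed
  also have "((\<lambda>t. z * integral\<^sup>L lborel (H t)) \<longlongrightarrow> - (of_real (Gamma (1 - \<alpha>)) * z powr of_real \<alpha>)) at_top \<longleftrightarrow> ?thesis"
  proof (rule filterlim_cong[OF refl refl])
    show "\<forall>\<^sub>F t in at_top. z * integral\<^sup>L lborel (H t) = of_real (t / \<mu>) * (\<Phi> (z / of_real (b t)) - 1 + z / of_real (b t) * of_real \<mu>)"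
      using eventually_b_pos
    proof eventually_elim
      case (elim t)
      have Re: "Re (z / of_real (b t)) \<ge> 0" using z elim by (simp add: Re_divide_of_real)
      define f where "f x = (indicator {0<..} x * T x) *\<^sub>R (1 - exp (- (z / of_real (b t) * of_real x)))" for x
      have "(\<integral>x. f x \<partial>lborel) = \<bar>b t\<bar> *\<^sub>R (\<integral>x. f (0 + b t * x) \<partial>lborel)"
        by (rule lborel_integral_real_affine) (use elim in auto)
      hence "of_real (t / \<mu>) * (z / of_real (b t) * (\<integral>x. f x \<partial>lborel)) = z * (of_real (t / \<mu>) * (\<integral>x. f (b t * x) \<partial>lborel))"
        using elim by (simp add: scaleR_conv_of_real)
      also have "of_real (t / \<mu>) * (\<integral>x. f (b t * x) \<partial>lborel) = (\<integral>x. of_real (t / \<mu>) * f (b t * x) \<partial>lborel)"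
        by (rule integral_mult_right_zero[symmetric])
      also have "(\<lambda>x. of_real (t / \<mu>) * f (b t * x)) = H t"
        using elim by (auto simp: H_def f_def fun_eq_iff indicator_def zero_less_mult_iff scaleR_conv_of_real)
      finally show ?case unfolding Phi_expansion[OF Re] by (simp add: f_def)
    qed
  qed
  finally show ?thesis .
qed

end

text \<open>Mean value inequality on the half plane cut by the disc of radius |z|, where the
  derivative 1 - exp(-w) has norm at most |w| \<le> |z|.\<close>

lemma norm_exp_minus_linear_le:
  fixes z :: complex assumes "Re z \<ge> 0"
  shows "norm (exp (- z) - 1 + z) \<le> (norm z)\<^sup>2"
proof -
  let ?S = "{w. Re w \<ge> 0} \<inter> cball 0 (norm z)"
  have "norm ((\<lambda>w. exp (- w) - 1 + w) z - (\<lambda>w. exp (- w) - 1 + w) 0) \<le> norm z * norm (z - 0)"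
  proof (rule field_differentiable_bound)
    show "convex ?S" by (intro convex_Int convex_halfspace_Re_ge convex_cball)
    show "((\<lambda>w. exp (- w) - 1 + w) has_field_derivative (1 - exp (- w))) (at w within ?S)" for w
      by (auto intro!: derivative_eq_intros)
    show "norm (1 - exp (- w)) \<le> norm z" if "w \<in> ?S" for w
      using norm_one_minus_exp_le[of w] that by auto
  qed (use assms in auto)
  thus ?thesis by (simp add: power2_eq_square)
qed

text \<open>The power is exp(n Ln(1 + h)), free of branch problems because n is a natural number,
  and Ln(1 + h)/h tends to 1. The quotient is completed by 1 at 0 since h t may vanish.\<close>

lemma tendsto_one_plus_power_exp:
  fixes h :: "real \<Rightarrow> complex" and n :: "real \<Rightarrow> nat"
  assumes h: "(h \<longlongrightarrow> 0) F" and nh: "((\<lambda>t. of_nat (n t) * h t) \<longlongrightarrow> L) F"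
  shows "((\<lambda>t. (1 + h t) ^ n t) \<longlongrightarrow> exp L) F"
proof -
  define g where "g w = (if w = 0 then 1 else Ln (1 + w) / w)" for w :: complex
  have "((\<lambda>w. Ln (1 + w)) has_field_derivative 1) (at 0)"
    by (auto intro!: derivative_eq_intros)
  hence "((\<lambda>w. Ln (1 + w) / w) \<longlongrightarrow> 1) (at 0)" by (simp add: has_field_derivative_iff)
  hence "(g \<longlongrightarrow> 1) (at 0)"
    by (rule filterlim_mono_eventually[of _ "nhds 1" "at 0"]) (auto simp: g_def eventually_at_filter)
  hence "isCont g 0" by (simp add: isCont_def g_def)
  from isCont_tendsto_compose[OF this h] have "((\<lambda>t. g (h t)) \<longlongrightarrow> 1) F" by (simp add: g_def)
  from tendsto_mult[OF nh this] have "((\<lambda>t. exp (of_nat (n t) * h t * g (h t))) \<longlongrightarrow> exp L) F"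
    by (intro tendsto_intros) simp
  moreover have "\<forall>\<^sub>F t in F. exp (of_nat (n t) * h t * g (h t)) = (1 + h t) ^ n t"
  proof -
    have "\<forall>\<^sub>F t in F. norm (h t) < 1" using tendstoD[OF h, of 1] by simp
    thus ?thesis
    proof eventually_elim
      case (elim t)
      hence "1 + h t \<noteq> 0" by (metis add_eq_0_iff norm_minus_cancel norm_one order_less_irrefl)
      moreover have "h t * g (h t) = Ln (1 + h t)" by (simp add: g_def)
      ultimately show ?case by (simp add: mult.assoc exp_of_nat_mult)
    qed
  qed
  ultimately show ?thesis by (blast intro: Lim_transform_eventually)
qed

section \<open>Transforms of the centred walk and truncated second moments\<close>

context normed_tail
begin

text \<open>Each of the n(t) steps is centred separately: its transform times exp(z \<mu> / b t)
  equals 1 + h t with n(t) h t convergent, whereas \<Phi> - 1 alone is of larger order. What is left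
  of the centring, (t - n(t) \<mu>)/b t + x, tends to 0.\<close>

lemma laplace_power_limit:
  fixes n :: "real \<Rightarrow> nat" and x :: real
  assumes z: "Re z \<ge> 0" "z \<noteq> 0"
    and n: "((\<lambda>t. (t - real (n t) * \<mu>) / b t) \<longlongrightarrow> - x) at_top"
  shows "((\<lambda>t. exp (z * of_real (t / b t + x)) * \<Phi> (z / of_real (b t)) ^ n t)
    \<longlongrightarrow> exp (- (of_real (Gamma (1 - \<alpha>)) * z powr of_real \<alpha>))) at_top"
proof -
  define L where "L = - (of_real (Gamma (1 - \<alpha>)) * z powr of_real \<alpha>)"
  define u where "u t = z * of_real (\<mu> / b t)" for t
  define h where "h t = exp (u t) * \<Phi> (z / of_real (b t)) - 1" for t
  let ?q = "\<lambda>t. of_real (t / \<mu>) * (\<Phi> (z / of_real (b t)) - 1 + z / of_real (b t) * of_real \<mu>)" and ?r = "\<lambda>t. of_real (t / \<mu>) * (1 - u t - exp (- u t))" and ?k = "\<lambda>t. of_real (t / \<mu>) * h t"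
  have b_inf: "filterlim b at_infinity at_top" by (rule filterlim_at_top_imp_at_infinity[OF b_lim])
  have u0: "(u \<longlongrightarrow> 0) at_top"
  proof -
    have "((\<lambda>t. z * of_real (\<mu> / b t)) \<longlongrightarrow> z * of_real 0) at_top"
      by (intro tendsto_intros tendsto_of_real tendsto_divide_0[OF tendsto_const b_inf])
    thus ?thesis by (simp add: u_def[abs_def])
  qed
  have nt: "((\<lambda>t. real (n t) * \<mu> / t) \<longlongrightarrow> 1) at_top"
  proof -
    have "((\<lambda>t. 1 - (t - real (n t) * \<mu>) / b t * (b t / t)) \<longlongrightarrow> 1 - (- x) * 0) at_top"
      by (intro tendsto_intros n b_over_t)
    moreover have "\<forall>\<^sub>F t in at_top. 1 - (t - real (n t) * \<mu>) / b t * (b t / t) = real (n t) * \<mu> / t"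
      using eventually_b_pos eventually_gt_at_top[of 0] by eventually_elim (simp add: field_simps)
    ultimately show ?thesis by (auto intro: Lim_transform_eventually)
  qed
  have rest: "((\<lambda>t. ?r t) \<longlongrightarrow> 0) at_top"
  proof (rule Lim_null_comparison)
    show "((\<lambda>t. ((norm z)\<^sup>2 * \<mu>) * (t / (b t)\<^sup>2)) \<longlongrightarrow> 0) at_top"
      using tendsto_mult[OF tendsto_const t_over_b_squared] by simp
    show "\<forall>\<^sub>F t in at_top. norm (?r t) \<le> ((norm z)\<^sup>2 * \<mu>) * (t / (b t)\<^sup>2)"
      using eventually_b_pos eventually_gt_at_top[of 0]
    proof eventually_elim
      case (elim t)
      have "Re (u t) \<ge> 0" using z elim mu_pos by (simp add: u_def)
      from norm_exp_minus_linear_le[OF this] have "norm (1 - u t - exp (- u t)) \<le> (norm (u t))\<^sup>2"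
        by (metis add.commute diff_diff_eq2 minus_diff_eq norm_minus_cancel diff_add_eq)
      hence "norm (?r t) \<le> (t / \<mu>) * (norm (u t))\<^sup>2"
        using elim mu_pos by (simp add: norm_mult norm_divide mult_left_mono divide_right_mono)
      also have "\<dots> = ((norm z)\<^sup>2 * \<mu>) * (t / (b t)\<^sup>2)"
        using elim mu_pos by (simp add: u_def norm_mult norm_divide power_mult_distrib power_divide) (simp add: power2_eq_square)
      finally show ?case .
    qed
  qed
  have "((\<lambda>t. exp (u t) * (?q t + ?r t)) \<longlongrightarrow> exp 0 * (L + 0)) at_top"
    unfolding L_def by (intro tendsto_intros u0 laplace_limit z rest)
  \<comment> \<open>Up to the factor t/\<mu>, \<open>?q\<close> is \<Phi> - 1 + u and
    \<open>?r\<close> is 1 - u - exp(-u); they add up to \<Phi> - exp(-u), which times exp(u) is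
    h.\<close>
  also have "(\<lambda>t. exp (u t) * (?q t + ?r t)) = ?k"
  proof
    fix t
    have "z / of_real (b t) * of_real \<mu> = u t" by (simp add: u_def)
    thus "exp (u t) * (?q t + ?r t) = of_real (t / \<mu>) * h t"
      by (simp add: h_def algebra_simps exp_minus_inverse del: of_real_divide)
  qed
  finally have th: "(?k \<longlongrightarrow> L) at_top" by simp
  have "((\<lambda>t. of_real (\<mu> / t) * ?k t) \<longlongrightarrow> of_real 0 * L) at_top"
    by (intro tendsto_mult th tendsto_of_real real_tendsto_divide_at_top[OF tendsto_const] filterlim_ident)
  hence "((\<lambda>t. of_real (\<mu> / t) * ?k t) \<longlongrightarrow> 0) at_top" by simp
  moreover have "\<forall>\<^sub>F t in at_top. of_real (\<mu> / t) * ?k t = h t"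
    using eventually_gt_at_top[of 0] by eventually_elim (use mu_pos in simp)
  ultimately have h0: "(h \<longlongrightarrow> 0) at_top" by (blast intro: Lim_transform_eventually)
  have "((\<lambda>t. of_real (real (n t) * \<mu> / t) * ?k t) \<longlongrightarrow> of_real 1 * L) at_top"
    by (intro tendsto_mult th tendsto_of_real nt)
  hence "((\<lambda>t. of_real (real (n t) * \<mu> / t) * ?k t) \<longlongrightarrow> L) at_top" by simp
  moreover have "\<forall>\<^sub>F t in at_top. of_real (real (n t) * \<mu> / t) * ?k t = of_nat (n t) * h t"
    using eventually_gt_at_top[of 0] by eventually_elim (use mu_pos in simp)
  ultimately have nh: "((\<lambda>t. of_nat (n t) * h t) \<longlongrightarrow> L) at_top" by (blast intro: Lim_transform_eventually)
  have "((\<lambda>t. exp (z * of_real ((t - real (n t) * \<mu>) / b t + x)) * (1 + h t) ^ n t) \<longlongrightarrow> exp (z * of_real (- x + x)) * exp L) at_top"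
    by (intro tendsto_intros n tendsto_one_plus_power_exp h0 nh)
  moreover have "exp (z * of_real ((t - real (n t) * \<mu>) / b t + x)) * (1 + h t) ^ n t = exp (z * of_real (t / b t + x)) * \<Phi> (z / of_real (b t)) ^ n t" for t
  proof -
    have "(1 + h t) ^ n t = exp (of_nat (n t) * u t) * \<Phi> (z / of_real (b t)) ^ n t"
      by (simp add: h_def power_mult_distrib exp_of_nat_mult)
    moreover have "z * of_real ((t - real (n t) * \<mu>) / b t + x) + of_nat (n t) * u t = z * of_real (t / b t + x)"
      by (simp add: u_def algebra_simps diff_divide_distrib)
    ultimately show ?thesis by (metis exp_add mult.assoc)
  qed
  ultimately show ?thesis by (simp add: L_def)
qed

text \<open>Steps above y are clipped to y instead of being discarded, so that the layer-cake
  formula has no boundary term.\<close>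

definition V :: "real \<Rightarrow> real" where "V y = (\<integral>v. (max 0 (min v y))\<^sup>2 \<partial>D)"

lemma V_nonneg: "V y \<ge> 0" unfolding V_def by (intro integral_nonneg_AE) auto

text \<open>Layer cake with density 2 w on [0, y], then w = y u, which brings in T (y * u) and
  thereby the Potter bounds.\<close>

lemma V_eq_nn_integral:
  assumes y: "y > 0"
  shows "ennreal (V y) = (\<integral>\<^sup>+u. ennreal (y\<^sup>2 * (2 * u * T (y * u))) * indicator {0<..1} u \<partial>lborel)"
proof -
  have "ennreal (V y) = (\<integral>\<^sup>+v. ennreal ((max 0 (min v y))\<^sup>2) \<partial>D)"
    unfolding V_def using y
    by (intro nn_integral_eq_integral[symmetric] integrable_const_bound[of _ "y\<^sup>2"] AE_I2)
       (auto simp: max_def min_def intro!: power_mono)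
  also have "\<dots> = (\<integral>\<^sup>+v. (\<integral>\<^sup>+w. (ennreal (2 * w) * indicator {0..y} w) * indicator {0<..<v} w \<partial>lborel) \<partial>D)"
  proof (intro nn_integral_cong)
    fix v :: real
    show "ennreal ((max 0 (min v y))\<^sup>2) = (\<integral>\<^sup>+w. (ennreal (2 * w) * indicator {0..y} w) * indicator {0<..<v} w \<partial>lborel)"
    proof (cases "v > 0")
      case True
      have "(\<integral>\<^sup>+w. (ennreal (2 * w) * indicator {0..y} w) * indicator {0<..<v} w \<partial>lborel) = (\<integral>\<^sup>+w. ennreal (2 * w) * indicator {0..min v y} w \<partial>lborel)"
        by (intro nn_integral_cong_AE AE_mp[OF AE_lborel_singleton[of 0] AE_mp[OF AE_lborel_singleton[of v] AE_I2]]) (auto simp: indicator_def)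
      also have "\<dots> = ennreal ((min v y)\<^sup>2 - 0\<^sup>2)"
        using True y by (intro nn_integral_FTC_Icc) (auto intro!: derivative_eq_intros)
      finally show ?thesis using True y by simp
    next
      case False
      thus ?thesis by simp
    qed
  qed
  also have "\<dots> = (\<integral>\<^sup>+w. (ennreal (2 * w) * indicator {0..y} w) * ennreal (T w) * indicator {0<..} w \<partial>lborel)"
    unfolding T_def by (rule nn_integral_layer_cake) simp
  also have "\<dots> = ennreal \<bar>y\<bar> * (\<integral>\<^sup>+u. (ennreal (2 * (0 + y * u)) * indicator {0..y} (0 + y * u)) * ennreal (T (0 + y * u)) * indicator {0<..} (0 + y * u) \<partial>lborel)"
    by (rule nn_integral_real_affine) (use y in auto)
  also have "\<dots> = (\<integral>\<^sup>+u. ennreal \<bar>y\<bar> * ((ennreal (2 * (0 + y * u)) * indicator {0..y} (0 + y * u)) * ennreal (T (0 + y * u)) * indicator {0<..} (0 + y * u)) \<partial>lborel)"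
    by (rule nn_integral_cmult[symmetric]) simp
  also have "\<dots> = (\<integral>\<^sup>+u. ennreal (y\<^sup>2 * (2 * u * T (y * u))) * indicator {0<..1} u \<partial>lborel)"
    using y T_pos by (intro nn_integral_cong)
      (auto simp: indicator_def zero_less_mult_iff less_imp_le ennreal_mult'[symmetric] power2_eq_square mult_ac)
  finally show ?thesis .
qed

text \<open>For x \<ge> 1 and 0 < u \<le> 1 both branches of the Potter bound at x u are at most x
  powr (-(\<alpha>-\<delta>)) * u powr (-(\<alpha>+\<delta>)). The integral over u in
  \<open>V_eq_nn_integral\<close> then converges because \<alpha> + \<delta> < 2, which is where
  2/(2 - (\<alpha>+\<delta>)) comes from.\<close>

lemma truncation_bound:
  assumes \<delta>: "0 < \<delta>" "\<delta> < 2 - \<alpha>"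
  shows "\<exists>C>0. \<forall>\<^sub>F t in at_top. \<forall>x\<ge>1. t / \<mu> * (T (b t * x) + V (b t * x) / (b t * x)\<^sup>2) \<le> C * x powr (- (\<alpha> - \<delta>))"
proof -
  have \<delta>': "\<delta> < \<alpha>" using \<delta> alpha by simp
  obtain C where C: "C > 0" "\<forall>\<^sub>F t in at_top. \<forall>y>0. t / \<mu> * T (b t * y) \<le>
    C * (if y \<le> 1 then y powr (- (\<alpha> + \<delta>)) else y powr (- (\<alpha> - \<delta>)))"
    using scaled_tail_bound[OF \<delta>(1) \<delta>'] by blast
  have "\<forall>\<^sub>F t in at_top. \<forall>x\<ge>1. t / \<mu> * (T (b t * x) + V (b t * x) / (b t * x)\<^sup>2) \<le> (C + C * 2 / (2 - (\<alpha> + \<delta>))) * x powr (- (\<alpha> - \<delta>))"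
    using C(2) eventually_b_pos eventually_gt_at_top[of 0]
  proof eventually_elim
    case (elim t)
    show ?case
    proof (intro allI impI)
      fix x :: real assume x: "x \<ge> 1"
      have tail: "t / \<mu> * T (b t * x * u) \<le> C * x powr (- (\<alpha> - \<delta>)) * u powr (- (\<alpha> + \<delta>))" if u: "0 < u" "u \<le> 1" for u
      proof -
        have "t / \<mu> * T (b t * (x * u)) \<le> C * (if x * u \<le> 1 then (x * u) powr (- (\<alpha> + \<delta>)) else (x * u) powr (- (\<alpha> - \<delta>)))"
          using elim(1) x u by auto
        also have "\<dots> \<le> C * (x powr (- (\<alpha> - \<delta>)) * u powr (- (\<alpha> + \<delta>)))"
        proof (intro mult_left_mono)
          have "(x * u) powr (- (\<alpha> + \<delta>)) \<le> x powr (- (\<alpha> - \<delta>)) * u powr (- (\<alpha> + \<delta>))"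
            using x u \<delta> by (auto simp: powr_mult intro!: mult_right_mono powr_mono)
          moreover have "(x * u) powr (- (\<alpha> - \<delta>)) \<le> x powr (- (\<alpha> - \<delta>)) * u powr (- (\<alpha> + \<delta>))"
            using x u \<delta> by (auto simp: powr_mult intro!: mult_left_mono powr_mono')
          ultimately show "(if x * u \<le> 1 then (x * u) powr (- (\<alpha> + \<delta>)) else (x * u) powr (- (\<alpha> - \<delta>))) \<le> x powr (- (\<alpha> - \<delta>)) * u powr (- (\<alpha> + \<delta>))"
            by simp
        qed (use C in simp)
        finally show ?thesis by (simp add: mult.assoc)
      qed
      have y: "b t * x > 0" using elim x by simp
      have "ennreal (t / \<mu> / (b t * x)\<^sup>2 * V (b t * x)) = ennreal (t / \<mu> / (b t * x)\<^sup>2) * ennreal (V (b t * x))"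
        using elim mu_pos by (intro ennreal_mult') simp
      also have "\<dots> = (\<integral>\<^sup>+u. ennreal (t / \<mu> / (b t * x)\<^sup>2) * (ennreal ((b t * x)\<^sup>2 * (2 * u * T (b t * x * u))) * indicator {0<..1} u) \<partial>lborel)"
        unfolding V_eq_nn_integral[OF y] by (subst nn_integral_cmult) auto
      also have "\<dots> \<le> (\<integral>\<^sup>+u. ennreal (C * 2 * x powr (- (\<alpha> - \<delta>))) * ennreal (indicator {0..1} u * u powr (1 - (\<alpha> + \<delta>))) \<partial>lborel)"
      proof (intro nn_integral_mono)
        fix u :: real
        show "ennreal (t / \<mu> / (b t * x)\<^sup>2) * (ennreal ((b t * x)\<^sup>2 * (2 * u * T (b t * x * u))) * indicator {0<..1} u)
          \<le> ennreal (C * 2 * x powr (- (\<alpha> - \<delta>))) * ennreal (indicator {0..1} u * u powr (1 - (\<alpha> + \<delta>)))"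
        proof (cases "0 < u \<and> u \<le> 1")
          case True
          have "t / \<mu> / (b t * x)\<^sup>2 * ((b t * x)\<^sup>2 * (2 * u * T (b t * x * u))) = 2 * u * (t / \<mu> * T (b t * x * u))"
            using elim x by simp
          also have "\<dots> \<le> 2 * u * (C * x powr (- (\<alpha> - \<delta>)) * u powr (- (\<alpha> + \<delta>)))"
            using True by (intro mult_left_mono tail) auto
          also have "\<dots> = C * 2 * x powr (- (\<alpha> - \<delta>)) * (u powr 1 * u powr (- (\<alpha> + \<delta>)))"
            using True by simp
          also have "u powr 1 * u powr (- (\<alpha> + \<delta>)) = u powr (1 - (\<alpha> + \<delta>))"
            unfolding powr_add[symmetric] by (simp add: algebra_simps)
          finally have le: "t / \<mu> / (b t * x)\<^sup>2 * ((b t * x)\<^sup>2 * (2 * u * T (b t * x * u))) \<le> C * 2 * x powr (- (\<alpha> - \<delta>)) * u powr (1 - (\<alpha> + \<delta>))" .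
          have "ennreal (t / \<mu> / (b t * x)\<^sup>2) * ennreal ((b t * x)\<^sup>2 * (2 * u * T (b t * x * u))) = ennreal (t / \<mu> / (b t * x)\<^sup>2 * ((b t * x)\<^sup>2 * (2 * u * T (b t * x * u))))"
            using elim mu_pos by (intro ennreal_mult'[symmetric]) simp
          also have "\<dots> \<le> ennreal (C * 2 * x powr (- (\<alpha> - \<delta>)) * u powr (1 - (\<alpha> + \<delta>)))"
            by (rule ennreal_leI[OF le])
          also have "\<dots> = ennreal (C * 2 * x powr (- (\<alpha> - \<delta>))) * ennreal (u powr (1 - (\<alpha> + \<delta>)))"
            using C by (intro ennreal_mult') simp
          finally show ?thesis using True by simp
        qed auto
      qed
      also have "\<dots> = ennreal (C * 2 * x powr (- (\<alpha> - \<delta>))) * ennreal (1 powr (1 - (\<alpha> + \<delta>) + 1) / (1 - (\<alpha> + \<delta>) + 1))"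
        using has_bochner_integral_powr_from_0[of "1 - (\<alpha> + \<delta>)" 1] \<delta>
        by (subst nn_integral_cmult) (auto simp: has_bochner_integral_iff nn_integral_eq_integral)
      also have "\<dots> = ennreal (C * 2 * x powr (- (\<alpha> - \<delta>)) * (1 / (2 - (\<alpha> + \<delta>))))"
        using C \<delta> by (subst ennreal_mult'[symmetric]) (auto simp: algebra_simps)
      finally have "t / \<mu> / (b t * x)\<^sup>2 * V (b t * x) \<le> C * 2 * x powr (- (\<alpha> - \<delta>)) * (1 / (2 - (\<alpha> + \<delta>)))"
        using C \<delta> by (subst (asm) ennreal_le_iff) auto
      moreover have "t / \<mu> * T (b t * x) \<le> C * x powr (- (\<alpha> - \<delta>))" using tail[of 1] by simp
      ultimately show "t / \<mu> * (T (b t * x) + V (b t * x) / (b t * x)\<^sup>2) \<le> (C + C * 2 / (2 - (\<alpha> + \<delta>))) * x powr (- (\<alpha> - \<delta>))"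
        by (simp add: distrib_left distrib_right mult_ac)
    qed
  qed
  moreover have "C + C * 2 / (2 - (\<alpha> + \<delta>)) > 0" using C \<delta> by (intro add_pos_pos) auto
  ultimately show ?thesis by blast
qed

end

section \<open>The random walk and its first passage times\<close>

context regularly_varying_tail
begin

definition \<phi> :: "real \<Rightarrow> real" where "\<phi> s = (\<integral>x. exp (- (s * x)) \<partial>D)"

lemma Phi_of_real: "\<Phi> (of_real s) = of_real (\<phi> s)"
proof -
  have "\<Phi> (of_real s) = (\<integral>x. of_real (exp (- (s * x))) \<partial>D)"
    unfolding \<Phi>_def by (simp add: exp_of_real[symmetric])
  thus ?thesis unfolding \<phi>_def integral_complex_of_real .
qed

lemma integrable_exp_real: "s \<ge> 0 \<Longrightarrow> integrable D (\<lambda>x. exp (- (s * x)))"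
  using pos by (intro integrable_const_bound[of _ 1]) (auto elim!: eventually_mono)

lemma phi_bounds: assumes "s \<ge> 0" shows "0 \<le> \<phi> s" "\<phi> s \<le> 1"
proof -
  show "0 \<le> \<phi> s" unfolding \<phi>_def by (intro integral_nonneg_AE) auto
  have "\<phi> s \<le> (\<integral>x. 1 \<partial>D)" unfolding \<phi>_def
    using pos assms by (intro integral_mono_AE integrable_exp_real) (auto elim!: eventually_mono)
  thus "\<phi> s \<le> 1" by (simp add: prob_space[simplified])
qed

lemma phi_less_1: assumes s: "s > 0" shows "\<phi> s < 1"
proof (rule ccontr)
  assume "\<not> \<phi> s < 1"
  hence "\<phi> s = 1" using phi_bounds[of s] s by simp
  hence "(\<integral>x. 1 - exp (- (s * x)) \<partial>D) = 0"
    using integrable_exp_real[of s] s by (simp add: \<phi>_def prob_space[simplified])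
  moreover have "AE x in D. 0 \<le> 1 - exp (- (s * x))" using pos by eventually_elim (use s in simp)
  moreover have "integrable D (\<lambda>x. 1 - exp (- (s * x)))" using integrable_exp_real[of s] s by simp
  ultimately have "AE x in D. 1 - exp (- (s * x)) = 0" using integral_nonneg_eq_0_iff_AE by blast
  with pos have "AE x in D. False" by eventually_elim (use s in simp)
  thus False by (simp add: AE_False emeasure_space_1[simplified])
qed

end

text \<open>The cross terms vanish: by independence the expectation of Z i times the partial sum
  factorises, and Z i is centred. Boundedness supplies all the integrability.\<close>

lemma (in prob_space) indep_sum_second_moment:
  fixes Z :: "'i \<Rightarrow> 'a \<Rightarrow> real"
  assumes "finite I" "indep_vars (\<lambda>_. borel) Z I"
    and "\<And>i \<omega>. i \<in> I \<Longrightarrow> \<bar>Z i \<omega>\<bar> \<le> B" and "\<And>i. i \<in> I \<Longrightarrow> expectation (Z i) = 0"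
  shows "expectation (\<lambda>\<omega>. (\<Sum>i\<in>I. Z i \<omega>)\<^sup>2) = (\<Sum>i\<in>I. expectation (\<lambda>\<omega>. (Z i \<omega>)\<^sup>2))"
  using assms
proof (induction I rule: finite_induct)
  case (insert i I)
  have meas: "random_variable borel (Z j)" if "j \<in> insert i I" for j
    using insert.prems(1) that by (auto simp: indep_vars_def2)
  have Zint: "integrable M (Z j)" if "j \<in> insert i I" for j
    using meas[OF that] insert.prems(2)[OF that] by (intro integrable_const_bound[of _ B]) auto
  define S where "S \<omega> = (\<Sum>j\<in>I. Z j \<omega>)" for \<omega>
  have Sm[measurable]: "random_variable borel S" unfolding S_def using meas by (intro borel_measurable_sum) auto
  have [measurable]: "random_variable borel (Z i)" using meas by simp
  have Sb: "\<bar>S \<omega>\<bar> \<le> real (card I) * B" for \<omega>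
  proof -
    have "\<bar>S \<omega>\<bar> \<le> (\<Sum>j\<in>I. \<bar>Z j \<omega>\<bar>)" unfolding S_def by (rule sum_abs)
    also have "\<dots> \<le> (\<Sum>j\<in>I. B)" using insert.prems(2) by (intro sum_mono) auto
    finally show ?thesis by simp
  qed
  \<comment> \<open>The bound on |Z i| is assumed at every argument, so any point will do.\<close>
  have B0: "B \<ge> 0" using insert.prems(2)[of i undefined] by simp
  have Sint: "integrable M S" by (rule integrable_const_bound[of _ "real (card I) * B"]) (use Sb in auto)
  have ind: "indep_var borel (Z i) borel S" unfolding S_def
    by (rule indep_vars_sum) (use insert in auto)
  have prod: "expectation (\<lambda>\<omega>. Z i \<omega> * S \<omega>) = 0" "integrable M (\<lambda>\<omega>. Z i \<omega> * S \<omega>)"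
    using indep_var_lebesgue_integral[OF ind] indep_var_integrable[OF ind] Zint Sint insert.prems(3)[of i] by simp_all
  have sq: "integrable M (\<lambda>\<omega>. (Z i \<omega>)\<^sup>2)"
  proof (rule integrable_const_bound[of _ "B\<^sup>2"])
    show "AE \<omega> in M. norm ((Z i \<omega>)\<^sup>2) \<le> B\<^sup>2"
      using insert.prems(2)[of i] B0 by (intro AE_I2) (auto simp: abs_le_square_iff[symmetric])
  qed simp
  have sqS: "integrable M (\<lambda>\<omega>. (S \<omega>)\<^sup>2)"
  proof (rule integrable_const_bound[of _ "(real (card I) * B)\<^sup>2"])
    show "AE \<omega> in M. norm ((S \<omega>)\<^sup>2) \<le> (real (card I) * B)\<^sup>2"
      using Sb B0 by (intro AE_I2) (auto simp: abs_le_square_iff[symmetric])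
  qed simp
  have "expectation (\<lambda>\<omega>. (\<Sum>j\<in>insert i I. Z j \<omega>)\<^sup>2) = expectation (\<lambda>\<omega>. (Z i \<omega>)\<^sup>2 + (2 * (Z i \<omega> * S \<omega>) + (S \<omega>)\<^sup>2))"
    using insert.hyps by (simp add: S_def power2_sum algebra_simps)
  also have "\<dots> = expectation (\<lambda>\<omega>. (Z i \<omega>)\<^sup>2) + (2 * expectation (\<lambda>\<omega>. Z i \<omega> * S \<omega>) + expectation (\<lambda>\<omega>. (S \<omega>)\<^sup>2))"
    using sq sqS prod(2) by simp
  also have "expectation (\<lambda>\<omega>. (S \<omega>)\<^sup>2) = (\<Sum>j\<in>I. expectation (\<lambda>\<omega>. (Z j \<omega>)\<^sup>2))"
    unfolding S_def by (rule insert.IH) (use insert.prems in \<open>auto intro: indep_vars_subset\<close>)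
  finally show ?case using insert.hyps prod(1) by simp
qed simp

locale renewal = normed_tail D \<alpha> b + M: prob_space M
  for D \<alpha> b and M :: "'b measure" +
  fixes X :: "nat \<Rightarrow> 'b \<Rightarrow> real"
  assumes indep: "M.indep_vars (\<lambda>_. borel) X {1..}"
    and law: "k \<ge> 1 \<Longrightarrow> distr M borel (X k) = D"
begin

lemma X_measurable [measurable]: "k \<ge> 1 \<Longrightarrow> X k \<in> borel_measurable M"
  using indep by (auto simp: M.indep_vars_def2)

lemma walk_measurable [measurable]: "walk X n \<in> borel_measurable M"
  unfolding walk_def by (intro borel_measurable_sum) auto

lemma integral_X:
  fixes f :: "real \<Rightarrow> 'c :: {banach, second_countable_topology}"
  assumes "k \<ge> 1" "f \<in> borel_measurable borel"
  shows "(\<integral>\<omega>. f (X k \<omega>) \<partial>M) = (\<integral>x. f x \<partial>D)"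
  using integral_distr[OF X_measurable[OF assms(1)] assms(2)] law[OF assms(1)] by simp

lemma integrable_X:
  fixes f :: "real \<Rightarrow> 'c :: {banach, second_countable_topology}"
  assumes "k \<ge> 1" "f \<in> borel_measurable borel"
  shows "integrable M (\<lambda>\<omega>. f (X k \<omega>)) \<longleftrightarrow> integrable D f"
  using integrable_distr_eq[OF X_measurable[OF assms(1)] assms(2)] law[OF assms(1)] by simp

lemma AE_X_pos: "AE \<omega> in M. \<forall>k\<ge>1. X k \<omega> > 0"
proof -
  have "AE \<omega> in M. k \<ge> 1 \<longrightarrow> X k \<omega> > 0" for k
  proof (cases "k \<ge> 1")
    case True
    have "AE x in distr M borel (X k). 0 < x" unfolding law[OF True] by (rule pos)
    thus ?thesis using X_measurable[OF True] by (subst (asm) AE_distr_iff) auto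
  qed auto
  thus ?thesis by (simp add: AE_all_countable)
qed

lemma integral_exp_walk:
  assumes z: "Re z \<ge> 0"
  shows "(\<integral>\<omega>. exp (- (z * of_real (walk X n \<omega>))) \<partial>M) = \<Phi> z ^ n"
    and "integrable M (\<lambda>\<omega>. exp (- (z * of_real (walk X n \<omega>))))"
proof -
  have e: "exp (- (z * of_real (walk X n \<omega>))) = (\<Prod>i\<in>{1..n}. exp (- (z * of_real (X i \<omega>))))" for \<omega>
    by (simp add: walk_def sum_distrib_left sum_negf[symmetric] exp_sum)
  have ind: "M.indep_vars (\<lambda>_. borel) (\<lambda>i \<omega>. exp (- (z * of_real (X i \<omega>)))) {1..n}"
    by (rule M.indep_vars_compose2[OF M.indep_vars_subset[OF indep]]) auto
  have int: "integrable M (\<lambda>\<omega>. exp (- (z * of_real (X i \<omega>))))" if "i \<in> {1..n}" for i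
    using that integrable_exp[OF z] by (subst integrable_X) auto
  have i1: "(\<integral>\<omega>. exp (- (z * of_real (X i \<omega>))) \<partial>M) = \<Phi> z" if "i \<in> {1..n}" for i
    using that integral_X[of i "\<lambda>x. exp (- (z * of_real x))"] by (simp add: \<Phi>_def)
  show "(\<integral>\<omega>. exp (- (z * of_real (walk X n \<omega>))) \<partial>M) = \<Phi> z ^ n"
    unfolding e using M.indep_vars_lebesgue_integral[OF _ ind int] i1 by simp
  show "integrable M (\<lambda>\<omega>. exp (- (z * of_real (walk X n \<omega>))))"
    unfolding e using M.indep_vars_integrable[OF _ ind int] by simp
qed

lemma integral_exp_walk_real:
  assumes s: "s \<ge> 0"
  shows "(\<integral>\<omega>. exp (- (s * walk X n \<omega>)) \<partial>M) = \<phi> s ^ n"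
    and "integrable M (\<lambda>\<omega>. exp (- (s * walk X n \<omega>)))"
proof -
  have e: "exp (- (of_real s * of_real (walk X n \<omega>))) = complex_of_real (exp (- (s * walk X n \<omega>)))" for \<omega>
    by (simp add: exp_of_real[symmetric])
  have "of_real (\<integral>\<omega>. exp (- (s * walk X n \<omega>)) \<partial>M) = complex_of_real (\<phi> s ^ n)"
    using integral_exp_walk(1)[of "of_real s" n] s unfolding e integral_complex_of_real Phi_of_real by simp
  thus "(\<integral>\<omega>. exp (- (s * walk X n \<omega>)) \<partial>M) = \<phi> s ^ n" by (simp only: of_real_eq_iff)
  show "integrable M (\<lambda>\<omega>. exp (- (s * walk X n \<omega>)))"
    using integral_exp_walk(2)[of "of_real s" n] s unfolding e complex_of_real_integrable_eq by simp
qed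

text \<open>Chernoff bound on the lower side, where positivity of the steps makes the transform
  finite for every s \<ge> 0.\<close>

lemma prob_walk_le:
  assumes s: "s \<ge> 0"
  shows "measure M {\<omega> \<in> space M. walk X n \<omega> \<le> t} \<le> exp (s * t) * \<phi> s ^ n"
proof -
  have "measure M {\<omega> \<in> space M. walk X n \<omega> \<le> t} \<le> measure M {\<omega> \<in> space M. exp (- (s * walk X n \<omega>)) \<ge> exp (- (s * t))}"
    using s by (intro M.finite_measure_mono) (auto intro: mult_left_mono)
  also have "\<dots> \<le> (\<integral>\<omega>. exp (- (s * walk X n \<omega>)) \<partial>M) / exp (- (s * t))"
    by (rule integral_Markov_inequality_measure[where A = "space M"]) (use integral_exp_walk_real[OF s] in auto)
  also have "\<dots> = exp (s * t) * \<phi> s ^ n"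
    using integral_exp_walk_real[OF s] by (simp add: exp_minus field_simps)
  finally show ?thesis .
qed

text \<open>The Chernoff bound at s = 1 decays geometrically in n since \<phi> 1 < 1. Thus the event
  on which \<open>first_passage\<close> takes an arbitrary value is null.\<close>

lemma AE_walk_exceeds: "AE \<omega> in M. \<exists>k. walk X k \<omega> > t"
proof -
  have [measurable]: "{\<omega> \<in> space M. \<forall>k. walk X k \<omega> \<le> t} \<in> sets M" by measurable
  have "measure M {\<omega> \<in> space M. \<forall>k. walk X k \<omega> \<le> t} \<le> exp (1 * t) * \<phi> 1 ^ n" for n
    by (rule order_trans[OF M.finite_measure_mono prob_walk_le]) auto
  moreover have "(\<lambda>n. exp (1 * t) * \<phi> 1 ^ n) \<longlonglongrightarrow> exp (1 * t) * 0"
    using phi_bounds[of 1] phi_less_1[of 1] by (intro tendsto_intros LIMSEQ_power_zero) auto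
  ultimately have "measure M {\<omega> \<in> space M. \<forall>k. walk X k \<omega> \<le> t} \<le> 0"
    by (intro tendsto_lowerbound[where F = sequentially and f = "\<lambda>n. exp (1 * t) * \<phi> 1 ^ n"]) auto
  hence "emeasure M {\<omega> \<in> space M. \<forall>k. walk X k \<omega> \<le> t} = 0"
    by (simp add: M.emeasure_eq_measure measure_le_0_iff)
  thus ?thesis by (subst AE_iff_measurable[OF _ refl]) (auto simp: not_less)
qed

text \<open>With positive steps the walk increases, so once above t it stays there. The case n = 0
  is included: the empty sum 0 is at most t and the passage index is at least 1.\<close>

lemma first_passage_gt_iff:
  assumes t: "t \<ge> 0" and p: "\<forall>k\<ge>1. X k \<omega> > 0" and ex: "\<exists>k. walk X k \<omega> > t"
  shows "first_passage X t \<omega> > n \<longleftrightarrow> walk X n \<omega> \<le> t" and "first_passage X t \<omega> \<ge> 1"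
proof -
  define A where "A = {k. k \<ge> 1 \<and> walk X k \<omega> > t}"
  have mono: "walk X j \<omega> \<le> walk X k \<omega>" if "j \<le> k" for j k
    unfolding walk_def using that p by (intro sum_mono2) (auto intro: less_imp_le)
  have w0: "walk X 0 \<omega> = 0" by (simp add: walk_def)
  obtain k where "walk X k \<omega> > t" using ex by blast
  hence "k \<in> A" using w0 t by (cases k) (auto simp: A_def)
  hence fA: "first_passage X t \<omega> \<in> A" unfolding first_passage_def A_def[symmetric] by (intro Inf_nat_def1) auto
  thus "first_passage X t \<omega> \<ge> 1" by (simp add: A_def)
  show "first_passage X t \<omega> > n \<longleftrightarrow> walk X n \<omega> \<le> t"
  proof
    assume "first_passage X t \<omega> > n"
    hence "n \<notin> A" unfolding first_passage_def A_def[symmetric] by (meson cInf_lower bdd_below_bot not_less)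
    thus "walk X n \<omega> \<le> t" using w0 t by (cases n) (auto simp: A_def)
  next
    assume "walk X n \<omega> \<le> t"
    thus "first_passage X t \<omega> > n" using fA mono[of "first_passage X t \<omega>" n] by (force simp: A_def not_le[symmetric])
  qed
qed

lemma first_passage_measurable [measurable]: "first_passage X t \<in> measurable M (count_space UNIV)"
  unfolding first_passage_def Inf_nat_def by measurable

section \<open>Weak limit and exponential moments of the normalised passage time\<close>

definition Y :: "real \<Rightarrow> 'b \<Rightarrow> real" where
  "Y t \<omega> = (real (first_passage X t \<omega>) - t / \<mu>) / (b t / \<mu>)"

lemma Y_measurable [measurable]: "Y t \<in> borel_measurable M"
  unfolding Y_def by measurable

text \<open>The shift \<open>x\<close> compensates the asymptotic drift -x of the centring, so the
  limit is the same for every x. Taking z = i s gives characteristic functions, z = \<theta> > 0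
  exponential moments.\<close>

lemma walk_laplace_limit:
  fixes n :: "real \<Rightarrow> nat" and x :: real
  assumes z: "Re z \<ge> 0" "z \<noteq> 0"
    and n: "((\<lambda>t. (t - real (n t) * \<mu>) / b t) \<longlongrightarrow> - x) at_top"
  shows "((\<lambda>t. \<integral>\<omega>. exp (z * of_real ((t - walk X (n t) \<omega>) / b t + x)) \<partial>M)
    \<longlongrightarrow> exp (- (of_real (Gamma (1 - \<alpha>)) * z powr of_real \<alpha>))) at_top"
proof (rule Lim_transform_eventually[OF laplace_power_limit[OF z n]])
  show "\<forall>\<^sub>F t in at_top. exp (z * of_real (t / b t + x)) * \<Phi> (z / of_real (b t)) ^ n t = (\<integral>\<omega>. exp (z * of_real ((t - walk X (n t) \<omega>) / b t + x)) \<partial>M)"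
    using eventually_b_pos
  proof eventually_elim
    case (elim t)
    have Re: "Re (z / of_real (b t)) \<ge> 0" using z elim by (simp add: Re_divide_of_real)
    have "exp (z * of_real ((t - walk X (n t) \<omega>) / b t + x)) = exp (z * of_real (t / b t + x)) * exp (- (z / of_real (b t) * of_real (walk X (n t) \<omega>)))" for \<omega>
      by (simp add: algebra_simps diff_divide_distrib flip: exp_add)
    thus ?case by (simp only: integral_mult_right_zero integral_exp_walk(1)[OF Re])
  qed
qed

lemma walk_char_limit:
  fixes n :: "real \<Rightarrow> nat" and x :: real
  assumes n: "((\<lambda>t. (t - real (n t) * \<mu>) / b t) \<longlongrightarrow> - x) at_top"
  shows "((\<lambda>t. char (distr M borel (\<lambda>\<omega>. (t - walk X (n t) \<omega>) / b t + x)) s) \<longlongrightarrow> stable_cf \<alpha> s) at_top"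
proof -
  have c: "char (distr M borel (\<lambda>\<omega>. (t - walk X (n t) \<omega>) / b t + x)) s = (\<integral>\<omega>. exp (\<i> * of_real s * of_real ((t - walk X (n t) \<omega>) / b t + x)) \<partial>M)" for t
    unfolding char_def by (subst integral_distr) (auto simp: mult_ac)
  show ?thesis
  proof (cases "s = 0")
    case True
    show ?thesis unfolding c by (simp add: True stable_cf_def M.prob_space)
  next
    case False
    from walk_laplace_limit[OF _ _ n, of "\<i> * of_real s"] False
    show ?thesis unfolding c stable_cf_eq_powr[OF False] by simp
  qed
qed

lemma walk_weak_limit:
  fixes n :: "real \<Rightarrow> nat" and x :: real and \<tau> :: "nat \<Rightarrow> real"
  assumes n: "((\<lambda>t. (t - real (n t) * \<mu>) / b t) \<longlongrightarrow> - x) at_top"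
    and \<tau>: "filterlim \<tau> at_top sequentially"
    and N': "real_distribution N'" and cf: "\<And>s. char N' s = stable_cf \<alpha> s"
  shows "weak_conv_m (\<lambda>k. distr M borel (\<lambda>\<omega>. (\<tau> k - walk X (n (\<tau> k)) \<omega>) / b (\<tau> k) + x)) N'"
proof (rule levy_continuity[OF _ N'])
  show "real_distribution (distr M borel (\<lambda>\<omega>. (\<tau> k - walk X (n (\<tau> k)) \<omega>) / b (\<tau> k) + x))" for k
    by (rule M.real_distribution_distr) measurable
  show "(\<lambda>k. char (distr M borel (\<lambda>\<omega>. (\<tau> k - walk X (n (\<tau> k)) \<omega>) / b (\<tau> k) + x)) s) \<longlonglongrightarrow> char N' s" for s
    unfolding cf by (rule filterlim_compose[OF walk_char_limit[OF n] \<tau>])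
qed

lemma walk_exp_limit:
  fixes n :: "real \<Rightarrow> nat" and x \<theta> :: real
  assumes \<theta>: "\<theta> > 0" and n: "((\<lambda>t. (t - real (n t) * \<mu>) / b t) \<longlongrightarrow> - x) at_top"
  shows "((\<lambda>t. \<integral>\<omega>. exp (\<theta> * ((t - walk X (n t) \<omega>) / b t + x)) \<partial>M) \<longlongrightarrow> exp (- Gamma (1 - \<alpha>) * \<theta> powr \<alpha>)) at_top"
proof -
  let ?D = "\<lambda>t \<omega>. (t - walk X (n t) \<omega>) / b t + x" and ?l = "exp (- Gamma (1 - \<alpha>) * \<theta> powr \<alpha>)"
  have e: "exp (of_real \<theta> * of_real (?D t \<omega>)) = complex_of_real (exp (\<theta> * (?D t \<omega>)))" for t \<omega>
    by (simp add: exp_of_real[symmetric])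
  have r: "exp (- (of_real (Gamma (1 - \<alpha>)) * of_real \<theta> powr of_real \<alpha>)) = complex_of_real ?l"
    using \<theta> by (simp add: powr_of_real exp_of_real[symmetric])
  have "((\<lambda>t. \<integral>\<omega>. exp (complex_of_real \<theta> * of_real (?D t \<omega>)) \<partial>M)
    \<longlongrightarrow> exp (- (of_real (Gamma (1 - \<alpha>)) * of_real \<theta> powr of_real \<alpha>))) at_top"
    by (rule walk_laplace_limit[OF _ _ n]) (use \<theta> in auto)
  hence "((\<lambda>t. complex_of_real (\<integral>\<omega>. exp (\<theta> * (?D t \<omega>)) \<partial>M)) \<longlongrightarrow> complex_of_real ?l) at_top"
    unfolding e r integral_complex_of_real .
  thus ?thesis by (simp only: tendsto_of_real_iff)
qed

lemma integrable_walk_exp: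
  assumes "\<theta> > 0" "b t > 0"
  shows "integrable M (\<lambda>\<omega>. exp (\<theta> * ((t - walk X n \<omega>) / b t + x)))"
proof -
  have "exp (\<theta> * ((t - walk X n \<omega>) / b t + x)) = exp (\<theta> * (t / b t + x)) * exp (- (\<theta> / b t * walk X n \<omega>))" for \<omega>
    by (simp add: algebra_simps diff_divide_distrib flip: exp_add)
  thus ?thesis using integral_exp_walk_real(2)[of "\<theta> / b t" n] assms by simp
qed

text \<open>This is the index at which the duality is applied for the level x. Rounding to an
  integer moves the centring by at most \<mu>/b t, which vanishes; the level before rounding is
  eventually nonnegative because b t / t tends to 0.\<close>

lemma passage_index_limit:
  "((\<lambda>t. (t - real (nat \<lfloor>t / \<mu> + x * (b t / \<mu>)\<rfloor>) * \<mu>) / b t) \<longlongrightarrow> - x) at_top"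
  and eventually_passage_level_nonneg: "\<forall>\<^sub>F t in at_top. t / \<mu> + x * (b t / \<mu>) \<ge> 0"
proof -
  define r where "r t = t / \<mu> + x * (b t / \<mu>)" for t
  have "((\<lambda>t. 1 + x * (b t / t)) \<longlongrightarrow> 1 + x * 0) at_top" by (intro tendsto_intros b_over_t)
  hence "\<forall>\<^sub>F t in at_top. 1 + x * (b t / t) > 0" by (intro order_tendstoD) auto
  with eventually_gt_at_top[of 0] have ev: "\<forall>\<^sub>F t in at_top. r t \<ge> 0"
  proof eventually_elim
    case (elim t)
    have "r t = t / \<mu> * (1 + x * (b t / t))" using elim by (simp add: r_def distrib_left)
    also have "\<dots> \<ge> 0" using elim mu_pos by (intro mult_nonneg_nonneg) auto
    finally show ?case .
  qed
  thus "\<forall>\<^sub>F t in at_top. t / \<mu> + x * (b t / \<mu>) \<ge> 0" by (simp add: r_def)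
  have "((\<lambda>t. (t - real (nat \<lfloor>r t\<rfloor>) * \<mu>) / b t + x) \<longlongrightarrow> 0) at_top"
  proof (rule Lim_null_comparison)
    show "((\<lambda>t. \<mu> / b t) \<longlongrightarrow> 0) at_top"
      by (rule tendsto_divide_0[OF tendsto_const filterlim_at_top_imp_at_infinity[OF b_lim]])
    show "\<forall>\<^sub>F t in at_top. norm ((t - real (nat \<lfloor>r t\<rfloor>) * \<mu>) / b t + x) \<le> \<mu> / b t"
      using ev eventually_b_pos
    proof eventually_elim
      case (elim t)
      have "real (nat \<lfloor>r t\<rfloor>) = of_int \<lfloor>r t\<rfloor>" using elim by simp
      hence n: "0 \<le> r t - real (nat \<lfloor>r t\<rfloor>)" "r t - real (nat \<lfloor>r t\<rfloor>) \<le> 1" by linarith+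
      have "(t - real (nat \<lfloor>r t\<rfloor>) * \<mu>) / b t + x = (r t - real (nat \<lfloor>r t\<rfloor>)) * (\<mu> / b t)"
        using elim mu_pos by (simp add: r_def field_simps)
      hence "norm ((t - real (nat \<lfloor>r t\<rfloor>) * \<mu>) / b t + x) = norm ((r t - real (nat \<lfloor>r t\<rfloor>)) * (\<mu> / b t))" by (rule arg_cong)
      also have "\<dots> = (r t - real (nat \<lfloor>r t\<rfloor>)) * (\<mu> / b t)"
        using n elim mu_pos unfolding real_norm_def by (intro abs_of_nonneg mult_nonneg_nonneg) auto
      also have "\<dots> \<le> 1 * (\<mu> / b t)" using n elim mu_pos by (intro mult_right_mono) auto
      finally show ?case by simp
    qed
  qed
  hence "((\<lambda>t. ((t - real (nat \<lfloor>r t\<rfloor>) * \<mu>) / b t + x) - x) \<longlongrightarrow> 0 - x) at_top" by (intro tendsto_intros)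
  thus "((\<lambda>t. (t - real (nat \<lfloor>t / \<mu> + x * (b t / \<mu>)\<rfloor>) * \<mu>) / b t) \<longlongrightarrow> - x) at_top" by (simp add: r_def)
qed

text \<open>Y > x means that the passage index exceeds t/\<mu> + x b t/\<mu>, equivalently its floor
  because the index is an integer; nonnegativity makes the conversion of the floor to a natural
  number faithful.\<close>

lemma prob_Y_gt:
  assumes t: "t > 0" and r: "t / \<mu> + x * (b t / \<mu>) \<ge> 0"
  shows "measure M {\<omega> \<in> space M. Y t \<omega> > x} = measure M {\<omega> \<in> space M. walk X (nat \<lfloor>t / \<mu> + x * (b t / \<mu>)\<rfloor>) \<omega> \<le> t}"
proof (rule M.finite_measure_eq_AE)
  let ?r = "t / \<mu> + x * (b t / \<mu>)"
  show "AE \<omega> in M. \<omega> \<in> {\<omega> \<in> space M. Y t \<omega> > x} \<longleftrightarrow> \<omega> \<in> {\<omega> \<in> space M. walk X (nat \<lfloor>?r\<rfloor>) \<omega> \<le> t}"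
    using AE_X_pos AE_walk_exceeds[of t]
  proof eventually_elim
    case (elim \<omega>)
    have "b t / \<mu> > 0" using b_pos[OF t] mu_pos by simp
    hence "Y t \<omega> > x \<longleftrightarrow> real (first_passage X t \<omega>) > ?r"
      unfolding Y_def by (subst pos_less_divide_eq) (auto simp: less_diff_eq add.commute)
    also have "\<dots> \<longleftrightarrow> first_passage X t \<omega> > nat \<lfloor>?r\<rfloor>" using r by linarith
    also have "\<dots> \<longleftrightarrow> walk X (nat \<lfloor>?r\<rfloor>) \<omega> \<le> t"
      by (rule first_passage_gt_iff(1)) (use elim t in auto)
    finally show ?case by auto
  qed
qed measurable

text \<open>At each continuity point x the walk is taken at the index belonging to x. Then S_n \<le>
  t says that (t - S_n)/b t + x lies in [x, \<infinity>), whose boundary {x} is null for the limit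
  law.\<close>

lemma Y_weak_limit:
  fixes \<tau> :: "nat \<Rightarrow> real"
  assumes \<tau>: "filterlim \<tau> at_top sequentially"
    and N': "real_distribution N'" and cf: "\<And>s. char N' s = stable_cf \<alpha> s"
  shows "weak_conv_m (\<lambda>k. distr M borel (Y (\<tau> k))) N'"
  unfolding weak_conv_m_def weak_conv_def
proof (intro allI impI)
  fix x assume "isCont (cdf N') x"
  interpret N': real_distribution N' by (rule N')
  have x0: "measure N' {x} = 0" using \<open>isCont (cdf N') x\<close> by (simp add: N'.isCont_cdf)
  define n where "n t = nat \<lfloor>t / \<mu> + x * (b t / \<mu>)\<rfloor>" for t
  define D' where "D' k = distr M borel (\<lambda>\<omega>. (\<tau> k - walk X (n (\<tau> k)) \<omega>) / b (\<tau> k) + x)" for k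
  have "weak_conv_m D' N'"
    unfolding D'_def by (rule walk_weak_limit[OF _ \<tau> N' cf]) (unfold n_def, rule passage_index_limit)
  hence lim: "(\<lambda>k. measure (D' k) {x..}) \<longlonglongrightarrow> measure N' {x..}"
  proof (rule weak_conv_imp_continuity_set_conv[rotated 2])
    show "real_distribution (D' k)" for k unfolding D'_def by (rule M.real_distribution_distr) measurable
    show "emeasure N' (frontier {x..}) = 0" using x0 by (simp add: frontier_real_atLeast N'.emeasure_eq_measure)
  qed (use N' in auto)
  have ev: "\<forall>\<^sub>F k in sequentially. 1 - measure (D' k) {x..} = cdf (distr M borel (Y (\<tau> k))) x"
  proof -
    have "\<forall>\<^sub>F t in at_top. b t > 0 \<and> t > 0 \<and> t / \<mu> + x * (b t / \<mu>) \<ge> 0"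
      using eventually_b_pos eventually_gt_at_top[of 0] eventually_passage_level_nonneg[of x] by eventually_elim simp
    from eventually_compose_filterlim[OF this \<tau>] show ?thesis
    proof eventually_elim
      case (elim k)
      let ?t = "\<tau> k"
      interpret Yd: real_distribution "distr M borel (Y ?t)" by (rule M.real_distribution_distr) measurable
      have "measure (D' k) {x..} = measure M {\<omega> \<in> space M. walk X (n ?t) \<omega> \<le> ?t}"
        unfolding D'_def using elim by (subst measure_distr) (auto simp: vimage_def zero_le_divide_iff Int_def conj_commute intro!: arg_cong[of _ _ "measure M"])
      also have "\<dots> = measure M {\<omega> \<in> space M. Y ?t \<omega> > x}"
        unfolding n_def using elim by (intro prob_Y_gt[symmetric]) auto
      also have "\<dots> = measure (distr M borel (Y ?t)) {x<..}"
        by (subst measure_distr) (auto simp: vimage_def Int_def conj_commute)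
      also have "\<dots> = 1 - measure (distr M borel (Y ?t)) {..x}"
        using Yd.prob_compl[of "{..x}"] by (simp add: Compl_eq_Diff_UNIV[symmetric])
      finally show ?case by (simp add: cdf_def2)
    qed
  qed
  have "(\<lambda>k. 1 - measure (D' k) {x..}) \<longlonglongrightarrow> 1 - measure N' {x..}" by (intro tendsto_intros lim)
  also have "1 - measure N' {x..} = cdf N' x"
  proof -
    have "measure N' {x..} = measure N' {x<..} + measure N' {x}"
      by (subst N'.finite_measure_Union[symmetric]) (auto intro!: arg_cong[of _ _ "measure N'"])
    also have "\<dots> = 1 - measure N' {..x}"
      using x0 N'.prob_compl[of "{..x}"] by (simp add: Compl_eq_Diff_UNIV[symmetric])
    finally show ?thesis by (simp add: cdf_def2)
  qed
  finally show "(\<lambda>k. cdf (distr M borel (Y (\<tau> k))) x) \<longlonglongrightarrow> cdf N' x"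
    by (rule Lim_transform_eventually[OF _ ev])
qed

text \<open>The variables (t - S_n)/b t, with the index at level 0, converge weakly to the stable
  law, and their exponential moments converge to the stated value. Boundedness of the moment at 2
  \<theta> allows the two limits to be identified.\<close>

lemma stable_exp_moment:
  assumes N': "real_distribution N'" and cf: "\<And>s. char N' s = stable_cf \<alpha> s" and \<theta>: "\<theta> \<ge> 0"
  shows "(\<integral>\<^sup>+w. ennreal (exp (\<theta> * w)) \<partial>N') = ennreal (exp (- Gamma (1 - \<alpha>) * \<theta> powr \<alpha>))"
proof (cases "\<theta> = 0")
  case True
  interpret N': real_distribution N' by (rule N')
  show ?thesis using True N'.emeasure_space_1 by simp
next
  case False
  with \<theta> have \<theta>: "\<theta> > 0" by simp
  define n where "n t = nat \<lfloor>t / \<mu> + 0 * (b t / \<mu>)\<rfloor>" for t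
  let ?D = "\<lambda>k \<omega>. (real k - walk X (n (real k)) \<omega>) / b (real k) + 0" and ?l = "\<lambda>\<theta>. exp (- Gamma (1 - \<alpha>) * \<theta> powr \<alpha>)"
  define D' where "D' k = distr M borel (\<lambda>\<omega>. (real k - walk X (n (real k)) \<omega>) / b (real k) + 0)" for k :: nat
  have n: "((\<lambda>t. (t - real (n t) * \<mu>) / b t) \<longlongrightarrow> - 0) at_top" unfolding n_def by (rule passage_index_limit)
  interpret W: weakly_convergent D' N' "\<lambda>y. exp (\<theta> * y)"
  proof (rule weakly_convergent.intro)
    show "real_distribution (D' k)" for k unfolding D'_def by (rule M.real_distribution_distr) measurable
    show "weak_conv_m D' N'" unfolding D'_def by (rule walk_weak_limit[OF n filterlim_real_sequentially N' cf])
  qed (use N' in auto)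
  have val: "\<forall>\<^sub>F k in sequentially. (\<integral>\<^sup>+y. ennreal (exp (\<eta> * y)) \<partial>D' k) = ennreal (\<integral>\<omega>. exp (\<eta> * ?D k \<omega>) \<partial>M)" if "\<eta> > 0" for \<eta>
    using eventually_compose_filterlim[OF eventually_b_pos filterlim_real_sequentially]
  proof eventually_elim
    case (elim k)
    have "(\<integral>\<^sup>+y. ennreal (exp (\<eta> * y)) \<partial>D' k) = (\<integral>\<^sup>+\<omega>. ennreal (exp (\<eta> * ?D k \<omega>)) \<partial>M)"
      unfolding D'_def by (subst nn_integral_distr) auto
    also have "\<dots> = ennreal (\<integral>\<omega>. exp (\<eta> * ?D k \<omega>) \<partial>M)"
      by (rule nn_integral_eq_integral[OF integrable_walk_exp]) (use elim that in auto)
    finally show ?case .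
  qed
  have lim: "(\<lambda>k. \<integral>\<^sup>+y. ennreal (exp (\<eta> * y)) \<partial>D' k) \<longlonglongrightarrow> ennreal (?l \<eta>)" if "\<eta> > 0" for \<eta>
  proof (rule Lim_transform_eventually)
    show "(\<lambda>k. ennreal (\<integral>\<omega>. exp (\<eta> * ?D k \<omega>) \<partial>M)) \<longlonglongrightarrow> ennreal (?l \<eta>)"
      by (intro tendsto_ennrealI filterlim_compose[OF walk_exp_limit[OF that n] filterlim_real_sequentially])
    show "\<forall>\<^sub>F k in sequentially. ennreal (\<integral>\<omega>. exp (\<eta> * ?D k \<omega>) \<partial>M) = (\<integral>\<^sup>+y. ennreal (exp (\<eta> * y)) \<partial>D' k)"
      using val[OF that] by eventually_elim simp
  qed
  define B where "B = exp (- Gamma (1 - \<alpha>) * (2 * \<theta>) powr \<alpha>) + 1"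
  have "\<forall>\<^sub>F k in sequentially. (\<integral>\<^sup>+y. ennreal (exp (2 * \<theta> * y)) \<partial>D' k) < ennreal B"
    by (rule order_tendstoD(2)[OF lim]) (use \<theta> in \<open>auto simp: B_def intro!: ennreal_lessI add_pos_pos\<close>)
  hence "\<forall>\<^sub>F k in sequentially. (\<integral>\<^sup>+y. ennreal (exp (\<theta> * y) powr 2) \<partial>D' k) \<le> ennreal B"
    by eventually_elim (simp add: exp_powr_real mult_ac less_imp_le)
  from W.tendsto_nn_integral(1)[OF _ _ this] have "(\<lambda>k. \<integral>\<^sup>+y. ennreal (exp (\<theta> * y)) \<partial>D' k) \<longlonglongrightarrow> (\<integral>\<^sup>+w. ennreal (exp (\<theta> * w)) \<partial>N')"
    by (simp add: B_def add_nonneg_nonneg)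
  from LIMSEQ_unique[OF this lim[OF \<theta>]] show ?thesis .
qed

section \<open>Tail bounds\<close>

text \<open>Chernoff bound at s / b t. With \<psi> = \<phi> - 1 + s \<mu>/b t and n about t/\<mu> +
  x b t/\<mu>, the exponent is t/\<mu> \<psi> + x (b t/\<mu>) \<psi> - x s up to rounding: the first
  term tends to \<open>K\<close>, and the coefficient of x in the second tends to 0, whence
  uniformity in x.\<close>

lemma upper_tail:
  assumes \<theta>: "\<theta> > 0"
  shows "\<exists>C\<ge>0. \<forall>\<^sub>F t in at_top. \<forall>x>0. measure M {\<omega> \<in> space M. Y t \<omega> > x} \<le> C * exp (- (2 * \<theta> * x))"
proof -
  \<comment> \<open>One unit above the target rate 2 \<theta>: it absorbs the term x * (b t / t) *
    (t / \<mu> * \<psi> t), which is eventually below x.\<close>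
  define s where "s = 2 * \<theta> + 1"
  have s: "s > 0" using \<theta> by (simp add: s_def)
  define \<psi> where "\<psi> t = \<phi> (s / b t) - 1 + s / b t * \<mu>" for t
  define K where "K = - (Gamma (1 - \<alpha>) * s powr \<alpha>)"
  have "((\<lambda>t. complex_of_real (t / \<mu> * \<psi> t)) \<longlongrightarrow> - (of_real (Gamma (1 - \<alpha>)) * of_real s powr of_real \<alpha>)) at_top"
  proof -
    have "\<Phi> (of_real s / of_real (b t)) = of_real (\<phi> (s / b t))" for t
      using Phi_of_real[of "s / b t"] by simp
    hence eq: "complex_of_real (t / \<mu> * \<psi> t) = of_real (t / \<mu>) * (\<Phi> (of_real s / of_real (b t)) - 1 + of_real s / of_real (b t) * of_real \<mu>)" for t
      by (simp add: \<psi>_def)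
    show ?thesis unfolding eq by (rule laplace_limit) (use s in auto)
  qed
  also have "- (of_real (Gamma (1 - \<alpha>)) * of_real s powr of_real \<alpha>) = complex_of_real K"
    using s by (simp add: K_def powr_of_real)
  finally have lim: "((\<lambda>t. t / \<mu> * \<psi> t) \<longlongrightarrow> K) at_top" by (simp only: tendsto_of_real_iff)
  have lim2: "((\<lambda>t. b t / t * (t / \<mu> * \<psi> t)) \<longlongrightarrow> 0 * K) at_top" by (intro tendsto_intros b_over_t lim)
  have "\<forall>\<^sub>F t in at_top. t / \<mu> * \<psi> t < K + 1" by (rule order_tendstoD(2)[OF lim]) simp
  moreover have "\<forall>\<^sub>F t in at_top. b t / t * (t / \<mu> * \<psi> t) < 1" by (rule order_tendstoD(2)[OF lim2]) simp
  ultimately have "\<forall>\<^sub>F t in at_top. \<forall>x>0. measure M {\<omega> \<in> space M. Y t \<omega> > x} \<le> exp (K + 2) * exp (- (2 * \<theta> * x))"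
    using eventually_gt_at_top[of 0] eventually_b_pos
  proof eventually_elim
    case (elim t)
    show ?case
    proof (intro allI impI)
      fix x :: real assume x: "x > 0"
      define r where "r = t / \<mu> + x * (b t / \<mu>)"
      have r: "r \<ge> 0" unfolding r_def using elim mu_pos x by (intro add_nonneg_nonneg mult_nonneg_nonneg) auto
      define n where "n = nat \<lfloor>r\<rfloor>"
      have n: "real n \<ge> r - 1" using r unfolding n_def by linarith
      define u where "u = s / b t"
      have l: "u \<ge> 0" using s elim by (simp add: u_def)
      note ph = phi_bounds[OF l]
      have "measure M {\<omega> \<in> space M. Y t \<omega> > x} = measure M {\<omega> \<in> space M. walk X n \<omega> \<le> t}"
        unfolding n_def r_def by (rule prob_Y_gt) (use elim r in \<open>auto simp: r_def\<close>)
      also have "\<dots> \<le> exp (u * t) * \<phi> u ^ n" by (rule prob_walk_le[OF l])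
      also have "\<dots> \<le> exp (u * t) * exp (\<phi> u - 1) ^ n"
        using ph exp_ge_add_one_self[of "\<phi> u - 1"] by (intro mult_left_mono power_mono) auto
      also have "\<dots> = exp (u * t + real n * (\<phi> u - 1))" by (simp add: exp_add exp_of_nat_mult)
      also have "\<dots> \<le> exp ((K + 2) + (- (2 * \<theta> * x)))"
      proof (subst exp_le_cancel_iff)
        \<comment> \<open>As \<phi> u - 1 lies in [-1, 0], replacing n by its lower bound r - 1
          costs at most 1.\<close>
        have "real n * (\<phi> u - 1) \<le> (r - 1) * (\<phi> u - 1)" using n ph by (intro mult_right_mono_neg) auto
        also have "\<dots> \<le> r * (\<phi> u - 1) + 1" using ph by (simp add: algebra_simps)
        finally have "u * t + real n * (\<phi> u - 1) \<le> u * t + r * (\<phi> u - 1) + 1" by simp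
        also have "u * t + r * (\<phi> u - 1) + 1 = u * t + r * (\<psi> t - u * \<mu>) + 1" by (simp add: \<psi>_def u_def)
        also have "u * t + r * (\<psi> t - u * \<mu>) + 1 = t / \<mu> * \<psi> t + x * (b t / t * (t / \<mu> * \<psi> t)) - x * s + 1"
          using elim mu_pos by (simp add: r_def u_def field_simps)
        also have "\<dots> \<le> (K + 1) + x * 1 - x * s + 1"
          using elim x by (intro add_mono diff_mono mult_left_mono) auto
        also have "\<dots> = (K + 2) + (- (2 * \<theta> * x))" by (simp add: s_def algebra_simps)
        finally show "u * t + real n * (\<phi> u - 1) \<le> (K + 2) + (- (2 * \<theta> * x))" .
      qed
      finally show "measure M {\<omega> \<in> space M. Y t \<omega> > x} \<le> exp (K + 2) * exp (- (2 * \<theta> * x))"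
        by (simp only: exp_add)
    qed
  qed
  thus ?thesis by (intro exI[of _ "exp (K + 2)"]) auto
qed

text \<open>Fuk--Nagaev type bound: truncate the steps at \<open>y\<close> and apply Chebyshev's inequality.
  Centring at \<open>\<mu>\<close> dominates centring at the truncated mean.\<close>
lemma prob_walk_deviation:
  assumes y: "y > 0"
  shows "measure M {\<omega> \<in> space M. walk X n \<omega> - real n * \<mu> > y} \<le> real n * (T y + V y / y\<^sup>2)"
proof -
  define f where "f v = max 0 (min v y)" for v
  define m where "m = (\<integral>v. f v \<partial>D)"
  define Z where "Z i \<omega> = f (X i \<omega>) - m" for i \<omega>
  let ?A = "\<Union>i\<in>{1..n}. {\<omega> \<in> space M. X i \<omega> > y}" and ?B = "{\<omega> \<in> space M. (\<Sum>i=1..n. Z i \<omega>)\<^sup>2 \<ge> y\<^sup>2}" and ?W = "{\<omega> \<in> space M. walk X n \<omega> - real n * \<mu> > y}"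
  have [measurable]: "f \<in> borel_measurable borel" unfolding f_def by measurable
  have fb: "0 \<le> f v" "f v \<le> y" for v using y by (auto simp: f_def)
  have fi: "integrable D f" by (rule integrable_const_bound[of _ y]) (use fb in auto)
  have f2i: "integrable D (\<lambda>v. (f v)\<^sup>2)"
    by (rule integrable_const_bound[of _ "y\<^sup>2"]) (use fb in \<open>auto intro!: power_mono\<close>)
  have m0: "0 \<le> m" unfolding m_def by (intro integral_nonneg_AE) (use fb in auto)
  have "m \<le> (\<integral>v. y \<partial>D)" unfolding m_def by (intro integral_mono fi) (use fb in auto)
  hence my: "m \<le> y" by (simp add: prob_space[simplified])
  have m\<mu>: "m \<le> \<mu>" unfolding m_def \<mu>_def using pos
    by (intro integral_mono_AE fi integrable_id) (auto simp: f_def elim!: eventually_mono)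
  have ind: "M.indep_vars (\<lambda>_. borel) Z {1..n}" unfolding Z_def
    by (rule M.indep_vars_compose2[OF M.indep_vars_subset[OF indep]]) auto
  have EZ: "M.expectation (Z i) = 0" if "i \<in> {1..n}" for i
    using integral_X[of i "\<lambda>v. f v - m"] that fi by (simp add: Z_def[abs_def] m_def prob_space[simplified])
  have EZ2: "M.expectation (\<lambda>\<omega>. (Z i \<omega>)\<^sup>2) \<le> V y" if "i \<in> {1..n}" for i
  proof -
    have "M.expectation (\<lambda>\<omega>. (Z i \<omega>)\<^sup>2) = (\<integral>v. (f v - m)\<^sup>2 \<partial>D)"
      using integral_X[of i "\<lambda>v. (f v - m)\<^sup>2"] that by (simp add: Z_def)
    also have "\<dots> = (\<integral>v. (f v)\<^sup>2 - 2 * m * f v + m\<^sup>2 \<partial>D)" by (simp add: power2_diff algebra_simps)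
    also have "\<dots> = V y - 2 * m * m + m\<^sup>2"
    proof -
      have "V y = (\<integral>v. (f v)\<^sup>2 \<partial>D)" by (simp add: V_def f_def)
      thus ?thesis using fi f2i by (simp add: m_def prob_space[simplified])
    qed
    also have "\<dots> \<le> V y" using m0 by (simp add: power2_eq_square)
    finally show ?thesis .
  qed
  have [measurable]: "(\<lambda>\<omega>. \<Sum>i=1..n. Z i \<omega>) \<in> borel_measurable M"
    unfolding Z_def by (intro borel_measurable_sum) auto
  have Zb: "\<bar>Z i \<omega>\<bar> \<le> y" for i \<omega> using fb[of "X i \<omega>"] m0 my by (simp add: Z_def)
  have "measure M ?W
    \<le> measure M (?A \<union> ?B)"
  proof (rule M.finite_measure_mono_AE)
    show "AE \<omega> in M. \<omega> \<in> ?W \<longrightarrow>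
      \<omega> \<in> ?A \<union> ?B"
      using AE_X_pos
    proof (eventually_elim, intro impI)
      fix \<omega> assume p: "\<forall>k\<ge>1. X k \<omega> > 0" and w: "\<omega> \<in> ?W"
      show "\<omega> \<in> ?A \<union> ?B"
      proof (cases "\<exists>i\<in>{1..n}. X i \<omega> > y")
        case False
        \<comment> \<open>If no step exceeds y, clipping changes nothing, and the sum of the Z i is
          S_n - n m, at least S_n - n \<mu> > y.\<close>
        have "Z i \<omega> = X i \<omega> - m" if "i \<in> {1..n}" for i
          using that False p by (auto simp: Z_def f_def max_def min_def not_less less_imp_le)
        hence "(\<Sum>i=1..n. Z i \<omega>) = walk X n \<omega> - real n * m"
          by (simp add: walk_def sum_subtractf)
        moreover have "real n * m \<le> real n * \<mu>" using m\<mu> by (intro mult_left_mono) auto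
        ultimately have "(\<Sum>i=1..n. Z i \<omega>) \<ge> y" using w by auto
        hence "(\<Sum>i=1..n. Z i \<omega>)\<^sup>2 \<ge> y\<^sup>2" using y by (intro power_mono) auto
        thus ?thesis using w by auto
      qed (use w in auto)
    qed
  qed measurable
  also have "\<dots> \<le> measure M ?A + measure M ?B"
    by (rule measure_Un_le; measurable)
  also have "measure M ?A \<le> (\<Sum>i\<in>{1..n}. measure M {\<omega> \<in> space M. X i \<omega> > y})"
    by (rule M.finite_measure_subadditive_finite) auto
  also have "\<dots> = (\<Sum>i\<in>{1..n}. T y)"
  proof (rule sum.cong[OF refl])
    fix i assume "i \<in> {1..n}"
    hence i: "i \<ge> 1" by simp
    have "T y = measure (distr M borel (X i)) {y<..}" by (simp add: law[OF i] T_def)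
    thus "measure M {\<omega> \<in> space M. X i \<omega> > y} = T y"
      using i by (simp add: measure_distr vimage_def Int_def conj_commute)
  qed
  also have "\<dots> = real n * T y" by simp
  also have "measure M ?B \<le> (\<integral>\<omega>. (\<Sum>i=1..n. Z i \<omega>)\<^sup>2 \<partial>M) / y\<^sup>2"
  proof (rule integral_Markov_inequality_measure[where A = "space M"])
    show "integrable M (\<lambda>\<omega>. (\<Sum>i=1..n. Z i \<omega>)\<^sup>2)"
    proof (rule M.integrable_const_bound[of _ "(real n * y)\<^sup>2"])
      show "AE \<omega> in M. norm ((\<Sum>i=1..n. Z i \<omega>)\<^sup>2) \<le> (real n * y)\<^sup>2"
      proof (intro AE_I2)
        fix \<omega>
        have "\<bar>\<Sum>i=1..n. Z i \<omega>\<bar> \<le> (\<Sum>i=1..n. y)" using Zb by (intro order_trans[OF sum_abs sum_mono])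
        thus "norm ((\<Sum>i=1..n. Z i \<omega>)\<^sup>2) \<le> (real n * y)\<^sup>2"
          using y by (simp add: abs_le_square_iff[symmetric])
      qed
    qed measurable
  qed (use y in auto)
  also have "(\<integral>\<omega>. (\<Sum>i=1..n. Z i \<omega>)\<^sup>2 \<partial>M) = (\<Sum>i=1..n. M.expectation (\<lambda>\<omega>. (Z i \<omega>)\<^sup>2))"
    by (rule M.indep_sum_second_moment[OF _ ind Zb EZ]) auto
  also have "\<dots> \<le> (\<Sum>i=1..n. V y)" by (intro sum_mono EZ2) auto
  also have "\<dots> = real n * V y" by simp
  finally show ?thesis using y by (simp add: divide_right_mono distrib_left)
qed

text \<open>-Y > x says that the passage index lies below r = (t - x b t)/\<mu>. At the last integer
  n below r the walk already exceeds t although n \<mu> < t - x b t: a deviation of more than x b t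
  within at most t/\<mu> steps, to which \<open>prob_walk_deviation\<close> and
  \<open>truncation_bound\<close> apply.\<close>

lemma lower_tail:
  assumes s: "0 < s" "s < \<alpha>"
  shows "\<exists>C\<ge>0. \<forall>\<^sub>F t in at_top. \<forall>x\<ge>1. measure M {\<omega> \<in> space M. - Y t \<omega> > x} \<le> C * x powr (- s)"
proof -
  \<comment> \<open>Serves both s \<le> \<alpha> - \<delta>, for the decay wanted, and \<delta> < 2
    - \<alpha>, for the truncation bound.\<close>
  define \<delta> where "\<delta> = min (\<alpha> - s) (2 - \<alpha>) / 2"
  have \<delta>: "0 < \<delta>" "\<delta> < 2 - \<alpha>" "s \<le> \<alpha> - \<delta>" using s alpha by (auto simp: \<delta>_def min_def field_simps)
  obtain C where C: "C > 0" "\<forall>\<^sub>F t in at_top. \<forall>x\<ge>1. t / \<mu> * (T (b t * x) + V (b t * x) / (b t * x)\<^sup>2) \<le> C * x powr (- (\<alpha> - \<delta>))"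
    using truncation_bound[OF \<delta>(1,2)] by blast
  have "\<forall>\<^sub>F t in at_top. \<forall>x\<ge>1. measure M {\<omega> \<in> space M. - Y t \<omega> > x} \<le> C * x powr (- s)"
    using C(2) eventually_gt_at_top[of 0] eventually_b_pos
  proof eventually_elim
    case (elim t)
    show ?case
    proof (intro allI impI)
      fix x :: real assume x: "x \<ge> 1"
      define r where "r = t / \<mu> - x * (b t / \<mu>)"
      \<comment> \<open>The largest integer strictly below r. For r \<le> 1 the event is null, since
        the passage index is at least 1; hence r > 1 is carried along inside the event.\<close>
      define n where "n = nat (\<lceil>r\<rceil> - 1)"
      have bx: "b t * x > 0" using elim x by simp
      have "measure M {\<omega> \<in> space M. - Y t \<omega> > x} \<le> measure M {\<omega> \<in> space M. r > 1 \<and> walk X n \<omega> - real n * \<mu> > b t * x}"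
      proof (rule M.finite_measure_mono_AE)
        show "AE \<omega> in M. \<omega> \<in> {\<omega> \<in> space M. - Y t \<omega> > x} \<longrightarrow> \<omega> \<in> {\<omega> \<in> space M. r > 1 \<and> walk X n \<omega> - real n * \<mu> > b t * x}"
          using AE_X_pos AE_walk_exceeds[of t]
        proof (eventually_elim, intro impI)
          fix \<omega> assume p: "\<forall>k\<ge>1. X k \<omega> > 0" and ex: "\<exists>k. walk X k \<omega> > t" and w: "\<omega> \<in> {\<omega> \<in> space M. - Y t \<omega> > x}"
          have "Y t \<omega> < - x" using w by simp
          hence "real (first_passage X t \<omega>) - t / \<mu> < - x * (b t / \<mu>)"
            unfolding Y_def using elim mu_pos by (subst (asm) pos_divide_less_eq) auto
          hence N: "real (first_passage X t \<omega>) < r" by (simp add: r_def)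
          have N1: "first_passage X t \<omega> \<ge> 1" using first_passage_gt_iff(2)[OF _ p ex] elim by simp
          have r1: "r > 1" using N N1 by linarith
          have "first_passage X t \<omega> \<le> n" unfolding n_def using N r1 by linarith
          hence "walk X n \<omega> > t" using first_passage_gt_iff(1)[OF _ p ex, of n] elim by auto
          moreover have "real n < r" unfolding n_def using r1 by linarith
          hence "real n * \<mu> < r * \<mu>" using mu_pos by simp
          moreover have "r * \<mu> = t - b t * x" using mu_pos by (simp add: r_def field_simps)
          ultimately show "\<omega> \<in> {\<omega> \<in> space M. r > 1 \<and> walk X n \<omega> - real n * \<mu> > b t * x}" using w r1 by auto
        qed
      qed measurable
      also have "\<dots> \<le> C * x powr (- (\<alpha> - \<delta>))"
      proof (cases "r > 1")
        case True
        have "measure M {\<omega> \<in> space M. r > 1 \<and> walk X n \<omega> - real n * \<mu> > b t * x} \<le> real n * (T (b t * x) + V (b t * x) / (b t * x)\<^sup>2)"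
          using prob_walk_deviation[OF bx, of n] True by simp
        also have "\<dots> \<le> t / \<mu> * (T (b t * x) + V (b t * x) / (b t * x)\<^sup>2)"
        proof (rule mult_right_mono)
          have "real n \<le> r" unfolding n_def using True by linarith
          also have "r \<le> t / \<mu>" using elim x mu_pos by (simp add: r_def)
          finally show "real n \<le> t / \<mu>" .
          show "0 \<le> T (b t * x) + V (b t * x) / (b t * x)\<^sup>2"
            using T_pos[of "b t * x"] V_nonneg[of "b t * x"] by (intro add_nonneg_nonneg divide_nonneg_nonneg) auto
        qed
        also have "\<dots> \<le> C * x powr (- (\<alpha> - \<delta>))" using elim x by blast
        finally show ?thesis .
      next
        case False thus ?thesis using C by simp
      qed
      also have "\<dots> \<le> C * x powr (- s)" using x \<delta> C by (intro mult_left_mono powr_mono) auto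
      finally show "measure M {\<omega> \<in> space M. - Y t \<omega> > x} \<le> C * x powr (- s)" .
    qed
  qed
  thus ?thesis using C by (intro exI[of _ C]) auto
qed

section \<open>Convergence of moments\<close>

lemma measure_distr_Ioi:
  assumes "f \<in> borel_measurable M"
  shows "measure (distr M borel f) {x<..} = measure M {\<omega> \<in> space M. f \<omega> > (x :: real)}"
  using assms by (simp add: measure_distr vimage_def Int_def conj_commute)

lemma Y_weakly_convergent:
  assumes "filterlim \<tau> at_top sequentially" "real_distribution N'" "\<And>s. char N' s = stable_cf \<alpha> s"
    and "\<And>x. isCont g x" "\<And>x. 0 \<le> g x"
  shows "weakly_convergent (\<lambda>k. distr M borel (Y (\<tau> k))) N' g"
  by (intro weakly_convergent.intro Y_weak_limit M.real_distribution_distr assms) measurable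

lemma exp_moment_bound:
  assumes \<theta>: "\<theta> > 0"
  shows "\<exists>B\<ge>0. \<forall>\<^sub>F t in at_top. (\<integral>\<^sup>+y. ennreal (exp (\<theta> * y)) \<partial>distr M borel (Y t)) \<le> ennreal B"
proof -
  obtain C where C: "C \<ge> 0" "\<forall>\<^sub>F t in at_top. \<forall>x>0. measure M {\<omega> \<in> space M. Y t \<omega> > x} \<le> C * exp (- (2 * \<theta> * x))"
    using upper_tail[OF \<theta>] by blast
  have "\<forall>\<^sub>F t in at_top. (\<integral>\<^sup>+y. ennreal (exp (\<theta> * y)) \<partial>distr M borel (Y t)) \<le> ennreal (1 + C)"
    using C(2)
  proof eventually_elim
    case (elim t)
    interpret Yd: real_distribution "distr M borel (Y t)" by (rule M.real_distribution_distr) measurable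
    show ?case by (rule Yd.nn_integral_exp_le_tail[OF \<theta> C(1)]) (use elim in \<open>simp add: measure_distr_Ioi\<close>)
  qed
  thus ?thesis using C by (intro exI[of _ "1 + C"]) auto
qed

text \<open>Uniform integrability of exp(\<theta> Y) comes from its second moment, the exponential
  moment at 2 \<theta>.\<close>

lemma exp_moment_limit:
  assumes N': "real_distribution N'" and cf: "\<And>s. char N' s = stable_cf \<alpha> s" and \<theta>: "\<theta> \<ge> 0"
  shows "((\<lambda>t. \<integral>\<^sup>+\<omega>. ennreal (exp (\<theta> * Y t \<omega>)) \<partial>M) \<longlongrightarrow> (\<integral>\<^sup>+w. ennreal (exp (\<theta> * w)) \<partial>N')) at_top"
proof (cases "\<theta> = 0")
  case True
  interpret N': real_distribution N' by (rule N')
  show ?thesis using True N'.emeasure_space_1 M.emeasure_space_1 by simp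
next
  case False
  with \<theta> have \<theta>: "\<theta> > 0" by simp
  obtain B where B: "B \<ge> 0" "\<forall>\<^sub>F t in at_top. (\<integral>\<^sup>+y. ennreal (exp (2 * \<theta> * y)) \<partial>distr M borel (Y t)) \<le> ennreal B"
    using exp_moment_bound[of "2 * \<theta>"] \<theta> by auto
  show ?thesis
  proof (rule tendsto_at_topI_sequentially)
    fix \<tau> :: "nat \<Rightarrow> real" assume \<tau>: "filterlim \<tau> at_top sequentially"
    interpret W: weakly_convergent "\<lambda>k. distr M borel (Y (\<tau> k))" N' "\<lambda>y. exp (\<theta> * y)"
      by (rule Y_weakly_convergent[OF \<tau> N' cf]) auto
    have "\<forall>\<^sub>F k in sequentially. (\<integral>\<^sup>+y. ennreal (exp (\<theta> * y) powr 2) \<partial>distr M borel (Y (\<tau> k))) \<le> ennreal B"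
      using eventually_compose_filterlim[OF B(2) \<tau>] by eventually_elim (simp add: exp_powr_real mult_ac)
    from W.tendsto_nn_integral(1)[OF _ B(1) this]
    show "(\<lambda>k. \<integral>\<^sup>+\<omega>. ennreal (exp (\<theta> * Y (\<tau> k) \<omega>)) \<partial>M) \<longlonglongrightarrow> (\<integral>\<^sup>+w. ennreal (exp (\<theta> * w)) \<partial>N')"
      by (simp add: nn_integral_distr)
  qed
qed

lemma isCont_max_powr: "p > 0 \<Longrightarrow> isCont (\<lambda>y::real. max y 0 powr p) x"
  and isCont_min_powr: "p > 0 \<Longrightarrow> isCont (\<lambda>y::real. (- min y 0) powr p) x"
proof -
  assume p: "p > 0"
  have "continuous_on UNIV (\<lambda>y::real. max y 0 powr p)"
    using p by (intro continuous_on_powr' continuous_intros) auto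
  thus "isCont (\<lambda>y::real. max y 0 powr p) x" by (simp add: continuous_on_eq_continuous_at)
  have "continuous_on UNIV (\<lambda>y::real. (- min y 0) powr p)"
    using p by (intro continuous_on_powr' continuous_intros) auto
  thus "isCont (\<lambda>y::real. (- min y 0) powr p) x" by (simp add: continuous_on_eq_continuous_at)
qed

text \<open>Every power of the positive part is dominated by an exponential, so the exponential
  bound at rate 1 controls the order 2 p, which gives uniform integrability at order p.\<close>

lemma positive_part_limit:
  assumes N': "real_distribution N'" and cf: "\<And>s. char N' s = stable_cf \<alpha> s" and p: "p > 0"
  shows "((\<lambda>t. \<integral>\<^sup>+\<omega>. ennreal (max (Y t \<omega>) 0 powr p) \<partial>M) \<longlongrightarrow> (\<integral>\<^sup>+w. ennreal (max w 0 powr p) \<partial>N')) at_top"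
    and "(\<integral>\<^sup>+w. ennreal (max w 0 powr p) \<partial>N') < \<infinity>"
proof -
  let ?I = "\<integral>\<^sup>+w. ennreal (max w 0 powr p) \<partial>N'" and ?E = "\<lambda>t. \<integral>\<^sup>+y. ennreal ((max y 0 powr p) powr 2) \<partial>distr M borel (Y t)"
  define q where "q = 2 * p"
  have q: "q > 0" using p by (simp add: q_def)
  \<comment> \<open>The inequality y \<le> q exp(y/q) raised to the power q, which explains the
    constant.\<close>
  have le: "max y 0 powr q \<le> q powr q * exp y" for y :: real
  proof (cases "y > 0")
    case True
    have "y / q \<le> exp (y / q)" using exp_ge_add_one_self[of "y / q"] by linarith
    hence "(y / q) powr q \<le> exp (y / q) powr q" using True q by (intro powr_mono2) auto
    hence "(y / q) powr q \<le> exp y" using q by (simp add: exp_powr_real)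
    thus ?thesis using True q by (simp add: powr_divide field_simps)
  qed simp
  obtain B where B: "B \<ge> 0" "\<forall>\<^sub>F t in at_top. (\<integral>\<^sup>+y. ennreal (exp (1 * y)) \<partial>distr M borel (Y t)) \<le> ennreal B"
    using exp_moment_bound[of 1] by auto
  have bound: "\<forall>\<^sub>F t in at_top. ?E t \<le> ennreal (q powr q * B)"
    using B(2)
  proof eventually_elim
    case (elim t)
    have "?E t \<le> (\<integral>\<^sup>+y. ennreal (q powr q) * ennreal (exp (1 * y)) \<partial>distr M borel (Y t))"
    proof (intro nn_integral_mono)
      fix y :: real
      have "(max y 0 powr p) powr 2 \<le> q powr q * exp (1 * y)"
        using le[of y] by (simp add: powr_powr q_def mult.commute del: powr_numeral)
      thus "ennreal ((max y 0 powr p) powr 2) \<le> ennreal (q powr q) * ennreal (exp (1 * y))"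
        by (simp add: ennreal_mult'[symmetric] ennreal_leI del: powr_numeral)
    qed
    also have "\<dots> = ennreal (q powr q) * (\<integral>\<^sup>+y. ennreal (exp (1 * y)) \<partial>distr M borel (Y t))"
      by (rule nn_integral_cmult) simp
    also have "\<dots> \<le> ennreal (q powr q) * ennreal B" by (rule mult_left_mono[OF elim]) simp
    finally show ?case by (simp add: ennreal_mult')
  qed
  have W: "weakly_convergent (\<lambda>k. distr M borel (Y (\<tau> k))) N' (\<lambda>y. max y 0 powr p)" if "filterlim \<tau> at_top sequentially" for \<tau>
    by (rule Y_weakly_convergent[OF that N' cf isCont_max_powr[OF p]]) auto
  note L = weakly_convergent.tendsto_nn_integral[OF W _ _ eventually_compose_filterlim[OF bound]]
  show "?I < \<infinity>"
    by (rule L(2)[OF filterlim_real_sequentially _ _ filterlim_real_sequentially]) (use B in auto)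
  show "((\<lambda>t. \<integral>\<^sup>+\<omega>. ennreal (max (Y t \<omega>) 0 powr p) \<partial>M) \<longlongrightarrow> ?I) at_top"
  proof (rule tendsto_at_topI_sequentially)
    fix \<tau> :: "nat \<Rightarrow> real" assume \<tau>: "filterlim \<tau> at_top sequentially"
    from L(1)[OF \<tau> _ _ \<tau>] B(1)
    show "(\<lambda>k. \<integral>\<^sup>+\<omega>. ennreal (max (Y (\<tau> k) \<omega>) 0 powr p) \<partial>M) \<longlonglongrightarrow> ?I"
      by (simp add: nn_integral_distr)
  qed
qed

lemma nn_integral_abs_powr_split:
  fixes N' :: "'c measure" and f :: "'c \<Rightarrow> real"
  assumes [measurable]: "f \<in> borel_measurable N'" and p: "p > 0"
  shows "(\<integral>\<^sup>+w. ennreal (\<bar>f w\<bar> powr p) \<partial>N') = (\<integral>\<^sup>+w. ennreal (max (f w) 0 powr p) \<partial>N') + (\<integral>\<^sup>+w. ennreal ((- min (f w) 0) powr p) \<partial>N')"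
proof -
  have "(\<integral>\<^sup>+w. ennreal (\<bar>f w\<bar> powr p) \<partial>N') = (\<integral>\<^sup>+w. ennreal (max (f w) 0 powr p) + ennreal ((- min (f w) 0) powr p) \<partial>N')"
    using p by (intro nn_integral_cong) (auto simp: max_def min_def)
  thus ?thesis by (simp add: nn_integral_add)
qed

text \<open>For p < \<alpha> the tail bound yields a bounded moment of an order strictly between p
  and \<alpha>. For p \<ge> \<alpha> the absolute moment of the limit is infinite while that of its
  positive part is finite, so the negative part carries the divergence, and lower semicontinuity
  passes it on to the converging variables.\<close>

lemma negative_part_limit:
  assumes N': "real_distribution N'" and cf: "\<And>s. char N' s = stable_cf \<alpha> s" and p: "p > 0"
  shows "((\<lambda>t. \<integral>\<^sup>+\<omega>. ennreal ((- min (Y t \<omega>) 0) powr p) \<partial>M) \<longlongrightarrow> (\<integral>\<^sup>+w. ennreal ((- min w 0) powr p) \<partial>N')) at_top"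
    and "(\<integral>\<^sup>+w. ennreal ((- min w 0) powr p) \<partial>N') < \<infinity> \<longleftrightarrow> p < \<alpha>"
proof -
  let ?I = "\<integral>\<^sup>+w. ennreal ((- min w 0) powr p) \<partial>N'" and ?E = "\<lambda>t. \<integral>\<^sup>+\<omega>. ennreal ((- min (Y t \<omega>) 0) powr p) \<partial>M"
  interpret N': real_distribution N' by (rule N')
  have W: "weakly_convergent (\<lambda>k. distr M borel (Y (\<tau> k))) N' (\<lambda>y. (- min y 0) powr p)" if "filterlim \<tau> at_top sequentially" for \<tau>
    by (rule Y_weakly_convergent[OF that N' cf isCont_min_powr[OF p]]) auto
  have "(?E \<longlongrightarrow> ?I) at_top
    \<and> (?I < \<infinity> \<longleftrightarrow> p < \<alpha>)"
  proof (cases "p < \<alpha>")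
    case True
    \<comment> \<open>p < r < s < \<alpha>: a tail of order s bounds the moment of order r, and r/p
      > 1 is the gain needed for uniform integrability at order p.\<close>
    define s where "s = (p + \<alpha>) / 2"
    define r where "r = (p + s) / 2"
    have s: "p < r" "r < s" "s < \<alpha>" using True by (auto simp: s_def r_def field_simps)
    obtain C where C: "C \<ge> 0" "\<forall>\<^sub>F t in at_top. \<forall>x\<ge>1. measure M {\<omega> \<in> space M. - Y t \<omega> > x} \<le> C * x powr (- s)"
      using lower_tail[of s] s p by auto
    define B where "B = 1 + C * r / (s - r)"
    have B: "B \<ge> 0" using C s p by (auto simp: B_def)
    have bound: "\<forall>\<^sub>F t in at_top. (\<integral>\<^sup>+y. ennreal (((- min y 0) powr p) powr (r / p)) \<partial>distr M borel (Y t)) \<le> ennreal B"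
      using C(2)
    proof eventually_elim
      case (elim t)
      interpret Yd: real_distribution "distr M borel (\<lambda>\<omega>. - Y t \<omega>)" by (rule M.real_distribution_distr) measurable
      have "(\<integral>\<^sup>+y. ennreal (((- min y 0) powr p) powr (r / p)) \<partial>distr M borel (Y t)) = (\<integral>\<^sup>+y. ennreal (max y 0 powr r) \<partial>distr M borel (\<lambda>\<omega>. - Y t \<omega>))"
        using p by (simp add: nn_integral_distr powr_powr) (intro nn_integral_cong, auto simp: max_def min_def)
      also have "\<dots> \<le> ennreal B" unfolding B_def
        by (rule Yd.nn_integral_powr_le_tail) (use s p C(1) elim in \<open>auto simp: measure_distr_Ioi\<close>)
      finally show ?case .
    qed
    have rp: "r / p > 1" using s p by simp
    note L = weakly_convergent.tendsto_nn_integral[OF W rp B eventually_compose_filterlim[OF bound]]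
    have "?I < \<infinity>"
      by (rule L(2)[OF filterlim_real_sequentially filterlim_real_sequentially])
    moreover have "(?E \<longlongrightarrow> ?I) at_top"
    proof (rule tendsto_at_topI_sequentially)
      fix \<tau> :: "nat \<Rightarrow> real" assume \<tau>: "filterlim \<tau> at_top sequentially"
      from L(1)[OF \<tau> \<tau>]
      show "(\<lambda>k. ?E (\<tau> k)) \<longlonglongrightarrow> ?I"
        by (simp add: nn_integral_distr)
    qed
    ultimately show ?thesis using True by simp
  next
    case False
    have "(\<integral>\<^sup>+w. ennreal (\<bar>w\<bar> powr p) \<partial>N') = \<infinity>"
      by (rule N'.stable_abs_moment_infinite[OF alpha _ cf]) (use False in auto)
    hence inf: "?I = \<infinity>"
      using nn_integral_abs_powr_split[of "\<lambda>w. w" N' p] positive_part_limit(2)[OF N' cf p] p by auto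
    have "(?E \<longlongrightarrow> \<infinity>) at_top"
    proof (rule tendsto_at_topI_sequentially)
      fix \<tau> :: "nat \<Rightarrow> real" assume \<tau>: "filterlim \<tau> at_top sequentially"
      from weakly_convergent.tendsto_nn_integral_infinite[OF W[OF \<tau>] inf]
      show "(\<lambda>k. ?E (\<tau> k)) \<longlonglongrightarrow> \<infinity>"
        by (simp add: nn_integral_distr)
    qed
    thus ?thesis using inf False by simp
  qed
  thus "(?E \<longlongrightarrow> ?I) at_top"
    and "?I < \<infinity> \<longleftrightarrow> p < \<alpha>" by blast+
qed

lemma abs_moment_limit:
  assumes N': "real_distribution N'" and cf: "\<And>s. char N' s = stable_cf \<alpha> s" and p: "p > 0"
  shows "((\<lambda>t. \<integral>\<^sup>+\<omega>. ennreal (\<bar>Y t \<omega>\<bar> powr p) \<partial>M) \<longlongrightarrow> (\<integral>\<^sup>+w. ennreal (\<bar>w\<bar> powr p) \<partial>N')) at_top"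
proof -
  interpret N': real_distribution N' by (rule N')
  have "(\<integral>\<^sup>+w. ennreal (\<bar>w\<bar> powr p) \<partial>N') = (\<integral>\<^sup>+w. ennreal (max w 0 powr p) \<partial>N') + (\<integral>\<^sup>+w. ennreal ((- min w 0) powr p) \<partial>N')"
    by (rule nn_integral_abs_powr_split[of "\<lambda>w. w"]) (use p in auto)
  thus ?thesis
    using tendsto_add[OF positive_part_limit(1)[OF N' cf p] negative_part_limit(1)[OF N' cf p]] p
    by (simp add: nn_integral_abs_powr_split)
qed

end

section \<open>Transfer to the original hypotheses and normalisation\<close>

theorem theorem1p4:
  fixes P :: "'a measure" and \<xi> :: "'a \<Rightarrow> real"
    and M :: "'b measure" and X :: "nat \<Rightarrow> 'b \<Rightarrow> real"
    and Q :: "'c measure" and W :: "'c \<Rightarrow> real"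
    and l c a :: "real \<Rightarrow> real" and \<alpha> \<mu> :: real
  assumes P: "prob_space P" and M: "prob_space M" and Q: "prob_space Q"
    and alpha: "1 < \<alpha>" "\<alpha> < 2"
    and slow: "slowly_varying l"
    and xi_meas: "\<xi> \<in> borel_measurable P"
    and xi_pos: "AE \<omega> in P. \<xi> \<omega> > 0"
    and xi_tail: "\<And>t. t > 0 \<Longrightarrow> measure P {\<omega> \<in> space P. \<xi> \<omega> > t} = t powr (- \<alpha>) * l t"
    and mu: "\<mu> = (LINT \<omega>|P. \<xi> \<omega>)"
    and X_indep: "prob_space.indep_vars M (\<lambda>_. borel) X {1..}"
    and X_copy: "\<And>k. k \<ge> 1 \<Longrightarrow> distr M borel (X k) = distr P borel \<xi>"
    and c_pos: "\<And>t. t > 0 \<Longrightarrow> c t > 0"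
    and c_lim: "((\<lambda>t. t * l (c t) * c t powr (- \<alpha>)) \<longlongrightarrow> 1) at_top"
    and a: "\<And>t. a t = \<mu> powr (- (1 + \<alpha>) / \<alpha>) * c t"
    and W_meas: "W \<in> borel_measurable Q"
    and W_char: "\<And>s::real. char (distr Q borel W) s =
        exp (- (complex_of_real (\<bar>s\<bar> powr \<alpha> * Gamma (1 - \<alpha>)) *
          (complex_of_real (cos (pi * \<alpha> / 2)) +
           \<i> * complex_of_real (sin (pi * \<alpha> / 2) * sgn s))))"
  shows
    "(\<forall>\<theta>\<ge>0.
        ((\<lambda>t. \<integral>\<^sup>+\<omega>. ennreal (exp (\<theta> * ((real (first_passage X t \<omega>) - t / \<mu>) / a t))) \<partial>M)
           \<longlongrightarrow> (\<integral>\<^sup>+\<omega>. ennreal (exp (\<theta> * W \<omega>)) \<partial>Q)) at_top \<and>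
        (\<integral>\<^sup>+\<omega>. ennreal (exp (\<theta> * W \<omega>)) \<partial>Q) = ennreal (exp (- Gamma (1 - \<alpha>) * \<theta> powr \<alpha>)))
     \<and>
     (\<forall>p>0.
        ((\<lambda>t. (\<integral>\<^sup>+\<omega>. ennreal (max (real (first_passage X t \<omega>) - t / \<mu>) 0 powr p) \<partial>M)
                / ennreal (a t powr p))
           \<longlongrightarrow> (\<integral>\<^sup>+\<omega>. ennreal (max (W \<omega>) 0 powr p) \<partial>Q)) at_top \<and>
        ((\<lambda>t. (\<integral>\<^sup>+\<omega>. ennreal ((- min (real (first_passage X t \<omega>) - t / \<mu>) 0) powr p) \<partial>M)
                / ennreal (a t powr p))
           \<longlongrightarrow> (\<integral>\<^sup>+\<omega>. ennreal ((- min (W \<omega>) 0) powr p) \<partial>Q)) at_top \<and>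
        (\<integral>\<^sup>+\<omega>. ennreal (max (W \<omega>) 0 powr p) \<partial>Q) < \<infinity> \<and>
        ((\<integral>\<^sup>+\<omega>. ennreal ((- min (W \<omega>) 0) powr p) \<partial>Q) < \<infinity> \<longleftrightarrow> p < \<alpha>))
     \<and>
     (\<forall>p>0.
        ((\<lambda>t. (\<integral>\<^sup>+\<omega>. ennreal (\<bar>real (first_passage X t \<omega>) - t / \<mu>\<bar> powr p) \<partial>M)
                / ennreal (a t powr p))
           \<longlongrightarrow> (\<integral>\<^sup>+\<omega>. ennreal (\<bar>W \<omega>\<bar> powr p) \<partial>Q)) at_top \<and>
        (p < \<alpha> \<longrightarrow>
           (\<integral>\<^sup>+\<omega>. ennreal (\<bar>W \<omega>\<bar> powr p) \<partial>Q) =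
             ennreal (2 * Gamma (p + 1) / (pi * p) * sin (pi * p / 2) * Gamma (1 - p / \<alpha>)
               * \<bar>Gamma (1 - \<alpha>)\<bar> powr (p / \<alpha>) * cos (pi * p / 2 - pi * p / \<alpha>))) \<and>
        (p \<ge> \<alpha> \<longrightarrow> (\<integral>\<^sup>+\<omega>. ennreal (\<bar>W \<omega>\<bar> powr p) \<partial>Q) = \<infinity>))"
proof -
  let ?Z = "\<lambda>t \<omega>. real (first_passage X t \<omega>) - t / \<mu>" and ?E = "\<lambda>f. \<integral>\<^sup>+\<omega>. ennreal (f (W \<omega>)) \<partial>Q"
  interpret P: prob_space P by (rule P)
  interpret Q: prob_space Q by (rule Q)
  note [measurable] = xi_meas W_meas
  define D where "D = distr P borel \<xi>"
  define N' where "N' = distr Q borel W"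
  have N': "real_distribution N'" unfolding N'_def by (rule Q.real_distribution_distr) measurable
  have cf: "char N' s = stable_cf \<alpha> s" for s unfolding N'_def stable_cf_def by (rule W_char)
  have tail: "measure D {t<..} = t powr (- \<alpha>) * l t" if "t > 0" for t
    using xi_tail[OF that] by (simp add: D_def measure_distr vimage_def Int_def conj_commute)
  have l_pos: "\<forall>\<^sub>F t in at_top. l t > 0" and l_lim: "\<And>x. x > 0 \<Longrightarrow> ((\<lambda>t. l (x * t) / l t) \<longlongrightarrow> 1) at_top"
    using slow by (auto simp: slowly_varying_def)
  interpret D: real_distribution D unfolding D_def by (rule P.real_distribution_distr) measurable
  interpret R: regularly_varying_tail D \<alpha>
  proof
    show "AE x in D. 0 < x" unfolding D_def by (subst AE_distr_iff) (use xi_pos in auto)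
    \<comment> \<open>Positivity of \<open>l\<close> is given only for large arguments; monotonicity
      of the tail carries it back to every x.\<close>
    show "measure D {x<..} > 0" for x
    proof -
      have "\<forall>\<^sub>F t in at_top. l t > 0 \<and> t > 0 \<and> t \<ge> x"
        using l_pos eventually_gt_at_top[of 0] eventually_ge_at_top[of x] by eventually_elim simp
      from eventually_happens'[OF trivial_limit_at_top_linorder this]
      obtain t where t: "l t > 0" "t > 0" "t \<ge> x" by blast
      hence "0 < measure D {t<..}" by (simp add: tail)
      also have "\<dots> \<le> measure D {x<..}" using t by (intro D.finite_measure_mono) auto
      finally show ?thesis .
    qed
    show "((\<lambda>x. measure D {x * y<..} / measure D {x<..}) \<longlongrightarrow> y powr (- \<alpha>)) at_top" if y: "y > 0" for y
    proof -
      have "((\<lambda>x. y powr (- \<alpha>) * (l (y * x) / l x)) \<longlongrightarrow> y powr (- \<alpha>) * 1) at_top"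
        by (intro tendsto_intros l_lim y)
      moreover have "\<forall>\<^sub>F x in at_top. y powr (- \<alpha>) * (l (y * x) / l x) = measure D {x * y<..} / measure D {x<..}"
        using eventually_gt_at_top[of 0]
      proof eventually_elim
        case (elim x)
        have "measure D {x * y<..} = x powr (- \<alpha>) * y powr (- \<alpha>) * l (y * x)"
          using tail[of "x * y"] elim y by (simp add: powr_mult mult.commute)
        thus ?case using tail[OF elim] elim by simp
      qed
      ultimately show ?thesis by (auto intro: Lim_transform_eventually)
    qed
  qed (use alpha in auto)
  have "R.\<mu> = (\<integral>x. x \<partial>D)" by (rule R.\<mu>_def)
  also have "\<dots> = \<mu>" unfolding D_def mu by (rule integral_distr) auto
  finally have mu_eq: "R.\<mu> = \<mu>" .
  have mu_pos: "\<mu> > 0" using R.mu_pos mu_eq by simp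
  have Tc: "((\<lambda>t. t * R.T (c t)) \<longlongrightarrow> 1) at_top"
  proof (rule Lim_transform_eventually[OF c_lim])
    show "\<forall>\<^sub>F t in at_top. t * l (c t) * c t powr (- \<alpha>) = t * R.T (c t)"
      using eventually_gt_at_top[of 0] by eventually_elim (simp add: R.T_def tail c_pos)
  qed
  \<comment> \<open>Forced by the norming: wherever c t \<le> z, t T(c t) is at least t T(z), which
    exceeds 2 for large t, while it has to tend to 1.\<close>
  have c_top: "filterlim c at_top at_top"
    unfolding filterlim_at_top_dense
  proof
    fix z :: real
    have "\<forall>\<^sub>F t in at_top. t * R.T (c t) < 2" by (rule order_tendstoD(2)[OF Tc]) simp
    moreover have "\<forall>\<^sub>F t in at_top. t > max 0 (2 / R.T z)" by (rule eventually_gt_at_top)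
    ultimately show "\<forall>\<^sub>F t in at_top. c t > z"
    proof eventually_elim
      case (elim t)
      have "2 < t * R.T z" using elim R.T_pos[of z] by (simp add: field_simps)
      hence "t * R.T (c t) < t * R.T z" using elim by linarith
      hence "R.T (c t) < R.T z" using elim by simp
      thus ?case using R.T_antimono[of "c t" z] by linarith
    qed
  qed
  \<comment> \<open>Chosen so that y powr (-\<alpha>) = \<mu>: scaling c by y multiplies the tail by
    \<mu> in the limit and turns t T(c t) -> 1 into t/\<mu> T(b t) -> 1. Dividing b by \<mu> then
    adds -1 to the exponent -1/\<alpha>, which explains the exponent -(1 + \<alpha>)/\<alpha> in
    \<open>a\<close>.\<close>
  define y where "y = \<mu> powr (- (1 / \<alpha>))"
  have y: "y > 0" using mu_pos by (simp add: y_def)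
  have y\<alpha>: "y powr (- \<alpha>) = \<mu>" using mu_pos alpha by (simp add: y_def powr_powr)
  define b where "b t = c t * y" for t
  have a_eq: "a t = b t / \<mu>" for t
  proof -
    have "- (1 + \<alpha>) / \<alpha> = - (1 / \<alpha>) - 1" using alpha by (simp add: field_simps)
    thus ?thesis using mu_pos by (simp add: a b_def y_def powr_diff)
  qed
  interpret R: normed_tail D \<alpha> b
  proof
    show "b t > 0" if "t > 0" for t using c_pos[OF that] y by (simp add: b_def)
    have "filterlim (\<lambda>t. y * c t) at_top at_top"
      by (rule filterlim_tendsto_pos_mult_at_top[OF tendsto_const y c_top])
    thus "filterlim b at_top at_top" by (simp add: b_def[abs_def] mult.commute)
    have "((\<lambda>t. R.T (c t * y) / R.T (c t)) \<longlongrightarrow> \<mu>) at_top"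
      using filterlim_compose[OF R.tail_rv[OF y] c_top] by (simp add: R.T_def y\<alpha>)
    hence "((\<lambda>t. (t * R.T (c t)) * (R.T (c t * y) / R.T (c t)) / \<mu>) \<longlongrightarrow> 1 * \<mu> / \<mu>) at_top"
      by (rule tendsto_divide[OF tendsto_mult[OF Tc] tendsto_const]) (use mu_pos in auto)
    moreover have "(t * R.T (c t)) * (R.T (c t * y) / R.T (c t)) / \<mu> = t / R.\<mu> * R.T (b t)" for t
      using R.T_pos[of "c t"] by (simp add: b_def mu_eq)
    ultimately show "((\<lambda>t. t / R.\<mu> * R.T (b t)) \<longlongrightarrow> 1) at_top" using mu_pos by simp
  qed
  interpret M: prob_space M by (rule M)
  interpret R: renewal D \<alpha> b M X
    by unfold_locales (use X_indep X_copy in \<open>auto simp: D_def\<close>)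
  have Y: "(?Z t \<omega>) / a t = R.Y t \<omega>" for t \<omega>
    by (simp add: R.Y_def a_eq mu_eq)
  have a_pos: "a t > 0" if "t > 0" for t using R.b_pos[OF that] mu_pos by (simp add: a_eq)
  have nnQ: "(\<integral>\<^sup>+w. ennreal (f w) \<partial>N') = (\<integral>\<^sup>+\<omega>. ennreal (f (W \<omega>)) \<partial>Q)" if "f \<in> borel_measurable borel" for f
    unfolding N'_def using that by (subst nn_integral_distr) auto
  \<comment> \<open>The three power functions are positively homogeneous of degree p, so dividing by
    a t powr p amounts to replacing N(t) - t/\<mu> by the normalised variable; for t > 0 the divisor
    is positive and finite.\<close>
  have scale: "((\<lambda>t. (\<integral>\<^sup>+\<omega>. ennreal (f (?Z t \<omega>)) \<partial>M) / ennreal (a t powr p)) \<longlongrightarrow> L) at_top"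
    if lim: "((\<lambda>t. \<integral>\<^sup>+\<omega>. ennreal (f (R.Y t \<omega>)) \<partial>M) \<longlongrightarrow> L) at_top"
      and hom: "\<And>s v. s > 0 \<Longrightarrow> f (s * v) = s powr p * f v" and [measurable]: "f \<in> borel_measurable borel" for f p L
  proof (rule Lim_transform_eventually[OF lim])
    show "\<forall>\<^sub>F t in at_top. (\<integral>\<^sup>+\<omega>. ennreal (f (R.Y t \<omega>)) \<partial>M) = (\<integral>\<^sup>+\<omega>. ennreal (f (?Z t \<omega>)) \<partial>M) / ennreal (a t powr p)"
      using eventually_gt_at_top[of 0]
    proof eventually_elim
      case (elim t)
      have "real (first_passage X t \<omega>) - t / \<mu> = a t * R.Y t \<omega>" for \<omega>
        using a_pos[OF elim] by (simp flip: Y)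
      hence "(\<integral>\<^sup>+\<omega>. ennreal (f (?Z t \<omega>)) \<partial>M) = (\<integral>\<^sup>+\<omega>. ennreal (a t powr p) * ennreal (f (R.Y t \<omega>)) \<partial>M)"
        using a_pos[OF elim] by (simp add: hom ennreal_mult')
      also have "\<dots> = ennreal (a t powr p) * (\<integral>\<^sup>+\<omega>. ennreal (f (R.Y t \<omega>)) \<partial>M)"
        by (rule nn_integral_cmult) measurable
      finally show ?case
        using a_pos[OF elim] by (simp add: ennreal_mult_divide_eq mult.commute[of "ennreal (a t powr p)"])
    qed
  qed
  have hom_max: "max (s * v) 0 powr p = s powr p * max v 0 powr p"
    and hom_min: "(- min (s * v) 0) powr p = s powr p * (- min v 0) powr p"
    and hom_abs: "\<bar>s * v\<bar> powr p = s powr p * \<bar>v\<bar> powr p" if "s > 0" for s v p :: real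
  proof -
    have "max (s * v) 0 = s * max v 0" "- min (s * v) 0 = s * (- min v 0)" "\<bar>s * v\<bar> = s * \<bar>v\<bar>"
      using that by (auto simp: max_def min_def abs_mult mult_le_0_iff zero_le_mult_iff)
    thus "max (s * v) 0 powr p = s powr p * max v 0 powr p" "(- min (s * v) 0) powr p = s powr p * (- min v 0) powr p"
      "\<bar>s * v\<bar> powr p = s powr p * \<bar>v\<bar> powr p"
      using that by (simp_all only: powr_mult)
  qed
  show ?thesis
  proof (intro conjI allI impI)
    fix \<theta> :: real assume \<theta>: "\<theta> \<ge> 0"
    show "((\<lambda>t. \<integral>\<^sup>+\<omega>. ennreal (exp (\<theta> * ((?Z t \<omega>) / a t))) \<partial>M)
           \<longlongrightarrow> ?E (\<lambda>w. exp (\<theta> * w))) at_top"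
      using R.exp_moment_limit[OF N' cf \<theta>] unfolding Y by (subst (asm) nnQ) auto
    show "?E (\<lambda>w. exp (\<theta> * w)) = ennreal (exp (- Gamma (1 - \<alpha>) * \<theta> powr \<alpha>))"
      using R.stable_exp_moment[OF N' cf \<theta>] by (subst (asm) nnQ) auto
  next
    fix p :: real assume p: "p > 0"
    show "((\<lambda>t. (\<integral>\<^sup>+\<omega>. ennreal (max (?Z t \<omega>) 0 powr p) \<partial>M) / ennreal (a t powr p))
           \<longlongrightarrow> ?E (\<lambda>w. max w 0 powr p)) at_top"
      by (rule scale) (use R.positive_part_limit(1)[OF N' cf p] hom_max in \<open>auto simp: nnQ\<close>)
    show "((\<lambda>t. (\<integral>\<^sup>+\<omega>. ennreal ((- min (?Z t \<omega>) 0) powr p) \<partial>M) / ennreal (a t powr p))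
           \<longlongrightarrow> ?E (\<lambda>w. (- min w 0) powr p)) at_top"
      by (rule scale[of "\<lambda>v. (- min v 0) powr p"]) (use R.negative_part_limit(1)[OF N' cf p] hom_min in \<open>auto simp: nnQ\<close>)
    show "?E (\<lambda>w. max w 0 powr p) < \<infinity>"
      using R.positive_part_limit(2)[OF N' cf p] by (subst (asm) nnQ) auto
    have neg: "(\<integral>\<^sup>+w. ennreal ((- min w 0) powr p) \<partial>N') = ?E (\<lambda>w. (- min w 0) powr p)"
      by (rule nnQ) measurable
    show "?E (\<lambda>w. (- min w 0) powr p) < \<infinity> \<longleftrightarrow> p < \<alpha>"
      using R.negative_part_limit(2)[OF N' cf p] unfolding neg .
    show "((\<lambda>t. (\<integral>\<^sup>+\<omega>. ennreal (\<bar>real (first_passage X t \<omega>) - t / \<mu>\<bar> powr p) \<partial>M) / ennreal (a t powr p))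
           \<longlongrightarrow> ?E (\<lambda>w. \<bar>w\<bar> powr p)) at_top"
      by (rule scale[of "\<lambda>v. \<bar>v\<bar> powr p"]) (use R.abs_moment_limit[OF N' cf p] hom_abs in \<open>auto simp: nnQ\<close>)
    have abs: "(\<integral>\<^sup>+w. ennreal (\<bar>w\<bar> powr p) \<partial>N') = ?E (\<lambda>w. \<bar>w\<bar> powr p)"
      by (rule nnQ) measurable
    show "?E (\<lambda>w. \<bar>w\<bar> powr p) =
             ennreal (2 * Gamma (p + 1) / (pi * p) * sin (pi * p / 2) * Gamma (1 - p / \<alpha>)
               * \<bar>Gamma (1 - \<alpha>)\<bar> powr (p / \<alpha>) * cos (pi * p / 2 - pi * p / \<alpha>))" if "p < \<alpha>"
      using real_distribution.stable_abs_moment[OF N' alpha p that cf] unfolding abs .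
    show "?E (\<lambda>w. \<bar>w\<bar> powr p) = \<infinity>" if "p \<ge> \<alpha>"
      using real_distribution.stable_abs_moment_infinite[OF N' alpha that cf] unfolding abs .
  qed
qed

end
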